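(* In $\mathsf{ITT}$, the following are logically equivalent: (1) for all types $A,B$, the map $\mathrm{CEqToEq}:(A\cong B)\to(A\simeq B)$ is an equivalence; (2) for all types $A,B$, $\mathrm{CEqToEq}:(A\cong B)\to(A\simeq B)$ admits a homotopy section; (3) for all types $A,B$ and every $f:A\to B$, the type $\mathrm{isEquiv}(f)$ is a proposition; (4) for every type $A$ and $f:A\to A$, if $f\sim\mathrm{id}_A$ then $f=\mathrm{id}_A$; (5) for all types $A,B$ and every $f:A\to B$, we have $\mathrm{isEquiv}(f)\to\mathrm{isCEq}(f)$; (6) for all types $A,B$ and every $f:A\to B$, we have $\mathrm{isEquiv}(f)\to\mathrm{isEquiv}(f_* )$, where $f_*:(X\to A)\to(X\to B)$ is post-composition with $f$, for every type $X$; (7) (weak function extensionality) for every family of contractible types $a:A\vdash P(a)$, the type $\prod_{a:A}P(a)$ is contractible; (8) (function extensionality) for every family $a:A\vdash B(a)$ and $f,g:\prod_{a:A}B(a)$, the canonical map $(f=g)\to(f\sim g)$ is an equivalence.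
   Context: $\mathsf{ITT}$ is intensional Martin-Löf type theory with $\Sigma$, $\Pi$, intensional identity types, binary coproducts, empty and unit types and a universe, with strict $\beta$-rules and strict $\eta$-rules for $\Sigma$, $\Pi$ and unit types. "Types" here range over all (possibly large) types. $f\sim g:=\prod_{a}fa=ga$. $\mathrm{isEquiv}(f)$ is the type of $(s,S,r,R)$ with $s,r:B\to A$, $S:f\circ s\sim\mathrm{id}_B$, $R:r\circ f\sim\mathrm{id}_A$; $A\simeq B:=\sum_{f}\mathrm{isEquiv}(f)$. $\mathrm{isCEq}(f)$ is the type of $(s,S,r,R)$ with $S: f\circ s =_{B\to B}\mathrm{id}_B$ and $R: r\circ f=_{A\to A}\mathrm{id}_A$ (categorical equivalence); $A\cong B:=\sum_f \mathrm{isCEq}(f)$. $\mathrm{CEqToEq}$ sends $(f,s,S,r,R)$ to $(f,s,\mathrm{happly}(S),r,\mathrm{happly}(R))$, where $\mathrm{happly}:(g=h)\to(g\sim h)$ is defined by path induction. *)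

theory Defs
  imports Main
begin

section \<open>Raw syntax of intensional type theory\<close>

text \<open>
  Terms and types share one syntactic class (the universe is in the style of Russell), with de Bruijn
  indices. Constants from \<^typ>\<open>'c\<close> are the postulated axioms of an extension of the theory.
  Binding arities: \<open>Pi A B\<close>, \<open>Sig A B\<close> and \<open>Lam A b\<close> bind one variable in the second argument;
  \<open>J a C d b p\<close> binds two variables in \<open>C\<close> (index \<open>1\<close> is the endpoint, index \<open>0\<close> the path);
  \<open>Case C l r s\<close> binds one variable in each of \<open>C\<close>, \<open>l\<close>, \<open>r\<close>;
  \<open>Abort C e\<close> binds one variable in \<open>C\<close>.
\<close>

datatype 'c expr =
    Var nat
  | Const 'c
  | U
  | Pi "'c expr" "'c expr"
  | Lam "'c expr" "'c expr"
  | App "'c expr" "'c expr"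
  | Sig "'c expr" "'c expr"
  | Pair "'c expr" "'c expr"
  | Fst "'c expr"
  | Snd "'c expr"
  | Idt "'c expr" "'c expr" "'c expr"
  | Refl "'c expr"
  | J "'c expr" "'c expr" "'c expr" "'c expr" "'c expr"
  | Sum "'c expr" "'c expr"
  | Inl "'c expr"
  | Inr "'c expr"
  | Case "'c expr" "'c expr" "'c expr" "'c expr"
  | Empty
  | Abort "'c expr" "'c expr"
  | Unit
  | Star

definition upr :: "(nat \<Rightarrow> nat) \<Rightarrow> nat \<Rightarrow> nat" where
  "upr \<rho> = case_nat 0 (\<lambda>i. Suc (\<rho> i))"

primrec ren :: "(nat \<Rightarrow> nat) \<Rightarrow> 'c expr \<Rightarrow> 'c expr" where
  "ren \<rho> (Var i) = Var (\<rho> i)"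
| "ren \<rho> (Const c) = Const c"
| "ren \<rho> U = U"
| "ren \<rho> (Pi A B) = Pi (ren \<rho> A) (ren (upr \<rho>) B)"
| "ren \<rho> (Lam A b) = Lam (ren \<rho> A) (ren (upr \<rho>) b)"
| "ren \<rho> (App f a) = App (ren \<rho> f) (ren \<rho> a)"
| "ren \<rho> (Sig A B) = Sig (ren \<rho> A) (ren (upr \<rho>) B)"
| "ren \<rho> (Pair a b) = Pair (ren \<rho> a) (ren \<rho> b)"
| "ren \<rho> (Fst p) = Fst (ren \<rho> p)"
| "ren \<rho> (Snd p) = Snd (ren \<rho> p)"
| "ren \<rho> (Idt A a b) = Idt (ren \<rho> A) (ren \<rho> a) (ren \<rho> b)"
| "ren \<rho> (Refl a) = Refl (ren \<rho> a)"
| "ren \<rho> (J a C d b p) = J (ren \<rho> a) (ren (upr (upr \<rho>)) C) (ren \<rho> d) (ren \<rho> b) (ren \<rho> p)"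
| "ren \<rho> (Sum A B) = Sum (ren \<rho> A) (ren \<rho> B)"
| "ren \<rho> (Inl a) = Inl (ren \<rho> a)"
| "ren \<rho> (Inr b) = Inr (ren \<rho> b)"
| "ren \<rho> (Case C l r s) = Case (ren (upr \<rho>) C) (ren (upr \<rho>) l) (ren (upr \<rho>) r) (ren \<rho> s)"
| "ren \<rho> Empty = Empty"
| "ren \<rho> (Abort C e) = Abort (ren (upr \<rho>) C) (ren \<rho> e)"
| "ren \<rho> Unit = Unit"
| "ren \<rho> Star = Star"

definition ups :: "(nat \<Rightarrow> 'c expr) \<Rightarrow> nat \<Rightarrow> 'c expr" where
  "ups \<sigma> = case_nat (Var 0) (\<lambda>i. ren Suc (\<sigma> i))"

primrec sub :: "(nat \<Rightarrow> 'c expr) \<Rightarrow> 'c expr \<Rightarrow> 'c expr" where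
  "sub \<sigma> (Var i) = \<sigma> i"
| "sub \<sigma> (Const c) = Const c"
| "sub \<sigma> U = U"
| "sub \<sigma> (Pi A B) = Pi (sub \<sigma> A) (sub (ups \<sigma>) B)"
| "sub \<sigma> (Lam A b) = Lam (sub \<sigma> A) (sub (ups \<sigma>) b)"
| "sub \<sigma> (App f a) = App (sub \<sigma> f) (sub \<sigma> a)"
| "sub \<sigma> (Sig A B) = Sig (sub \<sigma> A) (sub (ups \<sigma>) B)"
| "sub \<sigma> (Pair a b) = Pair (sub \<sigma> a) (sub \<sigma> b)"
| "sub \<sigma> (Fst p) = Fst (sub \<sigma> p)"
| "sub \<sigma> (Snd p) = Snd (sub \<sigma> p)"
| "sub \<sigma> (Idt A a b) = Idt (sub \<sigma> A) (sub \<sigma> a) (sub \<sigma> b)"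
| "sub \<sigma> (Refl a) = Refl (sub \<sigma> a)"
| "sub \<sigma> (J a C d b p) = J (sub \<sigma> a) (sub (ups (ups \<sigma>)) C) (sub \<sigma> d) (sub \<sigma> b) (sub \<sigma> p)"
| "sub \<sigma> (Sum A B) = Sum (sub \<sigma> A) (sub \<sigma> B)"
| "sub \<sigma> (Inl a) = Inl (sub \<sigma> a)"
| "sub \<sigma> (Inr b) = Inr (sub \<sigma> b)"
| "sub \<sigma> (Case C l r s) = Case (sub (ups \<sigma>) C) (sub (ups \<sigma>) l) (sub (ups \<sigma>) r) (sub \<sigma> s)"
| "sub \<sigma> Empty = Empty"
| "sub \<sigma> (Abort C e) = Abort (sub (ups \<sigma>) C) (sub \<sigma> e)"
| "sub \<sigma> Unit = Unit"
| "sub \<sigma> Star = Star"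

text \<open>\<open>wk n\<close> weakens by \<open>n\<close> variables; \<open>wk1 n\<close> does so below one binder.\<close>

definition wk :: "nat \<Rightarrow> 'c expr \<Rightarrow> 'c expr" where
  "wk n = ren (\<lambda>i. i + n)"

definition wk1 :: "nat \<Rightarrow> 'c expr \<Rightarrow> 'c expr" where
  "wk1 n = ren (upr (\<lambda>i. i + n))"

definition inst :: "'c expr \<Rightarrow> 'c expr \<Rightarrow> 'c expr" where
  "inst B a = sub (case_nat a Var) B"

definition inst2 :: "'c expr \<Rightarrow> 'c expr \<Rightarrow> 'c expr \<Rightarrow> 'c expr" where
  "inst2 C b p = sub (case_nat p (case_nat b Var)) C"

text \<open>\<open>reind C t\<close> replaces the variable \<open>0\<close> of \<open>C\<close> by \<open>t\<close>, where \<open>t\<close> again lives in a context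
  extended by one variable.\<close>

definition reind :: "'c expr \<Rightarrow> 'c expr \<Rightarrow> 'c expr" where
  "reind C t = sub (case_nat t (\<lambda>i. Var (Suc i))) C"


section \<open>The theory ITT and its extensions by axioms\<close>

text \<open>
  Contexts are lists with the most recent variable at the head.
  The parameter \<open>\<S>\<close> is a signature of closed typed constants; a constant can only be used once its
  type has been derived. With the empty signature the judgements are those of ITT itself;
  in general they are those of ITT extended by the axioms in \<open>\<S>\<close>. Extending by an axiom scheme
  amounts to having one constant per instance, of type the \<open>\<Pi>\<close>-closure of that instance over its
  context.

  The substitution rules quantify over all context morphisms \<open>\<sigma> : \<Delta> \<rightarrow> \<Gamma>\<close>; weakening and
  substitution of a single term are the usual special cases.
  Identity types have based path induction. \<open>\<Sigma>\<close> and the unit type are presented by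
  projections and \<open>\<eta>\<close>, from which their dependent eliminators are definable.
\<close>

inductive
      ctx :: "('c \<rightharpoonup> 'c expr) \<Rightarrow> 'c expr list \<Rightarrow> bool"
  and ty :: "('c \<rightharpoonup> 'c expr) \<Rightarrow> 'c expr list \<Rightarrow> 'c expr \<Rightarrow> bool"
  and tyeq :: "('c \<rightharpoonup> 'c expr) \<Rightarrow> 'c expr list \<Rightarrow> 'c expr \<Rightarrow> 'c expr \<Rightarrow> bool"
  and tm :: "('c \<rightharpoonup> 'c expr) \<Rightarrow> 'c expr list \<Rightarrow> 'c expr \<Rightarrow> 'c expr \<Rightarrow> bool"
  and tmeq :: "('c \<rightharpoonup> 'c expr) \<Rightarrow> 'c expr list \<Rightarrow> 'c expr \<Rightarrow> 'c expr \<Rightarrow> 'c expr \<Rightarrow> bool"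
  for \<S> :: "'c \<rightharpoonup> 'c expr"
where
  ctx_nil: "ctx \<S> []"
| ctx_cons: "\<lbrakk>ctx \<S> \<Gamma>; ty \<S> \<Gamma> A\<rbrakk> \<Longrightarrow> ctx \<S> (A # \<Gamma>)"
| tm_var: "\<lbrakk>ctx \<S> \<Gamma>; i < length \<Gamma>\<rbrakk> \<Longrightarrow> tm \<S> \<Gamma> (Var i) (wk (Suc i) (\<Gamma> ! i))"
| tm_const: "\<lbrakk>\<S> c = Some A; ty \<S> [] A\<rbrakk> \<Longrightarrow> tm \<S> [] (Const c) A"

| ty_sub: "\<lbrakk>ty \<S> \<Gamma> A; ctx \<S> \<Delta>;
    \<forall>i<length \<Gamma>. tm \<S> \<Delta> (\<sigma> i) (sub (\<lambda>k. \<sigma> (k + Suc i)) (\<Gamma> ! i))\<rbrakk>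
    \<Longrightarrow> ty \<S> \<Delta> (sub \<sigma> A)"
| tyeq_sub: "\<lbrakk>tyeq \<S> \<Gamma> A B; ctx \<S> \<Delta>;
    \<forall>i<length \<Gamma>. tm \<S> \<Delta> (\<sigma> i) (sub (\<lambda>k. \<sigma> (k + Suc i)) (\<Gamma> ! i))\<rbrakk>
    \<Longrightarrow> tyeq \<S> \<Delta> (sub \<sigma> A) (sub \<sigma> B)"
| tm_sub: "\<lbrakk>tm \<S> \<Gamma> t A; ctx \<S> \<Delta>;
    \<forall>i<length \<Gamma>. tm \<S> \<Delta> (\<sigma> i) (sub (\<lambda>k. \<sigma> (k + Suc i)) (\<Gamma> ! i))\<rbrakk>
    \<Longrightarrow> tm \<S> \<Delta> (sub \<sigma> t) (sub \<sigma> A)"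
| tmeq_sub: "\<lbrakk>tmeq \<S> \<Gamma> t u A; ctx \<S> \<Delta>;
    \<forall>i<length \<Gamma>. tm \<S> \<Delta> (\<sigma> i) (sub (\<lambda>k. \<sigma> (k + Suc i)) (\<Gamma> ! i))\<rbrakk>
    \<Longrightarrow> tmeq \<S> \<Delta> (sub \<sigma> t) (sub \<sigma> u) (sub \<sigma> A)"
| ty_sub_cong: "\<lbrakk>ty \<S> \<Gamma> A; ctx \<S> \<Delta>;
    \<forall>i<length \<Gamma>. tm \<S> \<Delta> (\<sigma> i) (sub (\<lambda>k. \<sigma> (k + Suc i)) (\<Gamma> ! i));
    \<forall>i<length \<Gamma>. tm \<S> \<Delta> (\<tau> i) (sub (\<lambda>k. \<tau> (k + Suc i)) (\<Gamma> ! i));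
    \<forall>i<length \<Gamma>. tmeq \<S> \<Delta> (\<sigma> i) (\<tau> i) (sub (\<lambda>k. \<sigma> (k + Suc i)) (\<Gamma> ! i))\<rbrakk>
    \<Longrightarrow> tyeq \<S> \<Delta> (sub \<sigma> A) (sub \<tau> A)"
| tm_sub_cong: "\<lbrakk>tm \<S> \<Gamma> t A; ctx \<S> \<Delta>;
    \<forall>i<length \<Gamma>. tm \<S> \<Delta> (\<sigma> i) (sub (\<lambda>k. \<sigma> (k + Suc i)) (\<Gamma> ! i));
    \<forall>i<length \<Gamma>. tm \<S> \<Delta> (\<tau> i) (sub (\<lambda>k. \<tau> (k + Suc i)) (\<Gamma> ! i));
    \<forall>i<length \<Gamma>. tmeq \<S> \<Delta> (\<sigma> i) (\<tau> i) (sub (\<lambda>k. \<sigma> (k + Suc i)) (\<Gamma> ! i))\<rbrakk>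
    \<Longrightarrow> tmeq \<S> \<Delta> (sub \<sigma> t) (sub \<tau> t) (sub \<sigma> A)"

| tyeq_refl: "ty \<S> \<Gamma> A \<Longrightarrow> tyeq \<S> \<Gamma> A A"
| tyeq_sym: "tyeq \<S> \<Gamma> A B \<Longrightarrow> tyeq \<S> \<Gamma> B A"
| tyeq_trans: "\<lbrakk>tyeq \<S> \<Gamma> A B; tyeq \<S> \<Gamma> B C\<rbrakk> \<Longrightarrow> tyeq \<S> \<Gamma> A C"
| tmeq_refl: "tm \<S> \<Gamma> t A \<Longrightarrow> tmeq \<S> \<Gamma> t t A"
| tmeq_sym: "tmeq \<S> \<Gamma> t u A \<Longrightarrow> tmeq \<S> \<Gamma> u t A"
| tmeq_trans: "\<lbrakk>tmeq \<S> \<Gamma> t u A; tmeq \<S> \<Gamma> u v A\<rbrakk> \<Longrightarrow> tmeq \<S> \<Gamma> t v A"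
| tm_conv: "\<lbrakk>tm \<S> \<Gamma> t A; tyeq \<S> \<Gamma> A B\<rbrakk> \<Longrightarrow> tm \<S> \<Gamma> t B"
| tmeq_conv: "\<lbrakk>tmeq \<S> \<Gamma> t u A; tyeq \<S> \<Gamma> A B\<rbrakk> \<Longrightarrow> tmeq \<S> \<Gamma> t u B"

| U_form: "ctx \<S> \<Gamma> \<Longrightarrow> ty \<S> \<Gamma> U"
| El: "tm \<S> \<Gamma> A U \<Longrightarrow> ty \<S> \<Gamma> A"
| El_cong: "tmeq \<S> \<Gamma> A B U \<Longrightarrow> tyeq \<S> \<Gamma> A B"

| Pi_form: "\<lbrakk>ty \<S> \<Gamma> A; ty \<S> (A # \<Gamma>) B\<rbrakk> \<Longrightarrow> ty \<S> \<Gamma> (Pi A B)"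
| Pi_cong: "\<lbrakk>ty \<S> \<Gamma> A; ty \<S> (A # \<Gamma>) B; tyeq \<S> \<Gamma> A A'; tyeq \<S> (A # \<Gamma>) B B'\<rbrakk>
    \<Longrightarrow> tyeq \<S> \<Gamma> (Pi A B) (Pi A' B')"
| Pi_U: "\<lbrakk>tm \<S> \<Gamma> A U; tm \<S> (A # \<Gamma>) B U\<rbrakk> \<Longrightarrow> tm \<S> \<Gamma> (Pi A B) U"
| Pi_U_cong: "\<lbrakk>tm \<S> \<Gamma> A U; tm \<S> (A # \<Gamma>) B U; tmeq \<S> \<Gamma> A A' U; tmeq \<S> (A # \<Gamma>) B B' U\<rbrakk>
    \<Longrightarrow> tmeq \<S> \<Gamma> (Pi A B) (Pi A' B') U"
| Lam: "\<lbrakk>ty \<S> \<Gamma> A; ty \<S> (A # \<Gamma>) B; tm \<S> (A # \<Gamma>) b B\<rbrakk> \<Longrightarrow> tm \<S> \<Gamma> (Lam A b) (Pi A B)"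
| Lam_cong: "\<lbrakk>ty \<S> \<Gamma> A; ty \<S> (A # \<Gamma>) B; tyeq \<S> \<Gamma> A A'; tmeq \<S> (A # \<Gamma>) b b' B\<rbrakk>
    \<Longrightarrow> tmeq \<S> \<Gamma> (Lam A b) (Lam A' b') (Pi A B)"
| App: "\<lbrakk>ty \<S> \<Gamma> A; ty \<S> (A # \<Gamma>) B; tm \<S> \<Gamma> f (Pi A B); tm \<S> \<Gamma> a A\<rbrakk>
    \<Longrightarrow> tm \<S> \<Gamma> (App f a) (inst B a)"
| App_cong: "\<lbrakk>ty \<S> \<Gamma> A; ty \<S> (A # \<Gamma>) B; tmeq \<S> \<Gamma> f f' (Pi A B); tmeq \<S> \<Gamma> a a' A\<rbrakk>
    \<Longrightarrow> tmeq \<S> \<Gamma> (App f a) (App f' a') (inst B a)"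
| Pi_beta: "\<lbrakk>ty \<S> \<Gamma> A; ty \<S> (A # \<Gamma>) B; tm \<S> (A # \<Gamma>) b B; tm \<S> \<Gamma> a A\<rbrakk>
    \<Longrightarrow> tmeq \<S> \<Gamma> (App (Lam A b) a) (inst b a) (inst B a)"
| Pi_eta: "\<lbrakk>ty \<S> \<Gamma> A; ty \<S> (A # \<Gamma>) B; tm \<S> \<Gamma> f (Pi A B)\<rbrakk>
    \<Longrightarrow> tmeq \<S> \<Gamma> f (Lam A (App (wk 1 f) (Var 0))) (Pi A B)"

| Sig_form: "\<lbrakk>ty \<S> \<Gamma> A; ty \<S> (A # \<Gamma>) B\<rbrakk> \<Longrightarrow> ty \<S> \<Gamma> (Sig A B)"
| Sig_cong: "\<lbrakk>ty \<S> \<Gamma> A; ty \<S> (A # \<Gamma>) B; tyeq \<S> \<Gamma> A A'; tyeq \<S> (A # \<Gamma>) B B'\<rbrakk>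
    \<Longrightarrow> tyeq \<S> \<Gamma> (Sig A B) (Sig A' B')"
| Sig_U: "\<lbrakk>tm \<S> \<Gamma> A U; tm \<S> (A # \<Gamma>) B U\<rbrakk> \<Longrightarrow> tm \<S> \<Gamma> (Sig A B) U"
| Sig_U_cong: "\<lbrakk>tm \<S> \<Gamma> A U; tm \<S> (A # \<Gamma>) B U; tmeq \<S> \<Gamma> A A' U; tmeq \<S> (A # \<Gamma>) B B' U\<rbrakk>
    \<Longrightarrow> tmeq \<S> \<Gamma> (Sig A B) (Sig A' B') U"
| Pair: "\<lbrakk>ty \<S> \<Gamma> A; ty \<S> (A # \<Gamma>) B; tm \<S> \<Gamma> a A; tm \<S> \<Gamma> b (inst B a)\<rbrakk>
    \<Longrightarrow> tm \<S> \<Gamma> (Pair a b) (Sig A B)"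
| Pair_cong: "\<lbrakk>ty \<S> \<Gamma> A; ty \<S> (A # \<Gamma>) B; tmeq \<S> \<Gamma> a a' A; tmeq \<S> \<Gamma> b b' (inst B a)\<rbrakk>
    \<Longrightarrow> tmeq \<S> \<Gamma> (Pair a b) (Pair a' b') (Sig A B)"
| Fst: "\<lbrakk>ty \<S> \<Gamma> A; ty \<S> (A # \<Gamma>) B; tm \<S> \<Gamma> p (Sig A B)\<rbrakk> \<Longrightarrow> tm \<S> \<Gamma> (Fst p) A"
| Fst_cong: "\<lbrakk>ty \<S> \<Gamma> A; ty \<S> (A # \<Gamma>) B; tmeq \<S> \<Gamma> p p' (Sig A B)\<rbrakk>
    \<Longrightarrow> tmeq \<S> \<Gamma> (Fst p) (Fst p') A"
| Snd: "\<lbrakk>ty \<S> \<Gamma> A; ty \<S> (A # \<Gamma>) B; tm \<S> \<Gamma> p (Sig A B)\<rbrakk>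
    \<Longrightarrow> tm \<S> \<Gamma> (Snd p) (inst B (Fst p))"
| Snd_cong: "\<lbrakk>ty \<S> \<Gamma> A; ty \<S> (A # \<Gamma>) B; tmeq \<S> \<Gamma> p p' (Sig A B)\<rbrakk>
    \<Longrightarrow> tmeq \<S> \<Gamma> (Snd p) (Snd p') (inst B (Fst p))"
| Sig_beta1: "\<lbrakk>ty \<S> \<Gamma> A; ty \<S> (A # \<Gamma>) B; tm \<S> \<Gamma> a A; tm \<S> \<Gamma> b (inst B a)\<rbrakk>
    \<Longrightarrow> tmeq \<S> \<Gamma> (Fst (Pair a b)) a A"
| Sig_beta2: "\<lbrakk>ty \<S> \<Gamma> A; ty \<S> (A # \<Gamma>) B; tm \<S> \<Gamma> a A; tm \<S> \<Gamma> b (inst B a)\<rbrakk>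
    \<Longrightarrow> tmeq \<S> \<Gamma> (Snd (Pair a b)) b (inst B a)"
| Sig_eta: "\<lbrakk>ty \<S> \<Gamma> A; ty \<S> (A # \<Gamma>) B; tm \<S> \<Gamma> p (Sig A B)\<rbrakk>
    \<Longrightarrow> tmeq \<S> \<Gamma> p (Pair (Fst p) (Snd p)) (Sig A B)"

| Id_form: "\<lbrakk>ty \<S> \<Gamma> A; tm \<S> \<Gamma> a A; tm \<S> \<Gamma> b A\<rbrakk> \<Longrightarrow> ty \<S> \<Gamma> (Idt A a b)"
| Id_cong: "\<lbrakk>tyeq \<S> \<Gamma> A A'; tmeq \<S> \<Gamma> a a' A; tmeq \<S> \<Gamma> b b' A\<rbrakk>
    \<Longrightarrow> tyeq \<S> \<Gamma> (Idt A a b) (Idt A' a' b')"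
| Id_U: "\<lbrakk>tm \<S> \<Gamma> A U; tm \<S> \<Gamma> a A; tm \<S> \<Gamma> b A\<rbrakk> \<Longrightarrow> tm \<S> \<Gamma> (Idt A a b) U"
| Id_U_cong: "\<lbrakk>tmeq \<S> \<Gamma> A A' U; tmeq \<S> \<Gamma> a a' A; tmeq \<S> \<Gamma> b b' A\<rbrakk>
    \<Longrightarrow> tmeq \<S> \<Gamma> (Idt A a b) (Idt A' a' b') U"
| Refl: "\<lbrakk>ty \<S> \<Gamma> A; tm \<S> \<Gamma> a A\<rbrakk> \<Longrightarrow> tm \<S> \<Gamma> (Refl a) (Idt A a a)"
| Refl_cong: "\<lbrakk>ty \<S> \<Gamma> A; tmeq \<S> \<Gamma> a a' A\<rbrakk> \<Longrightarrow> tmeq \<S> \<Gamma> (Refl a) (Refl a') (Idt A a a)"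
| J: "\<lbrakk>ty \<S> \<Gamma> A; tm \<S> \<Gamma> a A; ty \<S> (Idt (wk 1 A) (wk 1 a) (Var 0) # A # \<Gamma>) C;
    tm \<S> \<Gamma> d (inst2 C a (Refl a)); tm \<S> \<Gamma> b A; tm \<S> \<Gamma> p (Idt A a b)\<rbrakk>
    \<Longrightarrow> tm \<S> \<Gamma> (J a C d b p) (inst2 C b p)"
| J_cong: "\<lbrakk>ty \<S> \<Gamma> A; tmeq \<S> \<Gamma> a a' A; ty \<S> (Idt (wk 1 A) (wk 1 a) (Var 0) # A # \<Gamma>) C;
    tyeq \<S> (Idt (wk 1 A) (wk 1 a) (Var 0) # A # \<Gamma>) C C';
    tmeq \<S> \<Gamma> d d' (inst2 C a (Refl a)); tmeq \<S> \<Gamma> b b' A; tmeq \<S> \<Gamma> p p' (Idt A a b)\<rbrakk>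
    \<Longrightarrow> tmeq \<S> \<Gamma> (J a C d b p) (J a' C' d' b' p') (inst2 C b p)"
| J_beta: "\<lbrakk>ty \<S> \<Gamma> A; tm \<S> \<Gamma> a A; ty \<S> (Idt (wk 1 A) (wk 1 a) (Var 0) # A # \<Gamma>) C;
    tm \<S> \<Gamma> d (inst2 C a (Refl a))\<rbrakk>
    \<Longrightarrow> tmeq \<S> \<Gamma> (J a C d a (Refl a)) d (inst2 C a (Refl a))"

| Sum_form: "\<lbrakk>ty \<S> \<Gamma> A; ty \<S> \<Gamma> B\<rbrakk> \<Longrightarrow> ty \<S> \<Gamma> (Sum A B)"
| Sum_cong: "\<lbrakk>tyeq \<S> \<Gamma> A A'; tyeq \<S> \<Gamma> B B'\<rbrakk> \<Longrightarrow> tyeq \<S> \<Gamma> (Sum A B) (Sum A' B')"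
| Sum_U: "\<lbrakk>tm \<S> \<Gamma> A U; tm \<S> \<Gamma> B U\<rbrakk> \<Longrightarrow> tm \<S> \<Gamma> (Sum A B) U"
| Sum_U_cong: "\<lbrakk>tmeq \<S> \<Gamma> A A' U; tmeq \<S> \<Gamma> B B' U\<rbrakk> \<Longrightarrow> tmeq \<S> \<Gamma> (Sum A B) (Sum A' B') U"
| Inl: "\<lbrakk>ty \<S> \<Gamma> A; ty \<S> \<Gamma> B; tm \<S> \<Gamma> a A\<rbrakk> \<Longrightarrow> tm \<S> \<Gamma> (Inl a) (Sum A B)"
| Inl_cong: "\<lbrakk>ty \<S> \<Gamma> A; ty \<S> \<Gamma> B; tmeq \<S> \<Gamma> a a' A\<rbrakk> \<Longrightarrow> tmeq \<S> \<Gamma> (Inl a) (Inl a') (Sum A B)"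
| Inr: "\<lbrakk>ty \<S> \<Gamma> A; ty \<S> \<Gamma> B; tm \<S> \<Gamma> b B\<rbrakk> \<Longrightarrow> tm \<S> \<Gamma> (Inr b) (Sum A B)"
| Inr_cong: "\<lbrakk>ty \<S> \<Gamma> A; ty \<S> \<Gamma> B; tmeq \<S> \<Gamma> b b' B\<rbrakk> \<Longrightarrow> tmeq \<S> \<Gamma> (Inr b) (Inr b') (Sum A B)"
| Case: "\<lbrakk>ty \<S> \<Gamma> A; ty \<S> \<Gamma> B; ty \<S> (Sum A B # \<Gamma>) C;
    tm \<S> (A # \<Gamma>) l (reind C (Inl (Var 0))); tm \<S> (B # \<Gamma>) r (reind C (Inr (Var 0)));
    tm \<S> \<Gamma> s (Sum A B)\<rbrakk>
    \<Longrightarrow> tm \<S> \<Gamma> (Case C l r s) (inst C s)"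
| Case_cong: "\<lbrakk>ty \<S> \<Gamma> A; ty \<S> \<Gamma> B; ty \<S> (Sum A B # \<Gamma>) C; tyeq \<S> (Sum A B # \<Gamma>) C C';
    tmeq \<S> (A # \<Gamma>) l l' (reind C (Inl (Var 0))); tmeq \<S> (B # \<Gamma>) r r' (reind C (Inr (Var 0)));
    tmeq \<S> \<Gamma> s s' (Sum A B)\<rbrakk>
    \<Longrightarrow> tmeq \<S> \<Gamma> (Case C l r s) (Case C' l' r' s') (inst C s)"
| Case_beta1: "\<lbrakk>ty \<S> \<Gamma> A; ty \<S> \<Gamma> B; ty \<S> (Sum A B # \<Gamma>) C;
    tm \<S> (A # \<Gamma>) l (reind C (Inl (Var 0))); tm \<S> (B # \<Gamma>) r (reind C (Inr (Var 0)));
    tm \<S> \<Gamma> a A\<rbrakk>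
    \<Longrightarrow> tmeq \<S> \<Gamma> (Case C l r (Inl a)) (inst l a) (inst C (Inl a))"
| Case_beta2: "\<lbrakk>ty \<S> \<Gamma> A; ty \<S> \<Gamma> B; ty \<S> (Sum A B # \<Gamma>) C;
    tm \<S> (A # \<Gamma>) l (reind C (Inl (Var 0))); tm \<S> (B # \<Gamma>) r (reind C (Inr (Var 0)));
    tm \<S> \<Gamma> b B\<rbrakk>
    \<Longrightarrow> tmeq \<S> \<Gamma> (Case C l r (Inr b)) (inst r b) (inst C (Inr b))"

| Empty_form: "ctx \<S> \<Gamma> \<Longrightarrow> ty \<S> \<Gamma> Empty"
| Empty_U: "ctx \<S> \<Gamma> \<Longrightarrow> tm \<S> \<Gamma> Empty U"
| Abort: "\<lbrakk>ty \<S> (Empty # \<Gamma>) C; tm \<S> \<Gamma> e Empty\<rbrakk> \<Longrightarrow> tm \<S> \<Gamma> (Abort C e) (inst C e)"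
| Abort_cong: "\<lbrakk>ty \<S> (Empty # \<Gamma>) C; tyeq \<S> (Empty # \<Gamma>) C C'; tmeq \<S> \<Gamma> e e' Empty\<rbrakk>
    \<Longrightarrow> tmeq \<S> \<Gamma> (Abort C e) (Abort C' e') (inst C e)"

| Unit_form: "ctx \<S> \<Gamma> \<Longrightarrow> ty \<S> \<Gamma> Unit"
| Unit_U: "ctx \<S> \<Gamma> \<Longrightarrow> tm \<S> \<Gamma> Unit U"
| Star: "ctx \<S> \<Gamma> \<Longrightarrow> tm \<S> \<Gamma> Star Unit"
| Unit_eta: "tm \<S> \<Gamma> t Unit \<Longrightarrow> tmeq \<S> \<Gamma> t Star Unit"

definition inhabited :: "('c \<rightharpoonup> 'c expr) \<Rightarrow> 'c expr list \<Rightarrow> 'c expr \<Rightarrow> bool" where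
  "inhabited \<S> \<Gamma> T \<longleftrightarrow> (\<exists>t. tm \<S> \<Gamma> t T)"


section \<open>Internal notions\<close>

definition arr :: "'c expr \<Rightarrow> 'c expr \<Rightarrow> 'c expr" (infixr \<open>\<Rrightarrow>\<close> 65) where
  "A \<Rrightarrow> B = Pi A (wk 1 B)"

definition idm :: "'c expr \<Rightarrow> 'c expr" where
  "idm A = Lam A (Var 0)"

text \<open>\<open>cmp A g f\<close> is \<open>g \<circ> f\<close>, where \<open>A\<close> is the domain of \<open>f\<close>.\<close>

definition cmp :: "'c expr \<Rightarrow> 'c expr \<Rightarrow> 'c expr \<Rightarrow> 'c expr" where
  "cmp A g f = Lam A (App (wk 1 g) (App (wk 1 f) (Var 0)))"

text \<open>In \<open>htpy A B f g\<close> and \<open>happly A B f g\<close>, \<open>B\<close> is a family over \<open>A\<close> (so it lives in the context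
  extended by \<open>A\<close>) and \<open>f, g : Pi A B\<close>.\<close>

definition htpy :: "'c expr \<Rightarrow> 'c expr \<Rightarrow> 'c expr \<Rightarrow> 'c expr \<Rightarrow> 'c expr" where
  "htpy A B f g = Pi A (Idt B (App (wk 1 f) (Var 0)) (App (wk 1 g) (Var 0)))"

definition happly :: "'c expr \<Rightarrow> 'c expr \<Rightarrow> 'c expr \<Rightarrow> 'c expr \<Rightarrow> 'c expr" where
  "happly A B f g =
     Lam (Idt (Pi A B) f g)
       (J (wk 1 f)
          (htpy (wk 3 A) (wk1 3 B) (wk 3 f) (Var 1))
          (Lam (wk 1 A) (Refl (App (wk 2 f) (Var 0))))
          (wk 1 g) (Var 0))"

definition isEquiv :: "'c expr \<Rightarrow> 'c expr \<Rightarrow> 'c expr \<Rightarrow> 'c expr" where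
  "isEquiv A B f =
     Sig (B \<Rrightarrow> A)
    (Sig (htpy (wk 1 B) (wk 2 B) (cmp (wk 1 B) (wk 1 f) (Var 0)) (idm (wk 1 B)))
    (Sig (wk 2 B \<Rrightarrow> wk 2 A)
         (htpy (wk 3 A) (wk 4 A) (cmp (wk 3 A) (Var 0) (wk 3 f)) (idm (wk 3 A)))))"

definition isCEq :: "'c expr \<Rightarrow> 'c expr \<Rightarrow> 'c expr \<Rightarrow> 'c expr" where
  "isCEq A B f =
     Sig (B \<Rrightarrow> A)
    (Sig (Idt (wk 1 B \<Rrightarrow> wk 1 B) (cmp (wk 1 B) (wk 1 f) (Var 0)) (idm (wk 1 B)))
    (Sig (wk 2 B \<Rrightarrow> wk 2 A)
         (Idt (wk 3 A \<Rrightarrow> wk 3 A) (cmp (wk 3 A) (Var 0) (wk 3 f)) (idm (wk 3 A)))))"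

definition Eqv :: "'c expr \<Rightarrow> 'c expr \<Rightarrow> 'c expr" where
  "Eqv A B = Sig (A \<Rrightarrow> B) (isEquiv (wk 1 A) (wk 1 B) (Var 0))"

definition CEq :: "'c expr \<Rightarrow> 'c expr \<Rightarrow> 'c expr" where
  "CEq A B = Sig (A \<Rrightarrow> B) (isCEq (wk 1 A) (wk 1 B) (Var 0))"

definition CEqToEq :: "'c expr \<Rightarrow> 'c expr \<Rightarrow> 'c expr" where
  "CEqToEq A B = Lam (CEq A B)
     (let A1 = wk 1 A; B1 = wk 1 B; w = Var 0;
          f = Fst w; s = Fst (Snd w); S = Fst (Snd (Snd w));
          r = Fst (Snd (Snd (Snd w))); R = Snd (Snd (Snd (Snd w)))
      in Pair f (Pair s
           (Pair (App (happly B1 (wk 1 B1) (cmp B1 f s) (idm B1)) S)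
           (Pair r
                 (App (happly A1 (wk 1 A1) (cmp A1 r f) (idm A1)) R)))))"

definition isProp :: "'c expr \<Rightarrow> 'c expr" where
  "isProp A = Pi A (Pi (wk 1 A) (Idt (wk 2 A) (Var 1) (Var 0)))"

definition isContr :: "'c expr \<Rightarrow> 'c expr" where
  "isContr A = Sig A (Pi (wk 1 A) (Idt (wk 2 A) (Var 1) (Var 0)))"

definition postcomp :: "'c expr \<Rightarrow> 'c expr \<Rightarrow> 'c expr \<Rightarrow> 'c expr" where
  "postcomp X A f = Lam (X \<Rrightarrow> A) (cmp (wk 1 X) (wk 1 f) (Var 0))"

text \<open>\<open>hasSection A B f\<close> is the type of homotopy sections of \<open>f : A \<rightarrow> B\<close>.\<close>

definition hasSection :: "'c expr \<Rightarrow> 'c expr \<Rightarrow> 'c expr \<Rightarrow> 'c expr" where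
  "hasSection A B f =
     Sig (B \<Rrightarrow> A) (htpy (wk 1 B) (wk 2 B) (cmp (wk 1 B) (wk 1 f) (Var 0)) (idm (wk 1 B)))"


section \<open>The principles\<close>

text \<open>
  Quantification over types, small or large, is schematic: over all contexts and all types and
  families derivable in them. Quantification over terms is internal.
\<close>

definition CEqToEq_equiv :: "('c \<rightharpoonup> 'c expr) \<Rightarrow> bool" where
  "CEqToEq_equiv \<S> \<longleftrightarrow> (\<forall>\<Gamma> A B. ty \<S> \<Gamma> A \<longrightarrow> ty \<S> \<Gamma> B \<longrightarrow>
     inhabited \<S> \<Gamma> (isEquiv (CEq A B) (Eqv A B) (CEqToEq A B)))"

definition CEqToEq_section :: "('c \<rightharpoonup> 'c expr) \<Rightarrow> bool" where
  "CEqToEq_section \<S> \<longleftrightarrow> (\<forall>\<Gamma> A B. ty \<S> \<Gamma> A \<longrightarrow> ty \<S> \<Gamma> B \<longrightarrow>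
     inhabited \<S> \<Gamma> (hasSection (CEq A B) (Eqv A B) (CEqToEq A B)))"

definition isEquiv_isProp :: "('c \<rightharpoonup> 'c expr) \<Rightarrow> bool" where
  "isEquiv_isProp \<S> \<longleftrightarrow> (\<forall>\<Gamma> A B. ty \<S> \<Gamma> A \<longrightarrow> ty \<S> \<Gamma> B \<longrightarrow>
     inhabited \<S> \<Gamma> (Pi (A \<Rrightarrow> B) (isProp (isEquiv (wk 1 A) (wk 1 B) (Var 0)))))"

definition htpy_id_imp_eq_id :: "('c \<rightharpoonup> 'c expr) \<Rightarrow> bool" where
  "htpy_id_imp_eq_id \<S> \<longleftrightarrow> (\<forall>\<Gamma> A. ty \<S> \<Gamma> A \<longrightarrow>
     inhabited \<S> \<Gamma> (Pi (A \<Rrightarrow> A)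
       (htpy (wk 1 A) (wk 2 A) (Var 0) (idm (wk 1 A)) \<Rrightarrow>
        Idt (wk 1 A \<Rrightarrow> wk 1 A) (Var 0) (idm (wk 1 A)))))"

definition isEquiv_imp_isCEq :: "('c \<rightharpoonup> 'c expr) \<Rightarrow> bool" where
  "isEquiv_imp_isCEq \<S> \<longleftrightarrow> (\<forall>\<Gamma> A B. ty \<S> \<Gamma> A \<longrightarrow> ty \<S> \<Gamma> B \<longrightarrow>
     inhabited \<S> \<Gamma> (Pi (A \<Rrightarrow> B)
       (isEquiv (wk 1 A) (wk 1 B) (Var 0) \<Rrightarrow> isCEq (wk 1 A) (wk 1 B) (Var 0))))"

definition postcomp_isEquiv :: "('c \<rightharpoonup> 'c expr) \<Rightarrow> bool" where
  "postcomp_isEquiv \<S> \<longleftrightarrow> (\<forall>\<Gamma> A B X. ty \<S> \<Gamma> A \<longrightarrow> ty \<S> \<Gamma> B \<longrightarrow> ty \<S> \<Gamma> X \<longrightarrow>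
     inhabited \<S> \<Gamma> (Pi (A \<Rrightarrow> B)
       (isEquiv (wk 1 A) (wk 1 B) (Var 0) \<Rrightarrow>
        isEquiv (wk 1 X \<Rrightarrow> wk 1 A) (wk 1 X \<Rrightarrow> wk 1 B) (postcomp (wk 1 X) (wk 1 A) (Var 0)))))"

definition weak_funext :: "('c \<rightharpoonup> 'c expr) \<Rightarrow> bool" where
  "weak_funext \<S> \<longleftrightarrow> (\<forall>\<Gamma> A P. ty \<S> \<Gamma> A \<longrightarrow> ty \<S> (A # \<Gamma>) P \<longrightarrow>
     inhabited \<S> \<Gamma> (Pi A (isContr P) \<Rrightarrow> isContr (Pi A P)))"

definition funext :: "('c \<rightharpoonup> 'c expr) \<Rightarrow> bool" where
  "funext \<S> \<longleftrightarrow> (\<forall>\<Gamma> A B. ty \<S> \<Gamma> A \<longrightarrow> ty \<S> (A # \<Gamma>) B \<longrightarrow>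
     inhabited \<S> \<Gamma> (Pi (Pi A B) (Pi (wk 1 (Pi A B))
       (isEquiv (Idt (wk 2 (Pi A B)) (Var 1) (Var 0))
                (htpy (wk 2 A) (wk1 2 B) (Var 1) (Var 0))
                (happly (wk 2 A) (wk1 2 B) (Var 1) (Var 0))))))"

end

theory Submission
  imports Defs "HOL-Library.Monad_Syntax"
begin

text \<open>
  The implications proved are (1) \<open>\<Rightarrow>\<close> (2) \<open>\<Rightarrow>\<close> (5) \<open>\<Rightarrow>\<close> (6) \<open>\<Rightarrow>\<close> (4) \<open>\<Rightarrow>\<close> (7) \<open>\<Rightarrow>\<close> (8) \<open>\<Rightarrow>\<close> (1)
  and (8) \<open>\<Rightarrow>\<close> (3) \<open>\<Rightarrow>\<close> (4).
  For (6) \<open>\<Rightarrow>\<close> (4), the source map \<open>\<Sigma> x y. x = y \<rightarrow> A\<close> of the path space is an equivalence, so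
  composition with it is injective and the endomap \<open>(x, y, p) \<mapsto> (x, x, refl)\<close> equals the identity;
  evaluating targets along \<open>a \<mapsto> (f a, a, H a)\<close> gives \<open>f = id\<close>.
  For (4) \<open>\<Rightarrow>\<close> (7), if all \<open>P a\<close> are contractible then the projection \<open>\<Sigma> P \<rightarrow> A\<close> has a section \<open>s\<close>
  whose composite with it is equal to the identity of \<open>\<Sigma> P\<close>; hence the type of maps \<open>m : A \<rightarrow> \<Sigma> P\<close>
  with \<open>s = s \<circ> fst \<circ> m\<close> is a proposition, and \<open>\<Pi> P\<close> is a retract of it.
  For (7) \<open>\<Rightarrow>\<close> (8), \<open>\<Sigma> g. f \<sim> g\<close> is a retract of \<open>\<Pi> a. \<Sigma> b. f a = b\<close>.
  For (3) \<open>\<Rightarrow>\<close> (4), a homotopy \<open>f \<sim> id\<close> makes \<open>f\<close> a second inverse of \<open>id\<close>.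

  The internal derivations are given as explicit proof terms. Their typing is established by a
  type inference and normalisation procedure that is proved sound for the judgements of ITT and
  evaluated by the simplifier. It works on terms with metavariables for types and families, since
  large types cannot be abstracted internally. No injectivity of type formers is available, so the
  procedure reinfers types whenever it reduces a redex.
\<close>

section \<open>Substitution calculus\<close>

lemma upr_simps [simp]: "upr \<rho> 0 = 0" "upr \<rho> (Suc i) = Suc (\<rho> i)"
  by (simp_all add: upr_def)

lemma ups_simps [simp]: "ups \<sigma> 0 = Var 0" "ups \<sigma> (Suc i) = ren Suc (\<sigma> i)"
  by (simp_all add: ups_def)

lemma upr_upr: "(\<lambda>i. upr \<rho> (upr \<rho>' i)) = upr (\<lambda>i. \<rho> (\<rho>' i))"
  by (rule ext, case_tac i) auto

lemma ren_ren: "ren \<rho> (ren \<rho>' t) = ren (\<lambda>i. \<rho> (\<rho>' i)) t"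
  by (induction t arbitrary: \<rho> \<rho>') (simp_all add: upr_upr)

lemma ups_upr: "(\<lambda>i. ups \<sigma> (upr \<rho> i)) = ups (\<lambda>i. \<sigma> (\<rho> i))"
  by (rule ext, case_tac i) auto

lemma sub_ren: "sub \<sigma> (ren \<rho> t) = sub (\<lambda>i. \<sigma> (\<rho> i)) t"
  by (induction t arbitrary: \<sigma> \<rho>) (simp_all add: ups_upr)

lemma ren_ups: "(\<lambda>i. ren (upr \<rho>) (ups \<sigma> i)) = ups (\<lambda>i. ren \<rho> (\<sigma> i))"
  by (rule ext, case_tac i) (auto simp: ren_ren)

lemma ren_sub: "ren \<rho> (sub \<sigma> t) = sub (\<lambda>i. ren \<rho> (\<sigma> i)) t"
  by (induction t arbitrary: \<sigma> \<rho>) (simp_all add: ren_ups)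

lemma sub_ups: "(\<lambda>i. sub (ups \<tau>) (ups \<sigma> i)) = ups (\<lambda>i. sub \<tau> (\<sigma> i))"
  by (rule ext, case_tac i) (auto simp: sub_ren ren_sub)

lemma sub_sub: "sub \<tau> (sub \<sigma> t) = sub (\<lambda>i. sub \<tau> (\<sigma> i)) t"
  by (induction t arbitrary: \<sigma> \<tau>) (simp_all add: sub_ups)

lemma ups_Var: "ups (\<lambda>i. Var (\<rho> i)) = (\<lambda>i. Var (upr \<rho> i))"
  by (rule ext, case_tac i) auto

lemma sub_Var_ren: "sub (\<lambda>i. Var (\<rho> i)) t = ren \<rho> t"
  by (induction t arbitrary: \<rho>) (simp_all add: ups_Var)

lemma upr_id: "upr (\<lambda>i. i) = (\<lambda>i. i)"
  by (rule ext, case_tac i) auto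

lemma ren_id: "ren (\<lambda>i. i) t = t"
  by (induction t) (simp_all add: upr_id)

lemma sub_Var: "sub Var t = t"
  using sub_Var_ren [of "\<lambda>i. i" t] by (simp add: ren_id)


section \<open>Context morphisms\<close>

text \<open>The premise shared by the substitution rules of the judgements, named so that those
  rules can be folded with it.\<close>

definition mor :: "('c \<rightharpoonup> 'c expr) \<Rightarrow> 'c expr list \<Rightarrow> (nat \<Rightarrow> 'c expr) \<Rightarrow> 'c expr list \<Rightarrow> bool" where
  "mor \<S> \<Delta> \<sigma> \<Gamma> \<longleftrightarrow> (\<forall>i<length \<Gamma>. tm \<S> \<Delta> (\<sigma> i) (sub (\<lambda>k. \<sigma> (k + Suc i)) (\<Gamma> ! i)))"

lemma mor_cons:
  assumes "mor \<S> \<Delta> \<sigma> \<Gamma>" "tm \<S> \<Delta> a (sub \<sigma> A)"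
  shows "mor \<S> \<Delta> (case_nat a \<sigma>) (A # \<Gamma>)"
  unfolding mor_def
proof (intro allI impI)
  fix i assume "i < length (A # \<Gamma>)"
  then show "tm \<S> \<Delta> (case_nat a \<sigma> i)
      (sub (\<lambda>k. case_nat a \<sigma> (k + Suc i)) ((A # \<Gamma>) ! i))"
    using assms by (cases i) (auto simp: mor_def)
qed

text \<open>Weakening is not a primitive rule of the judgements. It is substitution along this
  morphism of variables, past a whole block of hypotheses.\<close>

lemma mor_wk:
  assumes "ctx \<S> (\<Delta> @ \<Gamma>)"
  shows "mor \<S> (\<Delta> @ \<Gamma>) (\<lambda>i. Var (i + length \<Delta>)) \<Gamma>"
  unfolding mor_def
proof (intro allI impI)
  fix i assume "i < length \<Gamma>"
  with tm_var [OF assms, of "i + length \<Delta>"]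
  show "tm \<S> (\<Delta> @ \<Gamma>) (Var (i + length \<Delta>))
      (sub (\<lambda>k. Var (k + Suc i + length \<Delta>)) (\<Gamma> ! i))"
    by (simp add: nth_append sub_Var_ren wk_def ac_simps)
qed

lemma mor_Var: "ctx \<S> \<Gamma> \<Longrightarrow> mor \<S> \<Gamma> Var \<Gamma>"
  using mor_wk [of \<S> "[]" \<Gamma>] by simp

lemma mor_inst: "\<lbrakk>ctx \<S> \<Gamma>; tm \<S> \<Gamma> a A\<rbrakk> \<Longrightarrow> mor \<S> \<Gamma> (case_nat a Var) (A # \<Gamma>)"
  by (rule mor_cons) (simp_all add: mor_Var sub_Var)

lemmas ty_mor = ty_sub [folded mor_def]
lemmas tyeq_mor = tyeq_sub [folded mor_def]
lemmas tm_mor = tm_sub [folded mor_def]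
lemmas tmeq_mor = tmeq_sub [folded mor_def]
lemmas ty_mor_cong = ty_sub_cong [folded mor_def]

lemma ctx_of:
  "ctx \<S> \<Gamma> \<Longrightarrow> True"
  "ty \<S> \<Gamma> A \<Longrightarrow> ctx \<S> \<Gamma>"
  "tyeq \<S> \<Gamma> A B \<Longrightarrow> ctx \<S> \<Gamma>"
  "tm \<S> \<Gamma> t A \<Longrightarrow> ctx \<S> \<Gamma>"
  "tmeq \<S> \<Gamma> t u A \<Longrightarrow> ctx \<S> \<Gamma>"
  by (induction rule: ctx_ty_tyeq_tm_tmeq.inducts) (simp_all add: ctx_nil)

lemma wk_1: "wk 1 = ren Suc" "wk (Suc 0) = ren Suc"
  by (simp_all add: wk_def)

lemma mor_wk1: "ctx \<S> (A # \<Gamma>) \<Longrightarrow> mor \<S> (A # \<Gamma>) (\<lambda>i. Var (Suc i)) \<Gamma>"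
  using mor_wk [of \<S> "[A]" \<Gamma>] by simp

lemma ty_wk1: "\<lbrakk>ty \<S> \<Gamma> B; ctx \<S> (A # \<Gamma>)\<rbrakk> \<Longrightarrow> ty \<S> (A # \<Gamma>) (wk 1 B)"
  using ty_mor [OF _ _ mor_wk1, of \<S> \<Gamma>] by (auto simp: sub_Var_ren wk_1)

lemma tyeq_wk1: "\<lbrakk>tyeq \<S> \<Gamma> B B'; ctx \<S> (A # \<Gamma>)\<rbrakk> \<Longrightarrow> tyeq \<S> (A # \<Gamma>) (wk 1 B) (wk 1 B')"
  using tyeq_mor [OF _ _ mor_wk1, of \<S> \<Gamma>] by (auto simp: sub_Var_ren wk_1)

lemma tm_wk1: "\<lbrakk>tm \<S> \<Gamma> t B; ctx \<S> (A # \<Gamma>)\<rbrakk> \<Longrightarrow> tm \<S> (A # \<Gamma>) (wk 1 t) (wk 1 B)"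
  using tm_mor [OF _ _ mor_wk1, of \<S> \<Gamma>] by (auto simp: sub_Var_ren wk_1)

lemma tmeq_wk1:
  "\<lbrakk>tmeq \<S> \<Gamma> t u B; ctx \<S> (A # \<Gamma>)\<rbrakk> \<Longrightarrow> tmeq \<S> (A # \<Gamma>) (wk 1 t) (wk 1 u) (wk 1 B)"
  using tmeq_mor [OF _ _ mor_wk1, of \<S> \<Gamma>] by (auto simp: sub_Var_ren wk_1)

lemma ty_inst: "\<lbrakk>ty \<S> (A # \<Gamma>) B; ctx \<S> \<Gamma>; tm \<S> \<Gamma> a A\<rbrakk> \<Longrightarrow> ty \<S> \<Gamma> (inst B a)"
  unfolding inst_def by (blast intro: ty_mor mor_inst)

lemma ty_inst_cong:
  assumes "ty \<S> (A # \<Gamma>) B" "ctx \<S> \<Gamma>" "tm \<S> \<Gamma> a A" "tm \<S> \<Gamma> a' A" "tmeq \<S> \<Gamma> a a' A"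
  shows "tyeq \<S> \<Gamma> (inst B a) (inst B a')"
  unfolding inst_def
proof (rule ty_mor_cong [OF assms(1,2)])
  show "\<forall>i<length (A # \<Gamma>). tmeq \<S> \<Gamma> (case_nat a Var i) (case_nat a' Var i)
      (sub (\<lambda>k. case_nat a Var (k + Suc i)) ((A # \<Gamma>) ! i))"
  proof (intro allI impI)
    fix i assume "i < length (A # \<Gamma>)"
    then show "tmeq \<S> \<Gamma> (case_nat a Var i) (case_nat a' Var i)
        (sub (\<lambda>k. case_nat a Var (k + Suc i)) ((A # \<Gamma>) ! i))"
      using assms(5) mor_Var [OF assms(2)]
      by (cases i) (auto simp: sub_Var mor_def intro: tmeq_refl)
  qed
qed (use assms mor_inst in auto)

text \<open>Context conversion as a substitution: the identity is a morphism between contexts whose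
  last types are equal, because the last variable can be retyped by conversion.\<close>

lemma mor_conv_head:
  assumes "ty \<S> \<Gamma> A" "tyeq \<S> \<Gamma> A A'"
  shows "mor \<S> (A # \<Gamma>) Var (A' # \<Gamma>)"
proof -
  have c: "ctx \<S> (A # \<Gamma>)" using assms(1) ctx_of by (blast intro: ctx_cons)
  have "tm \<S> (A # \<Gamma>) (Var 0) (wk 1 A)"
    using tm_var [OF c, of 0] by simp
  then have "tm \<S> (A # \<Gamma>) (Var 0) (wk 1 A')"
    by (rule tm_conv) (rule tyeq_wk1 [OF assms(2) c])
  then have "mor \<S> (A # \<Gamma>) (case_nat (Var 0) (\<lambda>i. Var (Suc i))) (A' # \<Gamma>)"
    by (intro mor_cons mor_wk1 c) (simp add: sub_Var_ren wk_1)
  moreover have "case_nat (Var 0) (\<lambda>i. Var (Suc i)) = Var"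
    by (simp add: fun_eq_iff split: nat.split)
  ultimately show ?thesis by metis
qed

lemma conv_head:
  assumes "ty \<S> \<Gamma> A" "tyeq \<S> \<Gamma> A A'"
  shows "ty \<S> (A' # \<Gamma>) B \<Longrightarrow> ty \<S> (A # \<Gamma>) B"
    and "tyeq \<S> (A' # \<Gamma>) B B' \<Longrightarrow> tyeq \<S> (A # \<Gamma>) B B'"
    and "tm \<S> (A' # \<Gamma>) b B \<Longrightarrow> tm \<S> (A # \<Gamma>) b B"
    and "tmeq \<S> (A' # \<Gamma>) b b' B \<Longrightarrow> tmeq \<S> (A # \<Gamma>) b b' B"
proof -
  have c: "ctx \<S> (A # \<Gamma>)" using assms(1) ctx_of by (blast intro: ctx_cons)
  note m = mor_conv_head [OF assms]
  show "ty \<S> (A' # \<Gamma>) B \<Longrightarrow> ty \<S> (A # \<Gamma>) B"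
    using ty_mor [OF _ c m] by (simp add: sub_Var)
  show "tyeq \<S> (A' # \<Gamma>) B B' \<Longrightarrow> tyeq \<S> (A # \<Gamma>) B B'"
    using tyeq_mor [OF _ c m] by (simp add: sub_Var)
  show "tm \<S> (A' # \<Gamma>) b B \<Longrightarrow> tm \<S> (A # \<Gamma>) b B"
    using tm_mor [OF _ c m] by (simp add: sub_Var)
  show "tmeq \<S> (A' # \<Gamma>) b b' B \<Longrightarrow> tmeq \<S> (A # \<Gamma>) b b' B"
    using tmeq_mor [OF _ c m] by (simp add: sub_Var)
qed

lemma mor_ups:
  assumes m: "mor \<S> \<Delta> \<sigma> \<Gamma>" and c: "ctx \<S> (sub \<sigma> A # \<Delta>)"
  shows "mor \<S> (sub \<sigma> A # \<Delta>) (ups \<sigma>) (A # \<Gamma>)"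
  unfolding ups_def
proof (rule mor_cons)
  show "mor \<S> (sub \<sigma> A # \<Delta>) (\<lambda>i. ren Suc (\<sigma> i)) \<Gamma>"
    unfolding mor_def
  proof (intro allI impI)
    fix i assume "i < length \<Gamma>"
    with m have "tm \<S> \<Delta> (\<sigma> i) (sub (\<lambda>k. \<sigma> (k + Suc i)) (\<Gamma> ! i))"
      unfolding mor_def by blast
    from tm_wk1 [OF this c]
    show "tm \<S> (sub \<sigma> A # \<Delta>) (ren Suc (\<sigma> i)) (sub (\<lambda>k. ren Suc (\<sigma> (k + Suc i))) (\<Gamma> ! i))"
      by (simp add: wk_1 ren_sub)
  qed
  show "tm \<S> (sub \<sigma> A # \<Delta>) (Var 0) (sub (\<lambda>i. ren Suc (\<sigma> i)) A)"
    using tm_var [OF c, of 0] by (simp add: wk_1 ren_sub)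
qed

section \<open>Inversion of the formation of Pi- and Sigma-types\<close>

definition wf_head :: "('c \<rightharpoonup> 'c expr) \<Rightarrow> 'c expr list \<Rightarrow> 'c expr \<Rightarrow> bool" where
  "wf_head \<S> \<Gamma> T \<longleftrightarrow> (\<forall>i. T = Var i \<longrightarrow> i < length \<Gamma>) \<and>
     (\<forall>A B. T = Pi A B \<or> T = Sig A B \<longrightarrow> ty \<S> \<Gamma> A \<and> ty \<S> (A # \<Gamma>) B)"

lemma wf_head_sub:
  assumes h: "wf_head \<S> \<Gamma> T" and c: "ctx \<S> \<Delta>"
    and s: "\<forall>i<length \<Gamma>. tm \<S> \<Delta> (\<sigma> i) (sub (\<lambda>k. \<sigma> (k + Suc i)) (\<Gamma> ! i)) \<and> wf_head \<S> \<Delta> (\<sigma> i)"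
  shows "wf_head \<S> \<Delta> (sub \<sigma> T)"
proof -
  have m: "mor \<S> \<Delta> \<sigma> \<Gamma>" using s unfolding mor_def by blast
  have under: "ty \<S> \<Delta> (sub \<sigma> A) \<and> ty \<S> (sub \<sigma> A # \<Delta>) (sub (ups \<sigma>) B)"
    if "ty \<S> \<Gamma> A" "ty \<S> (A # \<Gamma>) B" for A B
  proof -
    have A: "ty \<S> \<Delta> (sub \<sigma> A)" using that(1) c m by (rule ty_mor)
    then have c': "ctx \<S> (sub \<sigma> A # \<Delta>)" using c by (rule ctx_cons [rotated])
    show ?thesis using A ty_mor [OF that(2) c' mor_ups [OF m c']] by blast
  qed
  show ?thesis
  proof (cases T)
    case (Var i)
    with h s show ?thesis by (auto simp: wf_head_def)
  qed (use h under in \<open>auto simp: wf_head_def\<close>)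
qed

text \<open>Inversion cannot be read off from the last rule, since a derivation may end with
  \<open>ty_sub\<close> or \<open>tm_sub\<close>. If the substituted expression is a variable, its
  image \<open>\<sigma> i\<close> may itself be a Pi- or Sigma-type; the range clause of
  \<open>wf_head\<close> then gives access to the induction hypothesis for
  \<open>\<sigma> i\<close>. Terms take part because \<open>El\<close> turns terms of
  \<open>U\<close> into types.\<close>

lemma wf_head:
  "ctx \<S> \<Gamma> \<Longrightarrow> True"
  "ty \<S> \<Gamma> T \<Longrightarrow> wf_head \<S> \<Gamma> T"
  "tyeq \<S> \<Gamma> A B \<Longrightarrow> True"
  "tm \<S> \<Gamma> T A \<Longrightarrow> wf_head \<S> \<Gamma> T"
  "tmeq \<S> \<Gamma> t u A \<Longrightarrow> True"
proof (induction rule: ctx_ty_tyeq_tm_tmeq.inducts)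
  case (ty_sub \<Gamma> A \<Delta> \<sigma>)
  then show ?case by (intro wf_head_sub) auto
next
  case (tm_sub \<Gamma> t A \<Delta> \<sigma>)
  then show ?case by (intro wf_head_sub) auto
qed (auto simp: wf_head_def intro: El)

lemma ty_Pi_inv: "ty \<S> \<Gamma> (Pi A B) \<Longrightarrow> ty \<S> \<Gamma> A \<and> ty \<S> (A # \<Gamma>) B"
  and ty_Sig_inv: "ty \<S> \<Gamma> (Sig A B) \<Longrightarrow> ty \<S> \<Gamma> A \<and> ty \<S> (A # \<Gamma>) B"
  by (auto dest!: wf_head(2) simp: wf_head_def)

section \<open>Schematic terms\<close>

text \<open>\<open>TV m\<close> is a metavariable for a type and \<open>FV m t\<close> the instance at \<open>t\<close> of a metavariable for a family
  over \<open>TV 0\<close>. Pairs carry the two arguments of their \<open>\<Sigma>\<close>-type, so that every type can be inferred.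
  In \<open>interp I F n t\<close>, \<open>n\<close> is the number of local variables in front of the base context in which
  the metavariables are interpreted.\<close>

datatype mexpr =
    MVar nat
  | TV nat
  | FV nat mexpr
  | MPi mexpr mexpr
  | MLam mexpr mexpr
  | MApp mexpr mexpr
  | MSig mexpr mexpr
  | MPair mexpr mexpr mexpr mexpr
  | MFst mexpr
  | MSnd mexpr
  | MId mexpr mexpr mexpr
  | MRefl mexpr
  | MJ mexpr mexpr mexpr mexpr mexpr

primrec interp :: "(nat \<Rightarrow> 'c expr) \<Rightarrow> (nat \<Rightarrow> 'c expr) \<Rightarrow> nat \<Rightarrow> mexpr \<Rightarrow> 'c expr" where
  "interp I F n (MVar i) = Var i"
| "interp I F n (TV m) = wk n (I m)"
| "interp I F n (FV m t) = sub (case_nat (interp I F n t) (\<lambda>i. Var (i + n))) (F m)"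
| "interp I F n (MPi A B) = Pi (interp I F n A) (interp I F (Suc n) B)"
| "interp I F n (MLam A b) = Lam (interp I F n A) (interp I F (Suc n) b)"
| "interp I F n (MApp f a) = App (interp I F n f) (interp I F n a)"
| "interp I F n (MSig A B) = Sig (interp I F n A) (interp I F (Suc n) B)"
| "interp I F n (MPair A B a b) = Pair (interp I F n a) (interp I F n b)"
| "interp I F n (MFst p) = Fst (interp I F n p)"
| "interp I F n (MSnd p) = Snd (interp I F n p)"
| "interp I F n (MId A a b) = Idt (interp I F n A) (interp I F n a) (interp I F n b)"
| "interp I F n (MRefl a) = Refl (interp I F n a)"
| "interp I F n (MJ a C d b p) =
     J (interp I F n a) (interp I F (Suc (Suc n)) C) (interp I F n d) (interp I F n b) (interp I F n p)"

primrec lift :: "nat \<Rightarrow> nat \<Rightarrow> mexpr \<Rightarrow> mexpr" where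
  "lift d k (MVar i) = MVar (if i < k then i else i + d)"
| "lift d k (TV m) = TV m"
| "lift d k (FV m t) = FV m (lift d k t)"
| "lift d k (MPi A B) = MPi (lift d k A) (lift d (Suc k) B)"
| "lift d k (MLam A b) = MLam (lift d k A) (lift d (Suc k) b)"
| "lift d k (MApp f a) = MApp (lift d k f) (lift d k a)"
| "lift d k (MSig A B) = MSig (lift d k A) (lift d (Suc k) B)"
| "lift d k (MPair A B a b) = MPair (lift d k A) (lift d (Suc k) B) (lift d k a) (lift d k b)"
| "lift d k (MFst p) = MFst (lift d k p)"
| "lift d k (MSnd p) = MSnd (lift d k p)"
| "lift d k (MId A a b) = MId (lift d k A) (lift d k a) (lift d k b)"
| "lift d k (MRefl a) = MRefl (lift d k a)"
| "lift d k (MJ a C e b p) =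
     MJ (lift d k a) (lift d (Suc (Suc k)) C) (lift d k e) (lift d k b) (lift d k p)"

text \<open>\<open>subst k s t\<close> replaces the variable \<open>k\<close> of \<open>t\<close> by \<open>s\<close>, where \<open>s\<close> lives \<open>k\<close> binders
  further out.\<close>

primrec subst :: "nat \<Rightarrow> mexpr \<Rightarrow> mexpr \<Rightarrow> mexpr" where
  "subst k s (MVar i) = (if i < k then MVar i else if i = k then lift k 0 s else MVar (i - 1))"
| "subst k s (TV m) = TV m"
| "subst k s (FV m t) = FV m (subst k s t)"
| "subst k s (MPi A B) = MPi (subst k s A) (subst (Suc k) s B)"
| "subst k s (MLam A b) = MLam (subst k s A) (subst (Suc k) s b)"
| "subst k s (MApp f a) = MApp (subst k s f) (subst k s a)"
| "subst k s (MSig A B) = MSig (subst k s A) (subst (Suc k) s B)"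
| "subst k s (MPair A B a b) = MPair (subst k s A) (subst (Suc k) s B) (subst k s a) (subst k s b)"
| "subst k s (MFst p) = MFst (subst k s p)"
| "subst k s (MSnd p) = MSnd (subst k s p)"
| "subst k s (MId A a b) = MId (subst k s A) (subst k s a) (subst k s b)"
| "subst k s (MRefl a) = MRefl (subst k s a)"
| "subst k s (MJ a C e b p) =
     MJ (subst k s a) (subst (Suc (Suc k)) s C) (subst k s e) (subst k s b) (subst k s p)"

text \<open>\<open>p\<close> is weakened because it replaces variable 0 while the endpoint variable
  is still present; the later substitution of \<open>b\<close> undoes the weakening.\<close>

definition subst2 :: "mexpr \<Rightarrow> mexpr \<Rightarrow> mexpr \<Rightarrow> mexpr" where
  "subst2 C b p = subst 0 b (subst 0 (lift 1 0 p) C)"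

definition lren :: "nat \<Rightarrow> nat \<Rightarrow> nat \<Rightarrow> nat" where
  "lren d k i = (if i < k then i else i + d)"

lemma upr_lren: "upr (lren d k) = lren d (Suc k)"
  by (simp add: fun_eq_iff upr_def lren_def split: nat.split)

text \<open>The bound \<open>k \<le> n\<close> keeps the cutoff among the local variables, so all
  base variables move by \<open>d\<close>. Type metavariables mention only base variables, hence
  their weakening by \<open>n\<close> becomes one by \<open>n + d\<close>.\<close>

lemma interp_lift:
  "k \<le> n \<Longrightarrow> interp I F (n + d) (lift d k t) = ren (lren d k) (interp I F n t)"
proof (induction t arbitrary: n k)
  case (TV m)
  then show ?case by (simp add: wk_def ren_ren lren_def ac_simps)
next
  case (FV m t)
  then have *: "interp I F (n + d) (lift d k t) = ren (lren d k) (interp I F n t)" by simp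
  have "lren d k (i + n) = i + (n + d)" for i
    using FV.prems by (simp add: lren_def)
  then show ?case
    by (auto simp: * ren_sub fun_eq_iff split: nat.split
        intro!: arg_cong [where f="\<lambda>\<sigma>. sub \<sigma> (F m)"])
qed (simp_all add: lren_def upr_lren flip: add_Suc)

lemma interp_lift_0: "interp I F (n + d) (lift d 0 t) = wk d (interp I F n t)"
  by (simp add: interp_lift wk_def lren_def [abs_def])

lemma interp_lift_1: "interp I F (Suc n) (lift (Suc 0) 0 t) = wk 1 (interp I F n t)"
  using interp_lift_0 [of I F n 1 t] by simp

definition ssub :: "nat \<Rightarrow> 'c expr \<Rightarrow> nat \<Rightarrow> 'c expr" where
  "ssub k s i = (if i < k then Var i else if i = k then wk k s else Var (i - 1))"

lemma ups_ssub: "ups (ssub k s) = ssub (Suc k) s"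
  by (auto simp: fun_eq_iff ups_def ssub_def wk_def ren_ren split: nat.split)

lemma interp_subst:
  "interp I F (n + k) (subst k s t) = sub (ssub k (interp I F n s)) (interp I F (Suc (n + k)) t)"
proof (induction t arbitrary: k)
  case (MVar i)
  then show ?case by (simp add: ssub_def interp_lift_0)
next
  case (TV m)
  then show ?case by (simp add: wk_def sub_ren ssub_def sub_Var_ren)
next
  case (FV m t)
  show ?case
    by (auto simp: FV.IH sub_sub ssub_def fun_eq_iff split: nat.split
        intro!: arg_cong [where f="\<lambda>\<sigma>. sub \<sigma> (F m)"])
qed (simp_all add: ups_ssub flip: add_Suc_right)

lemma interp_subst_0: "interp I F n (subst 0 s t) = inst (interp I F (Suc n) t) (interp I F n s)"
proof -
  have "ssub 0 u = case_nat u Var" for u :: "'c expr"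
    by (auto simp: fun_eq_iff ssub_def wk_def ren_id split: nat.split)
  then show ?thesis
    using interp_subst [of I F n 0 s t] by (metis add_0_right inst_def)
qed

lemma inst_inst_wk: "inst (inst C (ren Suc p)) b = inst2 C b p"
proof -
  have "(\<lambda>i. sub (case_nat b Var) (case_nat (ren Suc p) Var i)) = case_nat p (case_nat b Var)"
    by (auto simp: fun_eq_iff sub_ren sub_Var split: nat.split)
  then show ?thesis
    by (simp add: inst_def inst2_def sub_sub wk_1)
qed

lemma interp_subst2:
  "interp I F n (subst2 C b p) = inst2 (interp I F (Suc (Suc n)) C) (interp I F n b) (interp I F n p)"
  by (simp add: subst2_def interp_subst_0 interp_lift_1 inst_inst_wk wk_1)


section \<open>A type inference and normalisation procedure\<close>

definition dest_pi :: "mexpr \<Rightarrow> (mexpr \<times> mexpr) option" where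
  "dest_pi t = (case t of MPi A B \<Rightarrow> Some (A, B) | _ \<Rightarrow> None)"

definition dest_sig :: "mexpr \<Rightarrow> (mexpr \<times> mexpr) option" where
  "dest_sig t = (case t of MSig A B \<Rightarrow> Some (A, B) | _ \<Rightarrow> None)"

definition dest_lam :: "mexpr \<Rightarrow> mexpr option" where
  "dest_lam t = (case t of MLam A b \<Rightarrow> Some b | _ \<Rightarrow> None)"

definition dest_pair :: "mexpr \<Rightarrow> (mexpr \<times> mexpr) option" where
  "dest_pair t = (case t of MPair A B a b \<Rightarrow> Some (a, b) | _ \<Rightarrow> None)"

definition is_refl :: "mexpr \<Rightarrow> bool" where
  "is_refl t = (case t of MRefl a \<Rightarrow> True | _ \<Rightarrow> False)"

text \<open>Substituting for variable 0 removes its slot from \<open>g\<close>; lifting back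
  recovers \<open>g\<close> exactly when variable 0 did not occur in it.\<close>

definition lam_eta :: "mexpr \<Rightarrow> mexpr option" where
  "lam_eta b = (case b of
     MApp g v \<Rightarrow>
       (let f = subst 0 v g in if v = MVar 0 \<and> lift 1 0 f = g then Some f else None)
   | _ \<Rightarrow> None)"

definition pair_eta :: "mexpr \<Rightarrow> mexpr \<Rightarrow> mexpr option" where
  "pair_eta a b = (case a of MFst p \<Rightarrow> if b = MSnd p then Some p else None | _ \<Rightarrow> None)"

definition guard :: "bool \<Rightarrow> unit option" where
  "guard b = (if b then Some () else None)"

text \<open>The result of inference on \<open>t\<close> is a normal form of \<open>t\<close> together with its normalised type,
  or with \<open>None\<close> if \<open>t\<close> is itself a type.\<close>

type_synonym inference = "mexpr list \<Rightarrow> mexpr \<Rightarrow> (mexpr \<times> mexpr option) option"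

definition tm_of :: "inference \<Rightarrow> mexpr list \<Rightarrow> mexpr \<Rightarrow> (mexpr \<times> mexpr) option" where
  "tm_of r \<Delta> t = r \<Delta> t \<bind> (\<lambda>(t', K). case K of None \<Rightarrow> None | Some T \<Rightarrow> Some (t', T))"

definition ty_of :: "inference \<Rightarrow> mexpr list \<Rightarrow> mexpr \<Rightarrow> mexpr option" where
  "ty_of r \<Delta> t = r \<Delta> t \<bind> (\<lambda>(t', K). case K of None \<Rightarrow> Some t' | Some T \<Rightarrow> None)"

text \<open>\<open>Q\<close> is asked only at applications, pairs, projections and path inductions,
  the nodes at which a substitution is expected to form a redex. \<open>k\<close> follows the
  substituted variable below binders.\<close>

primrec any_sub :: "(nat \<Rightarrow> mexpr \<Rightarrow> bool) \<Rightarrow> nat \<Rightarrow> mexpr \<Rightarrow> bool" where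
  "any_sub Q k (MVar i) \<longleftrightarrow> False"
| "any_sub Q k (TV m) \<longleftrightarrow> False"
| "any_sub Q k (FV m t) \<longleftrightarrow> any_sub Q k t"
| "any_sub Q k (MPi A B) \<longleftrightarrow> any_sub Q k A \<or> any_sub Q (Suc k) B"
| "any_sub Q k (MLam A b) \<longleftrightarrow> any_sub Q k A \<or> any_sub Q (Suc k) b"
| "any_sub Q k (MApp f a) \<longleftrightarrow> Q k (MApp f a) \<or> any_sub Q k f \<or> any_sub Q k a"
| "any_sub Q k (MSig A B) \<longleftrightarrow> any_sub Q k A \<or> any_sub Q (Suc k) B"
| "any_sub Q k (MPair A B a b) \<longleftrightarrow>
     Q k (MPair A B a b) \<or> any_sub Q k A \<or> any_sub Q (Suc k) B \<or> any_sub Q k a \<or> any_sub Q k b"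
| "any_sub Q k (MFst p) \<longleftrightarrow> Q k (MFst p) \<or> any_sub Q k p"
| "any_sub Q k (MSnd p) \<longleftrightarrow> Q k (MSnd p) \<or> any_sub Q k p"
| "any_sub Q k (MId A a b) \<longleftrightarrow> any_sub Q k A \<or> any_sub Q k a \<or> any_sub Q k b"
| "any_sub Q k (MRefl a) \<longleftrightarrow> any_sub Q k a"
| "any_sub Q k (MJ a C d b p) \<longleftrightarrow> Q k (MJ a C d b p) \<or> any_sub Q k a \<or>
     any_sub Q (Suc (Suc k)) C \<or> any_sub Q k d \<or> any_sub Q k b \<or> any_sub Q k p"

text \<open>Whether substituting the normal term \<open>s\<close> for the variable \<open>k\<close> of a normal type may create a
  redex. The answer only saves work: soundness does not depend on it.\<close>

definition creates_redex :: "mexpr \<Rightarrow> nat \<Rightarrow> mexpr \<Rightarrow> bool" where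
  "creates_redex s k T = (case s of
     MLam A b \<Rightarrow> any_sub (\<lambda>k t. case t of MApp f a \<Rightarrow> f = MVar k | _ \<Rightarrow> False) k T
   | MPair A B a b \<Rightarrow>
       any_sub (\<lambda>k t. case t of MFst p \<Rightarrow> p = MVar k | MSnd p \<Rightarrow> p = MVar k | _ \<Rightarrow> False) k T
   | MRefl a \<Rightarrow> any_sub (\<lambda>k t. case t of MJ a C d b p \<Rightarrow> p = MVar k | _ \<Rightarrow> False) k T
   | MFst p \<Rightarrow> any_sub (\<lambda>k t. case t of MPair A B a b \<Rightarrow> a = MVar k \<or> b = MVar k | _ \<Rightarrow> False) k T
   | MSnd p \<Rightarrow> any_sub (\<lambda>k t. case t of MPair A B a b \<Rightarrow> a = MVar k \<or> b = MVar k | _ \<Rightarrow> False) k T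
   | _ \<Rightarrow> False)"

text \<open>An instance of a normal type is renormalised only if a redex may have appeared.
  Otherwise it is returned unchecked, and its well-formedness must come from the substitution
  rules.\<close>

definition inst_ty :: "inference \<Rightarrow> mexpr list \<Rightarrow> mexpr \<Rightarrow> mexpr \<Rightarrow> mexpr option" where
  "inst_ty r \<Delta> B a =
     (if creates_redex a 0 B then ty_of r \<Delta> (subst 0 a B) else Some (subst 0 a B))"

definition inst2_ty :: "inference \<Rightarrow> mexpr list \<Rightarrow> mexpr \<Rightarrow> mexpr \<Rightarrow> mexpr \<Rightarrow> mexpr option" where
  "inst2_ty r \<Delta> C b p =
     (if creates_redex b 1 C \<or> creates_redex p 0 C
      then ty_of r \<Delta> (subst2 C b p) else Some (subst2 C b p))"

text \<open>Recursive calls go through \<open>r\<close>, so that soundness concerns one layer and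
  \<open>nf\<close> supplies the fuel. Types are compared by syntactic equality of normal forms. An
  eta-contraction is made only if the contracted term is inferred to have the same type; otherwise
  the introduction form is kept.\<close>

fun step :: "inference \<Rightarrow> inference" where
  "step r \<Delta> (MVar i) =
     (if i < length \<Delta> then Some (MVar i, Some (lift (Suc i) 0 (\<Delta> ! i))) else None)"
| "step r \<Delta> (TV m) = Some (TV m, None)"
| "step r \<Delta> (FV m a) = do {
     (a', T) \<leftarrow> tm_of r \<Delta> a;
     guard (T = TV 0);
     Some (FV m a', None) }"
| "step r \<Delta> (MPi A B) = do {
     A' \<leftarrow> ty_of r \<Delta> A;
     B' \<leftarrow> ty_of r (A' # \<Delta>) B;
     Some (MPi A' B', None) }"
| "step r \<Delta> (MLam A b) = do {
     A' \<leftarrow> ty_of r \<Delta> A;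
     (b', B) \<leftarrow> tm_of r (A' # \<Delta>) b;
     (case lam_eta b' of
       None \<Rightarrow> Some (MLam A' b', Some (MPi A' B))
     | Some f \<Rightarrow> do {
         (f', T) \<leftarrow> tm_of r \<Delta> f;
         if T = MPi A' B then Some (f', Some T)
         else Some (MLam A' b', Some (MPi A' B)) }) }"
| "step r \<Delta> (MApp f a) = do {
     (f', T) \<leftarrow> tm_of r \<Delta> f;
     (A, B) \<leftarrow> dest_pi T;
     (a', A') \<leftarrow> tm_of r \<Delta> a;
     guard (A' = A);
     B' \<leftarrow> inst_ty r \<Delta> B a';
     (case dest_lam f' of
       None \<Rightarrow> Some (MApp f' a', Some B')
     | Some b \<Rightarrow> do {
         (c, C) \<leftarrow> tm_of r \<Delta> (subst 0 a' b);
         guard (C = B');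
         Some (c, Some C) }) }"
| "step r \<Delta> (MSig A B) = do {
     A' \<leftarrow> ty_of r \<Delta> A;
     B' \<leftarrow> ty_of r (A' # \<Delta>) B;
     Some (MSig A' B', None) }"
| "step r \<Delta> (MPair A B a b) = do {
     A' \<leftarrow> ty_of r \<Delta> A;
     B' \<leftarrow> ty_of r (A' # \<Delta>) B;
     (a', A'') \<leftarrow> tm_of r \<Delta> a;
     guard (A'' = A');
     (b', C) \<leftarrow> tm_of r \<Delta> b;
     C' \<leftarrow> inst_ty r \<Delta> B' a';
     guard (C = C');
     (case pair_eta a' b' of
       None \<Rightarrow> Some (MPair A' B' a' b', Some (MSig A' B'))
     | Some p \<Rightarrow> do {
         (p', T) \<leftarrow> tm_of r \<Delta> p;
         if T = MSig A' B' then Some (p', Some T)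
         else Some (MPair A' B' a' b', Some (MSig A' B')) }) }"
| "step r \<Delta> (MFst p) = do {
     (p', T) \<leftarrow> tm_of r \<Delta> p;
     (A, B) \<leftarrow> dest_sig T;
     (case dest_pair p' of
       None \<Rightarrow> Some (MFst p', Some A)
     | Some (a, b) \<Rightarrow> do {
         (a', A') \<leftarrow> tm_of r \<Delta> a;
         guard (A' = A);
         Some (a', Some A') }) }"
| "step r \<Delta> (MSnd p) = do {
     (p', T) \<leftarrow> tm_of r \<Delta> p;
     (A, B) \<leftarrow> dest_sig T;
     (case dest_pair p' of
       None \<Rightarrow> do {
         B' \<leftarrow> inst_ty r \<Delta> B (MFst p');
         Some (MSnd p', Some B') }
     | Some (a, b) \<Rightarrow> do {
         B' \<leftarrow> inst_ty r \<Delta> B a;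
         (b', C) \<leftarrow> tm_of r \<Delta> b;
         guard (C = B');
         Some (b', Some C) }) }"
| "step r \<Delta> (MId A a b) = do {
     A' \<leftarrow> ty_of r \<Delta> A;
     (a', A1) \<leftarrow> tm_of r \<Delta> a;
     guard (A1 = A');
     (b', A2) \<leftarrow> tm_of r \<Delta> b;
     guard (A2 = A');
     Some (MId A' a' b', None) }"
| "step r \<Delta> (MRefl a) = do {
     (a', A) \<leftarrow> tm_of r \<Delta> a;
     Some (MRefl a', Some (MId A a' a')) }"
| "step r \<Delta> (MJ a C d b p) = do {
     (a', A) \<leftarrow> tm_of r \<Delta> a;
     C' \<leftarrow> ty_of r (MId (lift 1 0 A) (lift 1 0 a') (MVar 0) # A # \<Delta>) C;
     (d', D) \<leftarrow> tm_of r \<Delta> d;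
     D' \<leftarrow> inst2_ty r \<Delta> C' a' (MRefl a');
     guard (D = D');
     (b', A') \<leftarrow> tm_of r \<Delta> b;
     guard (A' = A);
     (p', P) \<leftarrow> tm_of r \<Delta> p;
     guard (P = MId A a' b');
     if is_refl p' then Some (d', Some D)
     else do {
       T \<leftarrow> inst2_ty r \<Delta> C' b' p';
       Some (MJ a' C' d' b' p', Some T) } }"

primrec nf :: "nat \<Rightarrow> inference" where
  "nf 0 = (\<lambda>\<Delta> t. None)"
| "nf (Suc n) = step (nf n)"

section \<open>Soundness of the procedure\<close>

abbreviation paths_from :: "'c expr \<Rightarrow> 'c expr \<Rightarrow> 'c expr" where
  "paths_from A a \<equiv> Idt (wk 1 A) (wk 1 a) (Var 0)"

lemma ctx_paths_from:
  assumes "ty \<S> \<Gamma> A" "tm \<S> \<Gamma> a A"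
  shows "ctx \<S> (A # \<Gamma>)" "ty \<S> (A # \<Gamma>) (paths_from A a)" "ctx \<S> (paths_from A a # A # \<Gamma>)"
proof -
  show c: "ctx \<S> (A # \<Gamma>)" using assms(1) ctx_of by (blast intro: ctx_cons)
  then show t: "ty \<S> (A # \<Gamma>) (paths_from A a)"
    using ty_wk1 [OF assms(1) c] tm_wk1 [OF assms(2) c] tm_var [OF c, of 0] by (auto intro: Id_form)
  show "ctx \<S> (paths_from A a # A # \<Gamma>)" using c t by (rule ctx_cons)
qed

lemma sub_paths_from: "sub (case_nat b Var) (paths_from A a) = Idt A a b"
  by (simp add: wk_1 sub_ren sub_Var)

lemma mor_inst2:
  assumes "ctx \<S> \<Gamma>" "tm \<S> \<Gamma> b A" "tm \<S> \<Gamma> p (Idt A a b)"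
  shows "mor \<S> \<Gamma> (case_nat p (case_nat b Var)) (paths_from A a # A # \<Gamma>)"
  using mor_cons [OF mor_inst [OF assms(1,2)], of p "paths_from A a"] assms(3)
  by (simp only: sub_paths_from)

lemma ty_inst2_cong:
  assumes c: "ctx \<S> \<Gamma>" and C: "ty \<S> (paths_from A a # A # \<Gamma>) C"
    and b: "tm \<S> \<Gamma> b A" "tm \<S> \<Gamma> b' A" "tmeq \<S> \<Gamma> b b' A"
    and p: "tm \<S> \<Gamma> p (Idt A a b)" "tm \<S> \<Gamma> p' (Idt A a b')" "tmeq \<S> \<Gamma> p p' (Idt A a b)"
  shows "tyeq \<S> \<Gamma> (inst2 C b p) (inst2 C b' p')"
  unfolding inst2_def
proof (rule ty_mor_cong [OF C c mor_inst2 [OF c b(1) p(1)] mor_inst2 [OF c b(2) p(2)]],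
    intro allI impI)
  let ?\<sigma> = "case_nat p (case_nat b Var)" and ?\<tau> = "case_nat p' (case_nat b' Var)"
  fix i assume i: "i < length (paths_from A a # A # \<Gamma>)"
  consider "i = 0" | "i = 1" | j where "i = Suc (Suc j)" by (metis One_nat_def not0_implies_Suc)
  then show "tmeq \<S> \<Gamma> (?\<sigma> i) (?\<tau> i) (sub (\<lambda>k. ?\<sigma> (k + Suc i)) ((paths_from A a # A # \<Gamma>) ! i))"
  proof cases
    case 1
    with p(3) show ?thesis using sub_paths_from [of b A a] by simp
  next
    case 2
    with b(3) show ?thesis by (simp add: sub_Var)
  next
    case 3
    with i mor_Var [OF c] show ?thesis by (auto simp: mor_def intro!: tmeq_refl)
  qed
qed

text \<open>The motives live over the paths from \<open>a'\<close>, since the procedure checks them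
  after normalising \<open>a\<close>; context conversion moves them to the paths from
  \<open>a\<close>. The types of the two path inductions then agree by congruence in endpoint and
  path, followed by the equality of the motives.\<close>

lemma J_conv:
  assumes A: "ty \<S> \<Gamma> A" and a: "tm \<S> \<Gamma> a A" "tm \<S> \<Gamma> a' A" "tmeq \<S> \<Gamma> a a' A"
    and C: "ty \<S> (paths_from A a' # A # \<Gamma>) C" "ty \<S> (paths_from A a' # A # \<Gamma>) C'"
      "tyeq \<S> (paths_from A a' # A # \<Gamma>) C C'"
    and d: "tm \<S> \<Gamma> d D" "tm \<S> \<Gamma> d' D" "tmeq \<S> \<Gamma> d d' D"
    and D: "tyeq \<S> \<Gamma> (inst2 C' a' (Refl a')) D"
    and b: "tm \<S> \<Gamma> b A" "tm \<S> \<Gamma> b' A" "tmeq \<S> \<Gamma> b b' A"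
    and p: "tm \<S> \<Gamma> p (Idt A a' b')" "tm \<S> \<Gamma> p' (Idt A a' b')" "tmeq \<S> \<Gamma> p p' (Idt A a' b')"
    and T: "tyeq \<S> \<Gamma> (inst2 C' b' p') T"
  shows "tm \<S> \<Gamma> (J a C d b p) T" "tm \<S> \<Gamma> (J a' C' d' b' p') T"
    "tmeq \<S> \<Gamma> (J a C d b p) (J a' C' d' b' p') T"
proof -
  have c: "ctx \<S> \<Gamma>" using A ctx_of by blast
  have cA: "ctx \<S> (A # \<Gamma>)" using ctx_paths_from [OF A a(1)] by blast
  have eqP: "tyeq \<S> (A # \<Gamma>) (paths_from A a) (paths_from A a')"
    using tyeq_wk1 [OF tyeq_refl [OF A] cA] tmeq_wk1 [OF a(3) cA] tm_var [OF cA, of 0]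
    by (auto intro: Id_cong tmeq_refl)
  note conv = conv_head [OF ctx_paths_from(2) [OF A a(1)] eqP]
  have Ca: "ty \<S> (paths_from A a # A # \<Gamma>) C" "tyeq \<S> (paths_from A a # A # \<Gamma>) C C'"
    using C conv by blast+
  have Id: "tyeq \<S> \<Gamma> (Idt A a' b') (Idt A a b)" "tyeq \<S> \<Gamma> (Idt A a' b') (Idt A a b')"
    "tyeq \<S> \<Gamma> (Idt A a a) (Idt A a a')" "tyeq \<S> \<Gamma> (Idt A a' a') (Idt A a a')"
    using A a b by (auto intro: Id_cong tyeq_refl tmeq_refl tmeq_sym)
  have r: "tm \<S> \<Gamma> (Refl a) (Idt A a a)" "tm \<S> \<Gamma> (Refl a') (Idt A a' a')"
    "tm \<S> \<Gamma> (Refl a') (Idt A a a')" "tmeq \<S> \<Gamma> (Refl a) (Refl a') (Idt A a a)"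
    using A a Id by (auto intro: Refl Refl_cong tm_conv)
  have p1: "tm \<S> \<Gamma> p (Idt A a b)" "tm \<S> \<Gamma> p' (Idt A a b')" "tmeq \<S> \<Gamma> p p' (Idt A a b)"
    using p Id by (auto intro: tm_conv tmeq_conv)
  have at: "tyeq \<S> \<Gamma> (inst2 C x q) (inst2 C' x q)" if "tm \<S> \<Gamma> x A" "tm \<S> \<Gamma> q (Idt A a' x)" for x q
    unfolding inst2_def using C(3) c mor_inst2 [OF c that] by (rule tyeq_mor)
  have "tyeq \<S> \<Gamma> (inst2 C a (Refl a)) (inst2 C a' (Refl a'))"
    using c Ca(1) a r(1,3,4) by (rule ty_inst2_cong)
  then have "tyeq \<S> \<Gamma> (inst2 C a (Refl a)) D"
    using at [OF a(2) r(2)] D by (blast intro: tyeq_trans)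
  then have d1: "tm \<S> \<Gamma> d (inst2 C a (Refl a))" "tmeq \<S> \<Gamma> d d' (inst2 C a (Refl a))"
    using d by (blast intro: tm_conv tmeq_conv tyeq_sym)+
  have d2: "tm \<S> \<Gamma> d' (inst2 C' a' (Refl a'))"
    using d D by (blast intro: tm_conv tyeq_sym)
  have "tyeq \<S> \<Gamma> (inst2 C b p) (inst2 C b' p')"
    using c Ca(1) b p1 by (rule ty_inst2_cong)
  then have T1: "tyeq \<S> \<Gamma> (inst2 C b p) T"
    using at [OF b(2) p(2)] T by (blast intro: tyeq_trans)
  show "tm \<S> \<Gamma> (J a C d b p) T"
    using J [OF A a(1) Ca(1) d1(1) b(1) p1(1)] T1 by (rule tm_conv)
  show "tm \<S> \<Gamma> (J a' C' d' b' p') T"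
    using J [OF A a(2) C(2) d2 b(2) p(2)] T by (rule tm_conv)
  show "tmeq \<S> \<Gamma> (J a C d b p) (J a' C' d' b' p') T"
    using J_cong [OF A a(3) Ca d1(2) b(3) p1(3)] T1 by (rule tmeq_conv)
qed

section \<open>Interpretation of schematic judgements and the notion of soundness\<close>

locale schema_model =
  fixes \<S> :: "'c \<rightharpoonup> 'c expr" and \<Gamma> :: "'c expr list" and I F :: "nat \<Rightarrow> 'c expr"
  assumes base_ctx: "ctx \<S> \<Gamma>"
    and ty_I: "\<And>m. ty \<S> \<Gamma> (I m)"
    and ty_F: "\<And>m. ty \<S> (I 0 # \<Gamma>) (F m)"
begin

primrec ictx :: "mexpr list \<Rightarrow> 'c expr list" where
  "ictx [] = \<Gamma>"
| "ictx (T # \<Delta>) = interp I F (length \<Delta>) T # ictx \<Delta>"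

abbreviation "Ctx \<Delta> \<equiv> ctx \<S> (ictx \<Delta>)"
abbreviation "Ty \<Delta> T \<equiv> ty \<S> (ictx \<Delta>) (interp I F (length \<Delta>) T)"
abbreviation "TyEq \<Delta> T T' \<equiv> tyeq \<S> (ictx \<Delta>) (interp I F (length \<Delta>) T) (interp I F (length \<Delta>) T')"
abbreviation "Tm \<Delta> t T \<equiv> tm \<S> (ictx \<Delta>) (interp I F (length \<Delta>) t) (interp I F (length \<Delta>) T)"
abbreviation "TmEq \<Delta> t t' T \<equiv> tmeq \<S> (ictx \<Delta>)
  (interp I F (length \<Delta>) t) (interp I F (length \<Delta>) t') (interp I F (length \<Delta>) T)"

lemma ictx_append: "\<exists>\<Delta>'. length \<Delta>' = length \<Delta> \<and> ictx \<Delta> = \<Delta>' @ \<Gamma>"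
proof (induction \<Delta>)
  case (Cons T \<Delta>)
  then obtain \<Delta>' where "length \<Delta>' = length \<Delta>" "ictx \<Delta> = \<Delta>' @ \<Gamma>" by blast
  then show ?case
    by (intro exI [of _ "interp I F (length \<Delta>) T # \<Delta>'"]) simp
qed simp

lemma mor_base: "Ctx \<Delta> \<Longrightarrow> mor \<S> (ictx \<Delta>) (\<lambda>i. Var (i + length \<Delta>)) \<Gamma>"
  using ictx_append [of \<Delta>] mor_wk by metis

lemma Tm_Var:
  assumes "Ctx \<Delta>" "i < length \<Delta>"
  shows "Tm \<Delta> (MVar i) (lift (Suc i) 0 (\<Delta> ! i))"
proof -
  have "i < length (ictx \<Delta>) \<and> ictx \<Delta> ! i = interp I F (length \<Delta> - Suc i) (\<Delta> ! i)"
    using assms(2)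
  proof (induction \<Delta> arbitrary: i)
    case (Cons T \<Delta>)
    then show ?case by (cases i) auto
  qed simp
  moreover have "interp I F (length \<Delta>) (lift (Suc i) 0 (\<Delta> ! i)) =
      wk (Suc i) (interp I F (length \<Delta> - Suc i) (\<Delta> ! i))"
    using interp_lift_0 [of I F "length \<Delta> - Suc i" "Suc i" "\<Delta> ! i"] assms(2)
    by (simp del: add_Suc_right)
  ultimately show ?thesis
    using tm_var [OF assms(1), of i] by simp
qed

lemma Ty_Var:
  assumes "Ctx \<Delta>" "i < length \<Delta>"
  shows "Ty \<Delta> (lift (Suc i) 0 (\<Delta> ! i))"
  using assms
proof (induction \<Delta> arbitrary: i)
  case (Cons T \<Delta>)
  have c: "Ctx \<Delta>" and T: "Ty \<Delta> T"
    using Cons.prems(1) by (auto elim: ctx.cases)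
  have w: "interp I F (Suc (length \<Delta>)) (lift (Suc i) 0 U) = wk 1 (interp I F (length \<Delta>) (lift i 0 U))"
    if "i \<le> length \<Delta>" for U
    using interp_lift_0 [of I F "length \<Delta> - i" "Suc i" U]
      interp_lift_0 [of I F "length \<Delta> - i" i U] that
    by (simp add: wk_def ren_ren)
  show ?case
  proof (cases i)
    case 0
    have "interp I F (length \<Delta>) (lift 0 0 T) = interp I F (length \<Delta>) T"
      using interp_lift_0 [of I F "length \<Delta>" 0 T] by (simp add: wk_def ren_id)
    with w [of T] T 0 show ?thesis using ty_wk1 [OF T] Cons.prems(1) by simp
  next
    case (Suc j)
    with Cons.IH [OF c, of j] Cons.prems w [of "\<Delta> ! j"] show ?thesis
      using ty_wk1 by simp
  qed
qed simp

text \<open>The replacement for injectivity of type formers: an introduction form in normal form has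
  an inferred type of matching form, and its parts are typed at the arguments of exactly that type.
  This is what contracting a redex requires.\<close>

definition shape :: "mexpr list \<Rightarrow> mexpr \<Rightarrow> mexpr \<Rightarrow> bool" where
  "shape \<Delta> t T \<longleftrightarrow>
     (\<forall>A b. t = MLam A b \<longrightarrow> (\<exists>B. T = MPi A B \<and> Tm (A # \<Delta>) b B)) \<and>
     (\<forall>A' B' a b. t = MPair A' B' a b \<longrightarrow> (\<exists>A B. T = MSig A B \<and> Tm \<Delta> a A \<and> Tm \<Delta> b (subst 0 a B))) \<and>
     (\<forall>a. t = MRefl a \<longrightarrow> (\<exists>A. T = MId A a a))"

definition sound_ty :: "mexpr list \<Rightarrow> mexpr \<Rightarrow> mexpr \<Rightarrow> bool" where
  "sound_ty \<Delta> t t' \<longleftrightarrow> Ty \<Delta> t \<and> Ty \<Delta> t' \<and> TyEq \<Delta> t t'"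

text \<open>Well-formedness of the type is carried along, since \<open>ctx_of\<close> extracts only
  the context from a typing derivation.\<close>

definition sound_tm :: "mexpr list \<Rightarrow> mexpr \<Rightarrow> mexpr \<Rightarrow> mexpr \<Rightarrow> bool" where
  "sound_tm \<Delta> t t' T \<longleftrightarrow> Ty \<Delta> T \<and> Tm \<Delta> t T \<and> Tm \<Delta> t' T \<and> TmEq \<Delta> t t' T \<and> shape \<Delta> t' T"

definition sound :: "inference \<Rightarrow> bool" where
  "sound r \<longleftrightarrow> (\<forall>\<Delta> t t' K. Ctx \<Delta> \<longrightarrow> r \<Delta> t = Some (t', K) \<longrightarrow>
     (case K of None \<Rightarrow> sound_ty \<Delta> t t' | Some T \<Rightarrow> sound_tm \<Delta> t t' T))"

lemma sound_tm_of: "\<lbrakk>sound r; Ctx \<Delta>; tm_of r \<Delta> t = Some (t', T)\<rbrakk> \<Longrightarrow> sound_tm \<Delta> t t' T"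
  unfolding sound_def tm_of_def
  by (force simp: bind_eq_Some_conv split: option.splits)

lemma sound_ty_of: "\<lbrakk>sound r; Ctx \<Delta>; ty_of r \<Delta> t = Some t'\<rbrakk> \<Longrightarrow> sound_ty \<Delta> t t'"
  unfolding sound_def ty_of_def
  by (force simp: bind_eq_Some_conv split: option.splits)

lemma sound_inst_ty:
  "\<lbrakk>sound r; Ctx \<Delta>; inst_ty r \<Delta> B a = Some T; Ty \<Delta> (subst 0 a B)\<rbrakk> \<Longrightarrow> sound_ty \<Delta> (subst 0 a B) T"
  unfolding inst_ty_def by (auto simp: sound_ty_def tyeq_refl split: if_splits dest: sound_ty_of)

lemma sound_inst2_ty:
  "\<lbrakk>sound r; Ctx \<Delta>; inst2_ty r \<Delta> C b p = Some T; Ty \<Delta> (subst2 C b p)\<rbrakk>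
    \<Longrightarrow> sound_ty \<Delta> (subst2 C b p) T"
  unfolding inst2_ty_def by (auto simp: sound_ty_def tyeq_refl split: if_splits dest: sound_ty_of)

lemma sound_tmI:
  "\<lbrakk>Ty \<Delta> T; Tm \<Delta> t T; Tm \<Delta> t' T; TmEq \<Delta> t t' T; shape \<Delta> t' T\<rbrakk> \<Longrightarrow> sound_tm \<Delta> t t' T"
  by (simp add: sound_tm_def)

lemma sound_tm_trans:
  assumes "Tm \<Delta> t T" "TmEq \<Delta> t u T" "sound_tm \<Delta> u t' T"
  shows "sound_tm \<Delta> t t' T"
  using assms by (auto simp: sound_tm_def intro: tmeq_trans)

section \<open>Soundness of the individual inference steps\<close>

lemma sound_Var: "\<lbrakk>Ctx \<Delta>; i < length \<Delta>\<rbrakk> \<Longrightarrow> sound_tm \<Delta> (MVar i) (MVar i) (lift (Suc i) 0 (\<Delta> ! i))"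
  using Tm_Var Ty_Var by (auto simp: sound_tm_def shape_def intro: tmeq_refl)

lemma sound_TV: "Ctx \<Delta> \<Longrightarrow> sound_ty \<Delta> (TV m) (TV m)"
  using ty_mor [OF ty_I _ mor_base]
  by (auto simp: sound_ty_def sub_Var_ren wk_def intro: tyeq_refl)

lemma sound_FV:
  assumes c: "Ctx \<Delta>" and a: "sound_tm \<Delta> a a' (TV 0)"
  shows "sound_ty \<Delta> (FV m a) (FV m a')"
proof -
  let ?\<sigma> = "\<lambda>a. case_nat (interp I F (length \<Delta>) a) (\<lambda>i. Var (i + length \<Delta>))"
  have mor: "mor \<S> (ictx \<Delta>) (?\<sigma> a) (I 0 # \<Gamma>)" if "Tm \<Delta> a (TV 0)" for a
    using mor_cons [OF mor_base [OF c]] that by (simp add: sub_Var_ren wk_def)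
  have a1: "Tm \<Delta> a (TV 0)" and a2: "Tm \<Delta> a' (TV 0)" and a3: "TmEq \<Delta> a a' (TV 0)"
    using a by (auto simp: sound_tm_def)
  have "tyeq \<S> (ictx \<Delta>) (sub (?\<sigma> a) (F m)) (sub (?\<sigma> a') (F m))"
  proof (rule ty_mor_cong [OF ty_F c mor [OF a1] mor [OF a2]], intro allI impI)
    fix i assume i: "i < length (I 0 # \<Gamma>)"
    show "tmeq \<S> (ictx \<Delta>) (?\<sigma> a i) (?\<sigma> a' i) (sub (\<lambda>k. ?\<sigma> a (k + Suc i)) ((I 0 # \<Gamma>) ! i))"
    proof (cases i)
      case 0
      then show ?thesis using a3 by (simp add: sub_Var_ren wk_def)
    next
      case (Suc j)
      then show ?thesis using mor_base [OF c] i by (auto simp: mor_def intro!: tmeq_refl)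
    qed
  qed
  then show ?thesis
    using ty_mor [OF ty_F c mor [OF a1]] ty_mor [OF ty_F c mor [OF a2]] by (simp add: sound_ty_def)
qed

lemma sound_binder:
  assumes c: "Ctx \<Delta>" and A: "sound_ty \<Delta> A A'" and B: "sound_ty (A' # \<Delta>) B B'"
  shows "sound_ty \<Delta> (MPi A B) (MPi A' B')" "sound_ty \<Delta> (MSig A B) (MSig A' B')"
proof -
  have A1: "Ty \<Delta> A" and A2: "Ty \<Delta> A'" and A3: "TyEq \<Delta> A A'"
    using A by (auto simp: sound_ty_def)
  have B1: "Ty (A' # \<Delta>) B'" and B2: "Ty (A # \<Delta>) B" and B3: "TyEq (A # \<Delta>) B B'"
    using B conv_head [OF A1 A3] by (auto simp: sound_ty_def)
  show "sound_ty \<Delta> (MPi A B) (MPi A' B')" "sound_ty \<Delta> (MSig A B) (MSig A' B')"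
    using A1 A2 A3 B1 B2 B3
    by (auto simp: sound_ty_def intro: Pi_form Pi_cong Sig_form Sig_cong)
qed

text \<open>The body is inferred over the normalised domain. Context conversion moves it to the
  original domain, where the abstraction is formed before its type is converted.\<close>

lemma sound_Lam:
  assumes c: "Ctx \<Delta>" and A: "sound_ty \<Delta> A A'" and b: "sound_tm (A' # \<Delta>) b b' B"
  shows "sound_tm \<Delta> (MLam A b) (MLam A' b') (MPi A' B)"
proof -
  have A1: "Ty \<Delta> A" and A2: "Ty \<Delta> A'" and A3: "TyEq \<Delta> A A'"
    using A by (auto simp: sound_ty_def)
  have B: "Ty (A' # \<Delta>) B" and b2: "Tm (A' # \<Delta>) b' B"
    using b by (auto simp: sound_tm_def)
  have B': "Ty (A # \<Delta>) B" and b1: "Tm (A # \<Delta>) b B" and b3: "TmEq (A # \<Delta>) b b' B"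
    using b conv_head [OF A1 A3] by (auto simp: sound_tm_def)
  have eq: "TyEq \<Delta> (MPi A B) (MPi A' B)"
    using A1 B' A3 by (auto intro: Pi_cong tyeq_refl)
  show ?thesis
  proof (rule sound_tmI)
    show "Ty \<Delta> (MPi A' B)" using A2 B by (auto intro: Pi_form)
    have "Tm \<Delta> (MLam A b) (MPi A B)" using A1 B' b1 by (auto intro: Lam)
    then show "Tm \<Delta> (MLam A b) (MPi A' B)" using eq by (rule tm_conv)
    show "Tm \<Delta> (MLam A' b') (MPi A' B)" using A2 B b2 by (auto intro: Lam)
    have "TmEq \<Delta> (MLam A b) (MLam A' b') (MPi A B)"
      using A1 B' A3 b3 by (auto intro: Lam_cong)
    then show "TmEq \<Delta> (MLam A b) (MLam A' b') (MPi A' B)" using eq by (rule tmeq_conv)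
    show "shape \<Delta> (MLam A' b') (MPi A' B)" using b2 by (simp add: shape_def)
  qed
qed

lemma lam_eta_Some:
  "lam_eta b = Some f \<Longrightarrow> b = MApp (lift 1 0 f) (MVar 0)"
  by (auto simp: lam_eta_def Let_def split: mexpr.splits if_splits)

lemma sound_Lam_eta:
  assumes c: "Ctx \<Delta>" and A: "sound_ty \<Delta> A A'" and b: "sound_tm (A' # \<Delta>) b b' B"
    and e: "lam_eta b' = Some f" and f: "sound_tm \<Delta> f f' (MPi A' B)"
  shows "sound_tm \<Delta> (MLam A b) f' (MPi A' B)"
proof -
  note l = sound_Lam [OF c A b]
  have b': "b' = MApp (lift 1 0 f) (MVar 0)" using e by (rule lam_eta_Some)
  have "Ty \<Delta> (MPi A' B)" "Tm \<Delta> f (MPi A' B)" using f by (auto simp: sound_tm_def)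
  then have "TmEq \<Delta> f (MLam A' b') (MPi A' B)"
    using Pi_eta ty_Pi_inv unfolding b' by (fastforce simp: interp_lift_1)
  then have "TmEq \<Delta> (MLam A b) f (MPi A' B)"
    using l by (auto simp: sound_tm_def intro: tmeq_trans tmeq_sym)
  then show ?thesis using l f by (auto simp: sound_tm_def intro: tmeq_trans)
qed

lemma Ty_subst: "\<lbrakk>Ctx \<Delta>; Ty (A # \<Delta>) B; Tm \<Delta> a A\<rbrakk> \<Longrightarrow> Ty \<Delta> (subst 0 a B)"
  using ty_inst by (fastforce simp: interp_subst_0)

lemma TyEq_subst:
  assumes "Ctx \<Delta>" "Ty (A # \<Delta>) B" "sound_tm \<Delta> a a' A"
  shows "TyEq \<Delta> (subst 0 a B) (subst 0 a' B)"
  using assms ty_inst_cong by (fastforce simp: interp_subst_0 sound_tm_def)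

lemma sound_App:
  assumes c: "Ctx \<Delta>" and f: "sound_tm \<Delta> f f' (MPi A B)" and a: "sound_tm \<Delta> a a' A"
    and B': "sound_ty \<Delta> (subst 0 a' B) B'"
  shows "sound_tm \<Delta> (MApp f a) (MApp f' a') B'"
proof -
  have A: "Ty \<Delta> A" and B: "Ty (A # \<Delta>) B"
    using f ty_Pi_inv by (auto simp: sound_tm_def)
  have eq: "TyEq \<Delta> (subst 0 a B) (subst 0 a' B)"
    using c B a by (rule TyEq_subst)
  have eq': "TyEq \<Delta> (subst 0 a' B) B'" "Ty \<Delta> B'" using B' by (auto simp: sound_ty_def)
  have app: "Tm \<Delta> (MApp g x) (subst 0 x B)" if "Tm \<Delta> g (MPi A B)" "Tm \<Delta> x A" for g x
    using App A B that by (fastforce simp: interp_subst_0)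
  have "TmEq \<Delta> (MApp f a) (MApp f' a') (subst 0 a B)"
    using App_cong A B f a by (fastforce simp: interp_subst_0 sound_tm_def)
  moreover have "Tm \<Delta> (MApp f a) (subst 0 a B)" "Tm \<Delta> (MApp f' a') (subst 0 a' B)"
    using f a app by (auto simp: sound_tm_def)
  ultimately show ?thesis
    using tyeq_trans [OF eq eq'(1)] eq'
    by (auto simp: shape_def intro!: sound_tmI intro: tm_conv tmeq_conv)
qed

text \<open>By \<open>shape\<close>, the domain annotation of the abstraction is the domain
  \<open>A\<close> of the inferred type and \<open>b\<close> is typed over it, so
  \<open>Pi_beta\<close> applies at that type.\<close>

lemma sound_beta:
  assumes c: "Ctx \<Delta>" and f: "sound_tm \<Delta> f (MLam A' b) (MPi A B)" and a: "sound_tm \<Delta> a a' A"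
    and B': "sound_ty \<Delta> (subst 0 a' B) B'" and b: "sound_tm \<Delta> (subst 0 a' b) t B'"
  shows "sound_tm \<Delta> (MApp f a) t B'"
proof (rule sound_tm_trans [OF _ _ b])
  note s = sound_App [OF c f a B']
  show "Tm \<Delta> (MApp f a) B'" using s by (simp add: sound_tm_def)
  have A: "Ty \<Delta> A" and B: "Ty (A # \<Delta>) B"
    using f ty_Pi_inv by (auto simp: sound_tm_def)
  have "Tm (A # \<Delta>) b B" "A' = A" using f by (auto simp: sound_tm_def shape_def)
  then have "TmEq \<Delta> (MApp (MLam A' b) a') (subst 0 a' b) (subst 0 a' B)"
    using Pi_beta A B a by (fastforce simp: interp_subst_0 sound_tm_def)
  then have "TmEq \<Delta> (MApp (MLam A' b) a') (subst 0 a' b) B'"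
    using B' by (auto simp: sound_ty_def intro: tmeq_conv)
  with s show "TmEq \<Delta> (MApp f a) (subst 0 a' b) B'"
    by (auto simp: sound_tm_def intro: tmeq_trans)
qed

lemma sound_Pair:
  assumes c: "Ctx \<Delta>" and A: "sound_ty \<Delta> A A'" and B: "sound_ty (A' # \<Delta>) B B'"
    and a: "sound_tm \<Delta> a a' A'" and b: "sound_tm \<Delta> b b' C" and C: "sound_ty \<Delta> (subst 0 a' B') C"
  shows "sound_tm \<Delta> (MPair A B a b) (MPair A' B' a' b') (MSig A' B')"
proof -
  have A': "Ty \<Delta> A'" and B': "Ty (A' # \<Delta>) B'" using A B by (auto simp: sound_ty_def)
  have eq: "TyEq \<Delta> C (subst 0 a' B')" using C by (auto simp: sound_ty_def intro: tyeq_sym)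
  have eq': "TyEq \<Delta> C (subst 0 a B')"
    using eq TyEq_subst [OF c B' a] by (auto intro: tyeq_trans tyeq_sym)
  have b2: "Tm \<Delta> b' (subst 0 a' B')" and b1: "Tm \<Delta> b (subst 0 a B')"
    and b3: "TmEq \<Delta> b b' (subst 0 a B')"
    using b eq eq' by (auto simp: sound_tm_def intro: tm_conv tmeq_conv)
  show ?thesis
    using a b1 b2 b3 A' B' Pair [of \<S> _ _ _ "interp I F (length \<Delta>) a" "interp I F (length \<Delta>) b"]
      Pair [of \<S> _ _ _ "interp I F (length \<Delta>) a'" "interp I F (length \<Delta>) b'"] Pair_cong
    by (intro sound_tmI) (auto simp: interp_subst_0 sound_tm_def shape_def intro: Sig_form)
qed

lemma pair_eta_Some: "pair_eta a b = Some p \<Longrightarrow> a = MFst p \<and> b = MSnd p"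
  by (auto simp: pair_eta_def split: mexpr.splits if_splits)

lemma sound_Pair_eta:
  assumes c: "Ctx \<Delta>" and A: "sound_ty \<Delta> A A'" and B: "sound_ty (A' # \<Delta>) B B'"
    and a: "sound_tm \<Delta> a a' A'" and b: "sound_tm \<Delta> b b' C" and C: "sound_ty \<Delta> (subst 0 a' B') C"
    and e: "pair_eta a' b' = Some p" and p: "sound_tm \<Delta> p p' (MSig A' B')"
  shows "sound_tm \<Delta> (MPair A B a b) p' (MSig A' B')"
proof -
  note l = sound_Pair [OF c A B a b C]
  have e': "a' = MFst p" "b' = MSnd p" using pair_eta_Some [OF e] by auto
  have "Ty \<Delta> (MSig A' B')" "Tm \<Delta> p (MSig A' B')" using p by (auto simp: sound_tm_def)
  then have "TmEq \<Delta> p (MPair A' B' a' b') (MSig A' B')"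
    using Sig_eta ty_Sig_inv unfolding e' by fastforce
  then have "TmEq \<Delta> (MPair A B a b) p (MSig A' B')"
    using l by (auto simp: sound_tm_def intro: tmeq_trans tmeq_sym)
  then show ?thesis using l p by (auto simp: sound_tm_def intro: tmeq_trans)
qed

lemma sound_Fst:
  assumes p: "sound_tm \<Delta> p p' (MSig A B)"
  shows "sound_tm \<Delta> (MFst p) (MFst p') A"
proof -
  have A: "Ty \<Delta> A" and B: "Ty (A # \<Delta>) B"
    using p ty_Sig_inv by (auto simp: sound_tm_def)
  then show ?thesis
    using p by (auto simp: sound_tm_def shape_def intro: Fst Fst_cong)
qed

lemma sound_Fst_beta:
  assumes p: "sound_tm \<Delta> p (MPair A' B' a b) (MSig A B)" and a: "sound_tm \<Delta> a a' A"
  shows "sound_tm \<Delta> (MFst p) a' A"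
proof (rule sound_tm_trans [OF _ _ a])
  note s = sound_Fst [OF p]
  show "Tm \<Delta> (MFst p) A" using s by (simp add: sound_tm_def)
  have "Ty \<Delta> A" "Ty (A # \<Delta>) B" using p ty_Sig_inv by (auto simp: sound_tm_def)
  moreover have "Tm \<Delta> a A" "Tm \<Delta> b (subst 0 a B)"
    using p by (auto simp: sound_tm_def shape_def)
  ultimately have "TmEq \<Delta> (MFst (MPair A' B' a b)) a A"
    using Sig_beta1 by (fastforce simp: interp_subst_0)
  with s show "TmEq \<Delta> (MFst p) a A" by (auto simp: sound_tm_def intro: tmeq_trans)
qed

lemma sound_Snd:
  assumes c: "Ctx \<Delta>" and p: "sound_tm \<Delta> p p' (MSig A B)"
    and B': "TyEq \<Delta> (subst 0 (MFst p') B) B'" "Ty \<Delta> B'"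
  shows "sound_tm \<Delta> (MSnd p) (MSnd p') B'"
proof -
  have A: "Ty \<Delta> A" and B: "Ty (A # \<Delta>) B"
    using p ty_Sig_inv by (auto simp: sound_tm_def)
  have eq: "TyEq \<Delta> (subst 0 (MFst p) B) B'"
    using TyEq_subst [OF c B sound_Fst [OF p]] B'(1) by (rule tyeq_trans)
  have "Tm \<Delta> (MSnd p) (subst 0 (MFst p) B)" "Tm \<Delta> (MSnd p') (subst 0 (MFst p') B)"
    "TmEq \<Delta> (MSnd p) (MSnd p') (subst 0 (MFst p) B)"
    using p A B Snd Snd_cong by (fastforce simp: interp_subst_0 sound_tm_def)+
  then show ?thesis
    using eq B' by (auto simp: shape_def intro!: sound_tmI intro: tm_conv tmeq_conv)
qed

text \<open>The second projection of the pair has its type at the first projection; the beta-rule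
  for the latter turns this into the instance at \<open>a\<close>, where \<open>b\<close> is
  typed.\<close>

lemma sound_Snd_beta:
  assumes c: "Ctx \<Delta>" and p: "sound_tm \<Delta> p (MPair A' C' a b) (MSig A B)"
    and B': "sound_ty \<Delta> (subst 0 a B) B'" and b: "sound_tm \<Delta> b b' B'"
  shows "sound_tm \<Delta> (MSnd p) b' B'"
proof (rule sound_tm_trans [OF _ _ b])
  have A: "Ty \<Delta> A" and B: "Ty (A # \<Delta>) B"
    using p ty_Sig_inv by (auto simp: sound_tm_def)
  have ab: "Tm \<Delta> a A" "Tm \<Delta> b (subst 0 a B)"
    using p by (auto simp: sound_tm_def shape_def)
  have "TmEq \<Delta> (MFst (MPair A' C' a b)) a A"
    using Sig_beta1 A B ab by (fastforce simp: interp_subst_0)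
  moreover have "Tm \<Delta> (MFst (MPair A' C' a b)) A"
    using p A B by (auto simp: sound_tm_def intro: Fst)
  ultimately have "TyEq \<Delta> (subst 0 (MFst (MPair A' C' a b)) B) (subst 0 a B)"
    using ty_inst_cong [of \<S> "interp I F (length \<Delta>) A" "ictx \<Delta>"] A B ab c
    by (fastforce simp: interp_subst_0)
  then have "TyEq \<Delta> (subst 0 (MFst (MPair A' C' a b)) B) B'" "Ty \<Delta> B'"
    using B' by (auto simp: sound_ty_def intro: tyeq_trans)
  note s = sound_Snd [OF c p this]
  then show "Tm \<Delta> (MSnd p) B'" by (simp add: sound_tm_def)
  have "TmEq \<Delta> (MSnd (MPair A' C' a b)) b (subst 0 a B)"
    using Sig_beta2 A B ab by (fastforce simp: interp_subst_0)
  then have "TmEq \<Delta> (MSnd (MPair A' C' a b)) b B'"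
    using B' by (auto simp: sound_ty_def intro: tmeq_conv)
  with s show "TmEq \<Delta> (MSnd p) b B'" by (auto simp: sound_tm_def intro: tmeq_trans)
qed

lemma sound_Id:
  assumes A: "sound_ty \<Delta> A A'" and a: "sound_tm \<Delta> a a' A'" and b: "sound_tm \<Delta> b b' A'"
  shows "sound_ty \<Delta> (MId A a b) (MId A' a' b')"
proof -
  have eq: "TyEq \<Delta> A' A" using A by (auto simp: sound_ty_def intro: tyeq_sym)
  have "Tm \<Delta> a A" "Tm \<Delta> b A" "TmEq \<Delta> a a' A" "TmEq \<Delta> b b' A"
    using a b eq by (auto simp: sound_tm_def intro: tm_conv tmeq_conv)
  then show ?thesis
    using A a b by (auto simp: sound_ty_def sound_tm_def intro: Id_form Id_cong)
qed

lemma sound_Refl: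
  assumes a: "sound_tm \<Delta> a a' A"
  shows "sound_tm \<Delta> (MRefl a) (MRefl a') (MId A a' a')"
proof -
  have A: "Ty \<Delta> A" "Tm \<Delta> a A" "Tm \<Delta> a' A" "TmEq \<Delta> a a' A" using a by (auto simp: sound_tm_def)
  then have "TyEq \<Delta> (MId A a a) (MId A a' a')" by (auto intro: Id_cong tyeq_refl)
  moreover have "Tm \<Delta> (MRefl a) (MId A a a)" "TmEq \<Delta> (MRefl a) (MRefl a') (MId A a a)"
    using A by (auto intro: Refl Refl_cong)
  moreover have "Tm \<Delta> (MRefl a') (MId A a' a')" "Ty \<Delta> (MId A a' a')"
    using A by (auto intro: Refl Id_form)
  ultimately show ?thesis
    by (auto simp: shape_def intro!: sound_tmI intro: tm_conv tmeq_conv)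
qed

lemma interp_paths_from:
  "interp I F (Suc n) (MId (lift 1 0 A) (lift 1 0 a) (MVar 0)) = paths_from (interp I F n A) (interp I F n a)"
  by (simp add: interp_lift_1)

lemma Ty_subst2:
  assumes c: "Ctx \<Delta>" and C: "sound_ty (MId (lift 1 0 A) (lift 1 0 a) (MVar 0) # A # \<Delta>) C C'"
    and b: "Tm \<Delta> b A" and p: "Tm \<Delta> p (MId A a b)"
  shows "Ty \<Delta> (subst2 C' b p)"
proof -
  let ?i = "interp I F (length \<Delta>)"
  have "mor \<S> (ictx \<Delta>) (case_nat (?i p) (case_nat (?i b) Var)) (paths_from (?i A) (?i a) # ?i A # ictx \<Delta>)"
    using mor_inst2 [OF c b] p by simp
  then show ?thesis
    using ty_mor [OF _ c] C interp_paths_from [of "length \<Delta>" A a]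
    by (fastforce simp: interp_subst2 inst2_def sound_ty_def)
qed

lemma sound_J:
  assumes c: "Ctx \<Delta>" and a: "sound_tm \<Delta> a a' A"
    and C: "sound_ty (MId (lift 1 0 A) (lift 1 0 a') (MVar 0) # A # \<Delta>) C C'"
    and d: "sound_tm \<Delta> d d' D" and D: "sound_ty \<Delta> (subst2 C' a' (MRefl a')) D"
    and b: "sound_tm \<Delta> b b' A" and p: "sound_tm \<Delta> p p' (MId A a' b')"
    and T: "TyEq \<Delta> (subst2 C' b' p') T" "Ty \<Delta> T"
  shows "sound_tm \<Delta> (MJ a C d b p) (MJ a' C' d' b' p') T"
proof (rule sound_tmI)
  let ?i = "interp I F (length \<Delta>)" and ?C = "interp I F (Suc (Suc (length \<Delta>))) C"
    and ?C' = "interp I F (Suc (Suc (length \<Delta>))) C'"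
  have C1: "ty \<S> (paths_from (?i A) (?i a') # ?i A # ictx \<Delta>) ?C"
    "ty \<S> (paths_from (?i A) (?i a') # ?i A # ictx \<Delta>) ?C'"
    "tyeq \<S> (paths_from (?i A) (?i a') # ?i A # ictx \<Delta>) ?C ?C'"
    using C interp_paths_from [of "length \<Delta>" A a'] by (simp_all add: sound_ty_def)
  have a1: "ty \<S> (ictx \<Delta>) (?i A)" "Tm \<Delta> a A" "Tm \<Delta> a' A" "TmEq \<Delta> a a' A"
    and b1: "Tm \<Delta> b A" "Tm \<Delta> b' A" "TmEq \<Delta> b b' A"
    and d1: "Tm \<Delta> d D" "Tm \<Delta> d' D" "TmEq \<Delta> d d' D"
    using a b d by (simp_all add: sound_tm_def)
  have p1: "tm \<S> (ictx \<Delta>) (?i p) (Idt (?i A) (?i a') (?i b'))"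
    "tm \<S> (ictx \<Delta>) (?i p') (Idt (?i A) (?i a') (?i b'))"
    "tmeq \<S> (ictx \<Delta>) (?i p) (?i p') (Idt (?i A) (?i a') (?i b'))"
    using p by (simp_all add: sound_tm_def)
  have D1: "tyeq \<S> (ictx \<Delta>) (inst2 ?C' (?i a') (Refl (?i a'))) (?i D)"
    and T1: "tyeq \<S> (ictx \<Delta>) (inst2 ?C' (?i b') (?i p')) (?i T)"
    using D T by (simp_all add: sound_ty_def interp_subst2)
  note conv = J_conv [OF a1 C1 d1 D1 b1 p1 T1]
  show "Tm \<Delta> (MJ a C d b p) T" "Tm \<Delta> (MJ a' C' d' b' p') T"
    "TmEq \<Delta> (MJ a C d b p) (MJ a' C' d' b' p') T"
    using conv by simp_all
qed (use T in \<open>auto simp: shape_def\<close>)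

text \<open>By \<open>shape\<close>, a normal reflexivity at type \<open>MId A a' b'\<close> forces
  both endpoints to coincide syntactically, so the redex is literally the left side of
  \<open>J_beta\<close>.\<close>

lemma sound_J_beta:
  assumes c: "Ctx \<Delta>" and a: "sound_tm \<Delta> a a' A"
    and C: "sound_ty (MId (lift 1 0 A) (lift 1 0 a') (MVar 0) # A # \<Delta>) C C'"
    and d: "sound_tm \<Delta> d d' D" and D: "sound_ty \<Delta> (subst2 C' a' (MRefl a')) D"
    and b: "sound_tm \<Delta> b b' A" and p: "sound_tm \<Delta> p p' (MId A a' b')" and r: "is_refl p'"
  shows "sound_tm \<Delta> (MJ a C d b p) d' D"
proof -
  obtain x where "p' = MRefl x" using r by (auto simp: is_refl_def split: mexpr.splits)
  with p have p': "p' = MRefl a'" and b': "b' = a'" by (auto simp: sound_tm_def shape_def)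
  have D1: "TyEq \<Delta> (subst2 C' a' (MRefl a')) D" "Ty \<Delta> D" using D by (auto simp: sound_ty_def)
  have s: "sound_tm \<Delta> (MJ a C d b p) (MJ a' C' d' a' (MRefl a')) D"
    using sound_J [OF c a C d D b p, of D] D1 by (simp add: p' b')
  let ?i = "interp I F (length \<Delta>)" and ?C' = "interp I F (Suc (Suc (length \<Delta>))) C'"
  have "Tm \<Delta> d' (subst2 C' a' (MRefl a'))"
    using d D1 by (auto simp: sound_tm_def intro: tm_conv tyeq_sym)
  then have "tm \<S> (ictx \<Delta>) (?i d') (inst2 ?C' (?i a') (Refl (?i a')))"
    by (simp add: interp_subst2)
  moreover have "ty \<S> (paths_from (?i A) (?i a') # ?i A # ictx \<Delta>) ?C'"
    using C interp_paths_from [of "length \<Delta>" A a'] by (simp add: sound_ty_def)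
  ultimately have "TmEq \<Delta> (MJ a' C' d' a' (MRefl a')) d' (subst2 C' a' (MRefl a'))"
    using J_beta [of \<S> "ictx \<Delta>" "?i A" "?i a'"] a by (simp add: sound_tm_def interp_subst2)
  then have "TmEq \<Delta> (MJ a' C' d' a' (MRefl a')) d' D" using D1(1) by (rule tmeq_conv)
  then have "TmEq \<Delta> (MJ a C d b p) d' D"
    using s by (auto simp: sound_tm_def intro: tmeq_trans)
  then show ?thesis using s d by (auto simp: sound_tm_def)
qed

lemma dest_simps:
  "dest_pi T = Some (A, B) \<longleftrightarrow> T = MPi A B"
  "dest_sig T = Some (A, B) \<longleftrightarrow> T = MSig A B"
  "dest_lam t = Some b \<longleftrightarrow> (\<exists>A. t = MLam A b)"
  "dest_pair t = Some (a, b) \<longleftrightarrow> (\<exists>A B. t = MPair A B a b)"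
  "guard c = Some u \<longleftrightarrow> c"
  by (auto simp: dest_pi_def dest_sig_def dest_lam_def dest_pair_def guard_def split: mexpr.splits)

section \<open>Soundness of the whole procedure\<close>

lemma sound_step:
  assumes r: "sound r"
  shows "sound (step r)"
  unfolding sound_def
proof (intro allI impI)
  fix \<Delta> t t' K
  assume c: "Ctx \<Delta>" and s: "step r \<Delta> t = Some (t', K)"
  note tm = sound_tm_of [OF r] and ty = sound_ty_of [OF r] and it = sound_inst_ty [OF r c]
  note unf = bind_eq_Some_conv dest_simps
  have cons: "Ctx (A' # \<Delta>)" if "sound_ty \<Delta> A A'" for A A'
    using c that by (auto simp: sound_ty_def intro: ctx_cons)
  show "case K of None \<Rightarrow> sound_ty \<Delta> t t' | Some T \<Rightarrow> sound_tm \<Delta> t t' T"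
  proof (cases t)
    case (MVar i)
    with s c show ?thesis by (auto split: if_splits intro: sound_Var)
  next
    case (TV m)
    with s c show ?thesis by (auto intro: sound_TV)
  next
    case (FV m a)
    with s obtain a' where "tm_of r \<Delta> a = Some (a', TV 0)" "t' = FV m a'" "K = None"
      by (auto simp: unf)
    with FV c tm show ?thesis by (auto intro: sound_FV)
  next
    case (MPi A B)
    with s obtain A' B' where *: "ty_of r \<Delta> A = Some A'" "ty_of r (A' # \<Delta>) B = Some B'"
      and [simp]: "t' = MPi A' B'" "K = None"
      by (auto simp: unf)
    have A: "sound_ty \<Delta> A A'" using ty c * by blast
    with MPi show ?thesis using sound_binder(1) [OF c A ty [OF cons [OF A] *(2)]] by simp
  next
    case (MSig A B)
    with s obtain A' B' where *: "ty_of r \<Delta> A = Some A'" "ty_of r (A' # \<Delta>) B = Some B'"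
      and [simp]: "t' = MSig A' B'" "K = None"
      by (auto simp: unf)
    have A: "sound_ty \<Delta> A A'" using ty c * by blast
    with MSig show ?thesis using sound_binder(2) [OF c A ty [OF cons [OF A] *(2)]] by simp
  next
    case (MLam A b)
    with s obtain A' b' B where *: "ty_of r \<Delta> A = Some A'" "tm_of r (A' # \<Delta>) b = Some (b', B)"
      by (auto simp: unf)
    have A: "sound_ty \<Delta> A A'" using ty c * by blast
    have b: "sound_tm (A' # \<Delta>) b b' B" using tm cons [OF A] * by blast
    show ?thesis
    proof (cases "\<exists>f f'. lam_eta b' = Some f \<and> tm_of r \<Delta> f = Some (f', MPi A' B)")
      case True
      then obtain f f' where f: "lam_eta b' = Some f" "tm_of r \<Delta> f = Some (f', MPi A' B)" by blast
      with s * MLam have "t' = f'" "K = Some (MPi A' B)" by auto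
      with MLam show ?thesis using sound_Lam_eta [OF c A b f(1) tm [OF c f(2)]] by simp
    next
      case False
      with s * MLam have "t' = MLam A' b'" "K = Some (MPi A' B)"
        by (auto simp: unf split: option.splits if_splits)
      with MLam show ?thesis using sound_Lam [OF c A b] by simp
    qed
  next
    case (MApp f a)
    with s obtain f' A B a' B' where *: "tm_of r \<Delta> f = Some (f', MPi A B)"
        "tm_of r \<Delta> a = Some (a', A)" "inst_ty r \<Delta> B a' = Some B'"
      by (auto simp: unf)
    have f: "sound_tm \<Delta> f f' (MPi A B)" and a: "sound_tm \<Delta> a a' A" using tm c * by blast+
    have "Ty \<Delta> (subst 0 a' B)"
      using f a c ty_Pi_inv Ty_subst [of \<Delta> A B a'] by (auto simp: sound_tm_def)
    then have B': "sound_ty \<Delta> (subst 0 a' B) B'" using it * by blast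
    show ?thesis
    proof (cases "dest_lam f'")
      case None
      with s * MApp have "t' = MApp f' a'" "K = Some B'" by (auto simp: dest_pi_def guard_def)
      with MApp show ?thesis using sound_App [OF c f a B'] by simp
    next
      case (Some b)
      then obtain A' where f': "f' = MLam A' b" by (auto simp: dest_simps)
      from s * MApp Some have b: "tm_of r \<Delta> (subst 0 a' b) = Some (t', B')" and "K = Some B'"
        by (auto simp: unf dest_pi_def)
      with MApp show ?thesis using sound_beta [OF c f [unfolded f'] a B' tm [OF c b]] by simp
    qed
  next
    case (MPair A B a b)
    with s obtain A' B' a' b' C where *: "ty_of r \<Delta> A = Some A'" "ty_of r (A' # \<Delta>) B = Some B'"
        "tm_of r \<Delta> a = Some (a', A')" "tm_of r \<Delta> b = Some (b', C)"
        "inst_ty r \<Delta> B' a' = Some C"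
      by (auto simp: unf)
    have A: "sound_ty \<Delta> A A'" using ty c * by blast
    have B: "sound_ty (A' # \<Delta>) B B'" using ty cons [OF A] * by blast
    have a: "sound_tm \<Delta> a a' A'" and b: "sound_tm \<Delta> b b' C" using tm c * by blast+
    have "Ty \<Delta> (subst 0 a' B')"
      using B a c Ty_subst [of \<Delta> A' B' a'] by (auto simp: sound_tm_def sound_ty_def)
    then have C: "sound_ty \<Delta> (subst 0 a' B') C" using it * by blast
    show ?thesis
    proof (cases "\<exists>p p'. pair_eta a' b' = Some p \<and> tm_of r \<Delta> p = Some (p', MSig A' B')")
      case True
      then obtain p p' where p: "pair_eta a' b' = Some p" "tm_of r \<Delta> p = Some (p', MSig A' B')"
        by blast
      with s * MPair have "t' = p'" "K = Some (MSig A' B')" by (auto simp: guard_def)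
      with MPair show ?thesis using sound_Pair_eta [OF c A B a b C p(1) tm [OF c p(2)]] by simp
    next
      case False
      with s * MPair have "t' = MPair A' B' a' b'" "K = Some (MSig A' B')"
        by (auto simp: unf split: option.splits if_splits)
      with MPair show ?thesis using sound_Pair [OF c A B a b C] by simp
    qed
  next
    case (MFst p)
    with s obtain p' A B where *: "tm_of r \<Delta> p = Some (p', MSig A B)"
      by (auto simp: unf)
    have p: "sound_tm \<Delta> p p' (MSig A B)" using tm c * by blast
    show ?thesis
    proof (cases "dest_pair p'")
      case None
      with s * MFst have "t' = MFst p'" "K = Some A" by (auto simp: dest_sig_def)
      with MFst show ?thesis using sound_Fst [OF p] by simp
    next
      case (Some ab)
      then obtain a b A' B' where p': "p' = MPair A' B' a b" and ab: "ab = (a, b)"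
        by (cases ab) (auto simp: dest_simps)
      from s * MFst Some ab have a: "tm_of r \<Delta> a = Some (t', A)" and "K = Some A"
        by (auto simp: unf dest_sig_def)
      with MFst show ?thesis using sound_Fst_beta [OF p [unfolded p'] tm [OF c a]] by simp
    qed
  next
    case (MSnd p)
    with s obtain p' A B where *: "tm_of r \<Delta> p = Some (p', MSig A B)"
      by (auto simp: unf)
    have p: "sound_tm \<Delta> p p' (MSig A B)" using tm c * by blast
    show ?thesis
    proof (cases "dest_pair p'")
      case None
      with s * MSnd obtain B' where B': "inst_ty r \<Delta> B (MFst p') = Some B'"
          and "t' = MSnd p'" "K = Some B'"
        by (auto simp: dest_sig_def unf)
      have "Ty \<Delta> (subst 0 (MFst p') B)"
        using p sound_Fst [OF p] c ty_Sig_inv Ty_subst [of \<Delta> A B "MFst p'"]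
        by (auto simp: sound_tm_def)
      then have "sound_ty \<Delta> (subst 0 (MFst p') B) B'" using it B' by blast
      with MSnd \<open>t' = _\<close> \<open>K = _\<close> show ?thesis
        using sound_Snd [OF c p] by (simp add: sound_ty_def)
    next
      case (Some ab)
      then obtain a b A' C' where p': "p' = MPair A' C' a b" and ab: "ab = (a, b)"
        by (cases ab) (auto simp: dest_simps)
      from s * MSnd Some ab obtain B' where **: "inst_ty r \<Delta> B a = Some B'"
          "tm_of r \<Delta> b = Some (t', B')" and "K = Some B'"
        by (auto simp: unf dest_sig_def)
      have "Ty \<Delta> (subst 0 a B)"
        using p p' c ty_Sig_inv Ty_subst [of \<Delta> A B a] by (auto simp: sound_tm_def shape_def)
      then have "sound_ty \<Delta> (subst 0 a B) B'" using it ** by blast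
      from sound_Snd_beta [OF c p [unfolded p'] this tm [OF c **(2)]]
      show ?thesis using MSnd \<open>K = Some B'\<close> by simp
    qed
  next
    case (MId A a b)
    with s obtain A' a' b' where "ty_of r \<Delta> A = Some A'" "tm_of r \<Delta> a = Some (a', A')"
        "tm_of r \<Delta> b = Some (b', A')" "t' = MId A' a' b'" "K = None"
      by (auto simp: unf)
    with MId c tm ty show ?thesis by (auto intro: sound_Id)
  next
    case (MRefl a)
    with s obtain a' A where "tm_of r \<Delta> a = Some (a', A)" "t' = MRefl a'" "K = Some (MId A a' a')"
      by (auto simp: unf)
    with MRefl c tm show ?thesis by (auto intro: sound_Refl)
  next
    case (MJ a C d b p)
    with s obtain a' A C' d' D b' p' where *: "tm_of r \<Delta> a = Some (a', A)"
        "ty_of r (MId (lift 1 0 A) (lift 1 0 a') (MVar 0) # A # \<Delta>) C = Some C'"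
        "tm_of r \<Delta> d = Some (d', D)" "inst2_ty r \<Delta> C' a' (MRefl a') = Some D"
        "tm_of r \<Delta> b = Some (b', A)" "tm_of r \<Delta> p = Some (p', MId A a' b')"
      by (auto simp: unf)
    have a: "sound_tm \<Delta> a a' A" and d: "sound_tm \<Delta> d d' D" and b: "sound_tm \<Delta> b b' A"
      and p: "sound_tm \<Delta> p p' (MId A a' b')" using tm c * by blast+
    have "Ctx (MId (lift 1 0 A) (lift 1 0 a') (MVar 0) # A # \<Delta>)"
      using ctx_paths_from(3) [of \<S> "ictx \<Delta>"] a interp_paths_from [of "length \<Delta>" A a']
      by (simp add: sound_tm_def)
    then have C: "sound_ty (MId (lift 1 0 A) (lift 1 0 a') (MVar 0) # A # \<Delta>) C C'"
      using ty * by blast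
    have "Ty \<Delta> (subst2 C' a' (MRefl a'))"
      using Ty_subst2 [OF c C, of a' "MRefl a'"] a sound_Refl [OF a] by (simp add: sound_tm_def)
    then have D: "sound_ty \<Delta> (subst2 C' a' (MRefl a')) D" using sound_inst2_ty [OF r c] * by blast
    show ?thesis
    proof (cases "is_refl p'")
      case True
      with s * MJ have "t' = d'" "K = Some D" by (auto simp: guard_def)
      with MJ show ?thesis using sound_J_beta [OF c a C d D b p True] by simp
    next
      case False
      with s * MJ obtain T where T: "inst2_ty r \<Delta> C' b' p' = Some T"
          and "t' = MJ a' C' d' b' p'" "K = Some T"
        by (auto simp: guard_def unf)
      moreover have "Ty \<Delta> (subst2 C' b' p')"
        using Ty_subst2 [OF c C] b p by (auto simp: sound_tm_def)
      ultimately have "sound_ty \<Delta> (subst2 C' b' p') T" using sound_inst2_ty [OF r c] by blast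
      with MJ \<open>t' = _\<close> \<open>K = _\<close> show ?thesis
        using sound_J [OF c a C d D b p] by (simp add: sound_ty_def)
    qed
  qed
qed

lemma sound_nf: "sound (nf n)"
  by (induction n) (simp_all add: sound_step, simp add: sound_def)

end

text \<open>The fuel 50 bounds the depth of recursion. Too little fuel makes the check fail and
  never makes it succeed wrongly.\<close>

definition has_type :: "mexpr list \<Rightarrow> mexpr \<Rightarrow> mexpr \<Rightarrow> bool" where
  "has_type \<Delta> t T = (case tm_of (nf 50) \<Delta> t of
     Some (t', T') \<Rightarrow> ty_of (nf 50) \<Delta> T = Some T' | None \<Rightarrow> False)"

definition is_type :: "mexpr list \<Rightarrow> mexpr \<Rightarrow> bool" where
  "is_type \<Delta> T = (case ty_of (nf 50) \<Delta> T of Some T' \<Rightarrow> True | None \<Rightarrow> False)"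

context schema_model
begin

lemma is_type_sound: "\<lbrakk>Ctx \<Delta>; is_type \<Delta> T\<rbrakk> \<Longrightarrow> Ty \<Delta> T"
  using sound_ty_of [OF sound_nf]
  by (auto simp: is_type_def sound_ty_def split: option.splits)

lemma has_type_sound:
  assumes c: "Ctx \<Delta>" and h: "has_type \<Delta> t T"
  shows "Tm \<Delta> t T" "Ty \<Delta> T"
proof -
  obtain t' T' where "tm_of (nf 50) \<Delta> t = Some (t', T')" "ty_of (nf 50) \<Delta> T = Some T'"
    using h by (auto simp: has_type_def split: option.splits)
  then have "sound_tm \<Delta> t t' T'" "sound_ty \<Delta> T T'"
    using sound_tm_of [OF sound_nf c] sound_ty_of [OF sound_nf c] by blast+
  then show "Tm \<Delta> t T" "Ty \<Delta> T"
    by (auto simp: sound_tm_def sound_ty_def intro: tm_conv tyeq_sym)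
qed

end


section \<open>Derivable schemas\<close>

text \<open>The inhabitant may depend on the model. Hence principles assumed of \<open>\<S>\<close>,
  which provide inhabitants separately for each context and choice of types, have the same form as
  schemas proved by one explicit term.\<close>

definition derivable :: "('c \<rightharpoonup> 'c expr) \<Rightarrow> mexpr \<Rightarrow> bool" where
  "derivable \<S> T \<longleftrightarrow> (\<forall>\<Gamma> I F. schema_model \<S> \<Gamma> I F \<longrightarrow>
     ty \<S> \<Gamma> (interp I F 0 T) \<and> inhabited \<S> \<Gamma> (interp I F 0 T))"

lemma derivableD:
  assumes "derivable \<S> T" "schema_model \<S> \<Gamma> I F"
  obtains t where "tm \<S> \<Gamma> t (interp I F 0 T)" "ty \<S> \<Gamma> (interp I F 0 T)"
  using assms unfolding derivable_def inhabited_def by blast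

lemma derivable_checked:
  assumes "has_type [] t T"
  shows "derivable \<S> T"
  unfolding derivable_def
proof (intro allI impI)
  fix \<Gamma> I F assume "schema_model \<S> \<Gamma> I F"
  then interpret schema_model \<S> \<Gamma> I F .
  show "ty \<S> \<Gamma> (interp I F 0 T) \<and> inhabited \<S> \<Gamma> (interp I F 0 T)"
    using has_type_sound [OF _ assms] base_ctx by (auto simp: inhabited_def)
qed

lemma inst_wk1: "inst (wk 1 B) a = B"
  by (simp add: inst_def wk_1 sub_ren sub_Var)

lemma derivable_mp:
  assumes "derivable \<S> (MPi A (lift 1 0 B))" "derivable \<S> A"
  shows "derivable \<S> B"
  unfolding derivable_def
proof (intro allI impI)
  fix \<Gamma> I F assume m: "schema_model \<S> \<Gamma> I F"
  let ?A = "interp I F 0 A" and ?B = "interp I F 0 B"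
  obtain f where f: "tm \<S> \<Gamma> f (Pi ?A (wk 1 ?B))" and t: "ty \<S> \<Gamma> (Pi ?A (wk 1 ?B))"
    using derivableD [OF assms(1) m] by (auto simp: interp_lift_1)
  obtain a where a: "tm \<S> \<Gamma> a ?A"
    using derivableD [OF assms(2) m] by blast
  note inv = ty_Pi_inv [OF t]
  have "ty \<S> \<Gamma> (inst (wk 1 ?B) a)" "tm \<S> \<Gamma> (App f a) (inst (wk 1 ?B) a)"
    using inv a f ctx_of(2) [OF t] by (auto intro: ty_inst App)
  then show "ty \<S> \<Gamma> ?B \<and> inhabited \<S> \<Gamma> ?B"
    unfolding inst_wk1 inhabited_def by blast
qed

lemma derivable_subst:
  assumes "derivable \<S> (MPi A B)" "has_type [] a A"
  shows "derivable \<S> (subst 0 a B)"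
  unfolding derivable_def
proof (intro allI impI)
  fix \<Gamma> I F assume m: "schema_model \<S> \<Gamma> I F"
  then interpret schema_model \<S> \<Gamma> I F .
  let ?A = "interp I F 0 A" and ?B = "interp I F 1 B" and ?a = "interp I F 0 a"
  obtain f where f: "tm \<S> \<Gamma> f (Pi ?A ?B)" and t: "ty \<S> \<Gamma> (Pi ?A ?B)"
    using derivableD [OF assms(1) m] by auto
  have a: "tm \<S> \<Gamma> ?a ?A" using has_type_sound(1) [OF _ assms(2)] base_ctx by simp
  have "ty \<S> \<Gamma> (inst ?B ?a)" "tm \<S> \<Gamma> (App f ?a) (inst ?B ?a)"
    using ty_Pi_inv [OF t] a f base_ctx by (auto intro: ty_inst App)
  then show "ty \<S> \<Gamma> (interp I F 0 (subst 0 a B)) \<and> inhabited \<S> \<Gamma> (interp I F 0 (subst 0 a B))"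
    by (auto simp: interp_subst_0 inhabited_def)
qed

text \<open>Specialising a bound variable by substitution, as opposed to checking an application, does not
  normalise the resulting type.\<close>

definition specializes :: "mexpr \<Rightarrow> mexpr \<Rightarrow> mexpr \<Rightarrow> bool" where
  "specializes M a T \<longleftrightarrow> (case M of MPi A B \<Rightarrow> has_type [] a A \<and> T = subst 0 a B | _ \<Rightarrow> False)"

lemma derivable_specializes: "\<lbrakk>derivable \<S> M; specializes M a T\<rbrakk> \<Longrightarrow> derivable \<S> T"
  using derivable_subst by (auto simp: specializes_def split: mexpr.splits)

definition hyps :: "mexpr list \<Rightarrow> mexpr \<Rightarrow> mexpr" where
  "hyps Hs T = foldr (\<lambda>H T. MPi H (lift 1 0 T)) Hs T"

text \<open>Schemas known to be derivable need not have a schematic proof term. They therefore enter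
  a checked term as arguments, which are then discharged by \<open>derivable_mp\<close> in each
  model.\<close>

lemma derivable_from:
  assumes "has_type [] t (hyps Hs T)" "\<forall>H\<in>set Hs. derivable \<S> H"
  shows "derivable \<S> T"
proof -
  have "derivable \<S> (hyps Hs T)" using assms(1) by (rule derivable_checked)
  then show ?thesis using assms(2)
  proof (induction Hs)
    case (Cons H Hs)
    then show ?case using derivable_mp [of \<S> H "hyps Hs T"] by (simp add: hyps_def)
  qed (simp add: hyps_def)
qed

subsection \<open>Instantiation of schemas\<close>

text \<open>\<open>\<theta>\<close> replaces type metavariables and \<open>\<phi>\<close> family
  metavariables, below \<open>d\<close> local binders. A family has its parameter as variable 0, so
  it is lifted with cutoff 1 before the argument is substituted.\<close>

primrec minst :: "(nat \<Rightarrow> mexpr) \<Rightarrow> (nat \<Rightarrow> mexpr) \<Rightarrow> nat \<Rightarrow> mexpr \<Rightarrow> mexpr" where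
  "minst \<theta> \<phi> d (MVar i) = MVar i"
| "minst \<theta> \<phi> d (TV m) = lift d 0 (\<theta> m)"
| "minst \<theta> \<phi> d (FV m t) = subst 0 (minst \<theta> \<phi> d t) (lift d 1 (\<phi> m))"
| "minst \<theta> \<phi> d (MPi A B) = MPi (minst \<theta> \<phi> d A) (minst \<theta> \<phi> (Suc d) B)"
| "minst \<theta> \<phi> d (MLam A b) = MLam (minst \<theta> \<phi> d A) (minst \<theta> \<phi> (Suc d) b)"
| "minst \<theta> \<phi> d (MApp f a) = MApp (minst \<theta> \<phi> d f) (minst \<theta> \<phi> d a)"
| "minst \<theta> \<phi> d (MSig A B) = MSig (minst \<theta> \<phi> d A) (minst \<theta> \<phi> (Suc d) B)"
| "minst \<theta> \<phi> d (MPair A B a b) =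
     MPair (minst \<theta> \<phi> d A) (minst \<theta> \<phi> (Suc d) B) (minst \<theta> \<phi> d a) (minst \<theta> \<phi> d b)"
| "minst \<theta> \<phi> d (MFst p) = MFst (minst \<theta> \<phi> d p)"
| "minst \<theta> \<phi> d (MSnd p) = MSnd (minst \<theta> \<phi> d p)"
| "minst \<theta> \<phi> d (MId A a b) = MId (minst \<theta> \<phi> d A) (minst \<theta> \<phi> d a) (minst \<theta> \<phi> d b)"
| "minst \<theta> \<phi> d (MRefl a) = MRefl (minst \<theta> \<phi> d a)"
| "minst \<theta> \<phi> d (MJ a C e b p) =
     MJ (minst \<theta> \<phi> d a) (minst \<theta> \<phi> (Suc (Suc d)) C) (minst \<theta> \<phi> d e) (minst \<theta> \<phi> d b) (minst \<theta> \<phi> d p)"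

text \<open>Instantiating the metavariables of a schema amounts to interpreting the same schema in
  another model.\<close>

lemma interp_minst:
  "interp I F (k + d) (minst \<theta> \<phi> d t) =
     interp (\<lambda>m. interp I F k (\<theta> m)) (\<lambda>m. interp I F (Suc k) (\<phi> m)) d t"
proof (induction t arbitrary: d)
  case (TV m)
  then show ?case by (simp add: interp_lift_0)
next
  case (FV m t)
  have "interp I F (Suc (k + d)) (lift d 1 (\<phi> m)) = ren (lren d 1) (interp I F (Suc k) (\<phi> m))"
    using interp_lift [of 1 "Suc k" I F d "\<phi> m"] by simp
  moreover have "(\<lambda>i. case_nat s Var (lren d (Suc 0) i)) = case_nat s (\<lambda>i. Var (i + d))"
    for s :: "'a expr"
    by (auto simp: fun_eq_iff lren_def split: nat.split)
  ultimately show ?case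
    by (simp add: interp_subst_0 FV.IH inst_def sub_ren)
qed (simp_all flip: add_Suc_right)

text \<open>A model assigns something well formed to every metavariable. Those beyond the given
  lists receive the first type, or in \<open>fsub\<close> the constant family at it.\<close>

definition tsub :: "mexpr list \<Rightarrow> nat \<Rightarrow> mexpr" where
  "tsub Ts m = (if m < length Ts then Ts ! m else hd Ts)"

definition fsub :: "mexpr list \<Rightarrow> mexpr list \<Rightarrow> nat \<Rightarrow> mexpr" where
  "fsub Ts Fs m = (if m < length Fs then Fs ! m else lift 1 0 (hd Ts))"

definition instance_in :: "mexpr list \<Rightarrow> mexpr list \<Rightarrow> mexpr list \<Rightarrow> mexpr \<Rightarrow> mexpr \<Rightarrow> bool" where
  "instance_in \<Delta> Ts Fs T T' \<longleftrightarrow> Ts \<noteq> [] \<and> list_all (is_type \<Delta>) Ts \<and>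
     list_all (is_type (hd Ts # \<Delta>)) Fs \<and> T' = minst (tsub Ts) (fsub Ts Fs) 0 T"

text \<open>Derivability ranges over all base contexts, so \<open>ictx \<Delta>\<close> can itself
  serve as the base of the model in which the instance is read.\<close>

lemma (in schema_model) instance_sound:
  assumes T: "derivable \<S> T" and c: "Ctx \<Delta>" and i: "instance_in \<Delta> Ts Fs T T'"
  shows "Ty \<Delta> T'" "inhabited \<S> (ictx \<Delta>) (interp I F (length \<Delta>) T')"
proof -
  have Ts: "Ts \<noteq> []" "\<And>X. X \<in> set Ts \<Longrightarrow> Ty \<Delta> X"
    using i is_type_sound [OF c] by (auto simp: instance_in_def list_all_iff)
  then have t: "Ty \<Delta> (tsub Ts m)" for m
    by (simp add: tsub_def)
  have h: "hd Ts = tsub Ts 0" using Ts(1) by (cases Ts) (auto simp: tsub_def)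
  have c': "Ctx (tsub Ts 0 # \<Delta>)" using c t by (auto intro: ctx_cons)
  have "Ty (tsub Ts 0 # \<Delta>) X" if "X \<in> set Fs" for X
    using i is_type_sound [OF c'] that h by (auto simp: instance_in_def list_all_iff)
  moreover have "Ty (tsub Ts 0 # \<Delta>) (lift 1 0 (tsub Ts 0))"
    using ty_wk1 [OF t] c' by (simp add: interp_lift_1)
  ultimately have f: "Ty (tsub Ts 0 # \<Delta>) (fsub Ts Fs m)" for m
    using h by (simp add: fsub_def)
  have "schema_model \<S> (ictx \<Delta>) (\<lambda>m. interp I F (length \<Delta>) (tsub Ts m))
      (\<lambda>m. interp I F (Suc (length \<Delta>)) (fsub Ts Fs m))"
    using c t f by unfold_locales auto
  then show "Ty \<Delta> T'" "inhabited \<S> (ictx \<Delta>) (interp I F (length \<Delta>) T')"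
    using T i interp_minst [of I F "length \<Delta>" 0 "tsub Ts" "fsub Ts Fs" T]
    by (auto simp: derivable_def instance_in_def)
qed

lemma derivable_instance:
  assumes "derivable \<S> T" "instance_in [] Ts Fs T T'"
  shows "derivable \<S> T'"
  unfolding derivable_def
proof (intro allI impI)
  fix \<Gamma> I F assume "schema_model \<S> \<Gamma> I F"
  then interpret schema_model \<S> \<Gamma> I F .
  show "ty \<S> \<Gamma> (interp I F 0 T') \<and> inhabited \<S> \<Gamma> (interp I F 0 T')"
    using instance_sound [OF assms(1) _ assms(2)] base_ctx by simp
qed

text \<open>Instances whose types or families mention a term variable, such as a map
  \<open>f\<close>, are taken in a context with one variable of type \<open>D\<close>, which is
  abstracted afterwards.\<close>

definition instance_Pi :: "mexpr \<Rightarrow> mexpr list \<Rightarrow> mexpr list \<Rightarrow> mexpr \<Rightarrow> mexpr \<Rightarrow> bool" where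
  "instance_Pi D Ts Fs T M \<longleftrightarrow> is_type [] D \<and>
     (case M of MPi D' T' \<Rightarrow> D' = D \<and> instance_in [D] Ts Fs T T' | _ \<Rightarrow> False)"

lemma derivable_instance_Pi:
  assumes "derivable \<S> T" "instance_Pi D Ts Fs T M"
  shows "derivable \<S> M"
  unfolding derivable_def
proof (intro allI impI)
  obtain T' where M: "M = MPi D T'" and D: "is_type [] D" and T': "instance_in [D] Ts Fs T T'"
    using assms(2) by (auto simp: instance_Pi_def split: mexpr.splits)
  fix \<Gamma> I F assume "schema_model \<S> \<Gamma> I F"
  then interpret schema_model \<S> \<Gamma> I F .
  have tyD: "ty \<S> \<Gamma> (interp I F 0 D)" using is_type_sound [OF _ D] base_ctx by simp
  then have c: "Ctx [D]" using base_ctx by (auto intro: ctx_cons)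
  have "ty \<S> (interp I F 0 D # \<Gamma>) (interp I F 1 T')"
    "inhabited \<S> (interp I F 0 D # \<Gamma>) (interp I F 1 T')"
    using instance_sound [OF assms(1) c T'] by simp_all
  with tyD show "ty \<S> \<Gamma> (interp I F 0 M) \<and> inhabited \<S> \<Gamma> (interp I F 0 M)"
    by (auto simp: M inhabited_def intro: Pi_form Lam)
qed

section \<open>Higher-order notation for schematic terms\<close>

text \<open>A schematic term is given as a function of the number of binders above it, so that a bound
  variable is represented by its level and can be used below any further binders.\<close>

type_synonym sch = "nat \<Rightarrow> mexpr"

definition svar :: "nat \<Rightarrow> sch" where "svar n = (\<lambda>m. MVar (m - Suc n))"
definition styp :: "nat \<Rightarrow> sch" where "styp m = (\<lambda>n. TV m)"
definition sfam :: "nat \<Rightarrow> sch \<Rightarrow> sch" where "sfam m a = (\<lambda>n. FV m (a n))"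
definition spi :: "sch \<Rightarrow> (sch \<Rightarrow> sch) \<Rightarrow> sch" where
  "spi A B = (\<lambda>n. MPi (A n) (B (svar n) (Suc n)))"
definition slam :: "sch \<Rightarrow> (sch \<Rightarrow> sch) \<Rightarrow> sch" where
  "slam A b = (\<lambda>n. MLam (A n) (b (svar n) (Suc n)))"
definition sapp :: "sch \<Rightarrow> sch \<Rightarrow> sch" (infixl \<open>\<cdot>\<close> 90) where
  "f \<cdot> a = (\<lambda>n. MApp (f n) (a n))"
definition ssig :: "sch \<Rightarrow> (sch \<Rightarrow> sch) \<Rightarrow> sch" where
  "ssig A B = (\<lambda>n. MSig (A n) (B (svar n) (Suc n)))"
definition spair :: "sch \<Rightarrow> (sch \<Rightarrow> sch) \<Rightarrow> sch \<Rightarrow> sch \<Rightarrow> sch" where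
  "spair A B a b = (\<lambda>n. MPair (A n) (B (svar n) (Suc n)) (a n) (b n))"
definition sfst :: "sch \<Rightarrow> sch" where "sfst p = (\<lambda>n. MFst (p n))"
definition ssnd :: "sch \<Rightarrow> sch" where "ssnd p = (\<lambda>n. MSnd (p n))"
definition sid :: "sch \<Rightarrow> sch \<Rightarrow> sch \<Rightarrow> sch" where "sid A a b = (\<lambda>n. MId (A n) (a n) (b n))"
definition srefl :: "sch \<Rightarrow> sch" where "srefl a = (\<lambda>n. MRefl (a n))"
definition sJ :: "sch \<Rightarrow> (sch \<Rightarrow> sch \<Rightarrow> sch) \<Rightarrow> sch \<Rightarrow> sch \<Rightarrow> sch \<Rightarrow> sch" where
  "sJ a C d b p = (\<lambda>n. MJ (a n) (C (svar n) (svar (Suc n)) (Suc (Suc n))) (d n) (b n) (p n))"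

syntax
  "_spi" :: "pttrn \<Rightarrow> sch \<Rightarrow> sch \<Rightarrow> sch" (\<open>(3\<Pi> _:_./ _)\<close> [0, 0, 60] 60)
  "_slam" :: "pttrn \<Rightarrow> sch \<Rightarrow> sch \<Rightarrow> sch" (\<open>(3\<Lambda> _:_./ _)\<close> [0, 0, 60] 60)
  "_ssig" :: "pttrn \<Rightarrow> sch \<Rightarrow> sch \<Rightarrow> sch" (\<open>(3\<Sigma> _:_./ _)\<close> [0, 0, 60] 60)
translations
  "\<Pi> x:A. B" == "CONST spi A (\<lambda>x. B)"
  "\<Lambda> x:A. B" == "CONST slam A (\<lambda>x. B)"
  "\<Sigma> x:A. B" == "CONST ssig A (\<lambda>x. B)"

definition sarr :: "sch \<Rightarrow> sch \<Rightarrow> sch" (infixr \<open>\<rightharpoondown>\<close> 70) where "A \<rightharpoondown> B = (\<Pi> _:A. B)"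
definition sidm :: "sch \<Rightarrow> sch" where "sidm A = (\<Lambda> x:A. x)"
definition scmp :: "sch \<Rightarrow> sch \<Rightarrow> sch \<Rightarrow> sch" where "scmp A g f = (\<Lambda> x:A. g \<cdot> (f \<cdot> x))"
definition shtpy :: "sch \<Rightarrow> (sch \<Rightarrow> sch) \<Rightarrow> sch \<Rightarrow> sch \<Rightarrow> sch" where
  "shtpy A B f g = (\<Pi> x:A. sid (B x) (f \<cdot> x) (g \<cdot> x))"
definition shapply :: "sch \<Rightarrow> (sch \<Rightarrow> sch) \<Rightarrow> sch \<Rightarrow> sch \<Rightarrow> sch" where
  "shapply A B f g = (\<Lambda> p:sid (spi A B) f g.
     sJ f (\<lambda>k _. shtpy A B f k) (\<Lambda> x:A. srefl (f \<cdot> x)) g p)"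

definition scsec :: "sch \<Rightarrow> sch \<Rightarrow> sch \<Rightarrow> sch \<Rightarrow> sch" where
  "scsec A B f s = sid (B \<rightharpoondown> B) (scmp B f s) (sidm B)"
definition scret :: "sch \<Rightarrow> sch \<Rightarrow> sch \<Rightarrow> sch \<Rightarrow> sch" where
  "scret A B f r = sid (A \<rightharpoondown> A) (scmp A r f) (sidm A)"
definition sisCEq :: "sch \<Rightarrow> sch \<Rightarrow> sch \<Rightarrow> sch" where
  "sisCEq A B f = (\<Sigma> s:B \<rightharpoondown> A. \<Sigma> _:scsec A B f s. \<Sigma> r:B \<rightharpoondown> A. scret A B f r)"
definition ssec :: "sch \<Rightarrow> sch \<Rightarrow> sch \<Rightarrow> sch \<Rightarrow> sch" where
  "ssec A B f s = shtpy B (\<lambda>_. B) (scmp B f s) (sidm B)"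
definition sret :: "sch \<Rightarrow> sch \<Rightarrow> sch \<Rightarrow> sch \<Rightarrow> sch" where
  "sret A B f r = shtpy A (\<lambda>_. A) (scmp A r f) (sidm A)"
definition sisEquiv :: "sch \<Rightarrow> sch \<Rightarrow> sch \<Rightarrow> sch" where
  "sisEquiv A B f = (\<Sigma> s:B \<rightharpoondown> A. \<Sigma> _:ssec A B f s. \<Sigma> r:B \<rightharpoondown> A. sret A B f r)"
definition smkEquiv :: "sch \<Rightarrow> sch \<Rightarrow> sch \<Rightarrow> sch \<Rightarrow> sch \<Rightarrow> sch \<Rightarrow> sch \<Rightarrow> sch" where
  "smkEquiv A B f s S r R =
    spair (B \<rightharpoondown> A) (\<lambda>s. \<Sigma> _:ssec A B f s. \<Sigma> r:B \<rightharpoondown> A. sret A B f r) s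
   (spair (ssec A B f s) (\<lambda>_. \<Sigma> r:B \<rightharpoondown> A. sret A B f r) S
   (spair (B \<rightharpoondown> A) (sret A B f) r R))"

text \<open>\<open>f\<close> is a function of the metalanguage, so any expression with a hole can be
  applied to a path.\<close>

definition sap :: "sch \<Rightarrow> (sch \<Rightarrow> sch) \<Rightarrow> sch \<Rightarrow> sch \<Rightarrow> sch \<Rightarrow> sch" where
  "sap B f a b p = sJ a (\<lambda>y _. sid B (f a) (f y)) (srefl (f a)) b p"
definition ssym :: "sch \<Rightarrow> sch \<Rightarrow> sch \<Rightarrow> sch \<Rightarrow> sch" where
  "ssym A a b p = sJ a (\<lambda>y _. sid A y a) (srefl a) b p"
text \<open>Induction is on the second path, so composition with reflexivity on the right is
  strictly the first path.\<close>

definition strans :: "sch \<Rightarrow> sch \<Rightarrow> sch \<Rightarrow> sch \<Rightarrow> sch \<Rightarrow> sch \<Rightarrow> sch" where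
  "strans A a b c p q = sJ b (\<lambda>y _. sid A a y) p c q"
definition sisContr :: "sch \<Rightarrow> sch" where "sisContr A = (\<Sigma> x:A. \<Pi> y:A. sid A x y)"
definition sisProp :: "sch \<Rightarrow> sch" where "sisProp A = (\<Pi> x:A. \<Pi> y:A. sid A x y)"


text \<open>The components of a right-nested quadruple such as a proof of \<open>sisEquiv\<close>:
  section, its law, retraction, its law.\<close>

definition c1 :: "sch \<Rightarrow> sch" where "c1 w = sfst w"
definition c2 :: "sch \<Rightarrow> sch" where "c2 w = sfst (ssnd w)"
definition c3 :: "sch \<Rightarrow> sch" where "c3 w = sfst (ssnd (ssnd w))"
definition c4 :: "sch \<Rightarrow> sch" where "c4 w = ssnd (ssnd (ssnd w))"

definition shasSection :: "sch \<Rightarrow> sch \<Rightarrow> sch \<Rightarrow> sch" where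
  "shasSection A B f = (\<Sigma> s:B \<rightharpoondown> A. ssec A B f s)"
definition shasRetraction :: "sch \<Rightarrow> sch \<Rightarrow> sch \<Rightarrow> sch" where
  "shasRetraction A B f = (\<Sigma> r:B \<rightharpoondown> A. sret A B f r)"
definition sEqv :: "sch \<Rightarrow> sch \<Rightarrow> sch" where "sEqv A B = (\<Sigma> f:A \<rightharpoondown> B. sisEquiv A B f)"
definition sCEq :: "sch \<Rightarrow> sch \<Rightarrow> sch" where "sCEq A B = (\<Sigma> f:A \<rightharpoondown> B. sisCEq A B f)"

definition isCEq_to_isEquiv :: "sch \<Rightarrow> sch \<Rightarrow> sch \<Rightarrow> sch \<Rightarrow> sch" where
  "isCEq_to_isEquiv A B f c = smkEquiv A B f (c1 c)
     (shapply B (\<lambda>_. B) (scmp B f (c1 c)) (sidm B) \<cdot> c2 c) (c3 c)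
     (shapply A (\<lambda>_. A) (scmp A (c3 c) f) (sidm A) \<cdot> c4 c)"
definition sCEqToEq :: "sch \<Rightarrow> sch \<Rightarrow> sch" where
  "sCEqToEq A B = (\<Lambda> w:sCEq A B.
     spair (A \<rightharpoondown> B) (sisEquiv A B) (sfst w) (isCEq_to_isEquiv A B (sfst w) (ssnd w)))"
definition spostcomp :: "sch \<Rightarrow> sch \<Rightarrow> sch \<Rightarrow> sch" where
  "spostcomp X A f = (\<Lambda> k:X \<rightharpoondown> A. scmp X f k)"

definition htpy_id_schema :: "sch \<Rightarrow> sch" where
  "htpy_id_schema A = (\<Pi> f:A \<rightharpoondown> A. shtpy A (\<lambda>_. A) f (sidm A) \<rightharpoondown> sid (A \<rightharpoondown> A) f (sidm A))"
definition isEquiv_isProp_schema :: "sch \<Rightarrow> sch \<Rightarrow> sch" where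
  "isEquiv_isProp_schema A B = (\<Pi> f:A \<rightharpoondown> B. sisProp (sisEquiv A B f))"
definition isCEq_schema :: "sch \<Rightarrow> sch \<Rightarrow> sch" where
  "isCEq_schema A B = (\<Pi> f:A \<rightharpoondown> B. sisEquiv A B f \<rightharpoondown> sisCEq A B f)"
definition postcomp_schema :: "sch \<Rightarrow> sch \<Rightarrow> sch \<Rightarrow> sch" where
  "postcomp_schema A B X = (\<Pi> f:A \<rightharpoondown> B. sisEquiv A B f \<rightharpoondown>
     sisEquiv (X \<rightharpoondown> A) (X \<rightharpoondown> B) (spostcomp X A f))"
definition weak_funext_schema :: "sch \<Rightarrow> (sch \<Rightarrow> sch) \<Rightarrow> sch" where
  "weak_funext_schema A P = ((\<Pi> a:A. sisContr (P a)) \<rightharpoondown> sisContr (spi A P))"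
definition funext_schema :: "sch \<Rightarrow> (sch \<Rightarrow> sch) \<Rightarrow> sch" where
  "funext_schema A P = (\<Pi> f:spi A P. \<Pi> g:spi A P.
     sisEquiv (sid (spi A P) f g) (shtpy A P f g) (shapply A P f g))"

abbreviation tA :: sch where "tA \<equiv> styp 0"
abbreviation tB :: sch where "tB \<equiv> styp 1"
abbreviation tX :: sch where "tX \<equiv> styp 2"
abbreviation tP :: "sch \<Rightarrow> sch" where "tP \<equiv> sfam 0"

section \<open>The implications\<close>

definition equiv_section_schema :: "sch \<Rightarrow> sch \<Rightarrow> sch" where
  "equiv_section_schema A B = (\<Pi> k:A \<rightharpoondown> B. sisEquiv A B k \<rightharpoondown> shasSection A B k)"

lemma derivable_equiv_section: "derivable \<S> (equiv_section_schema tA tB 0)"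
  by (rule derivable_checked [where t = "(\<Lambda> k:tA \<rightharpoondown> tB. \<Lambda> e:sisEquiv tA tB k.
    spair (tB \<rightharpoondown> tA) (ssec tA tB k) (c1 e) (c2 e)) 0"]) code_simp

lemma CEqToEq_section_if_equiv:
  assumes "derivable \<S> (sisEquiv (sCEq tA tB) (sEqv tA tB) (sCEqToEq tA tB) 0)"
  shows "derivable \<S> (shasSection (sCEq tA tB) (sEqv tA tB) (sCEqToEq tA tB) 0)"
proof -
  have "derivable \<S> (equiv_section_schema (sCEq tA tB) (sEqv tA tB) 0)"
    by (rule derivable_instance [OF derivable_equiv_section,
        where Ts = "[sCEq tA tB 0, sEqv tA tB 0]" and Fs = "[]"]) code_simp
  \<comment> \<open>The schema was proved for a variable \<open>k\<close>. Substituting the large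
    map \<open>CEqToEq\<close> for it avoids normalising the resulting type.\<close>
  then have "derivable \<S> (MPi (sisEquiv (sCEq tA tB) (sEqv tA tB) (sCEqToEq tA tB) 0)
      (lift 1 0 (shasSection (sCEq tA tB) (sEqv tA tB) (sCEqToEq tA tB) 0)))"
    by (rule derivable_specializes [where a = "sCEqToEq tA tB 0"]) code_simp
  then show ?thesis using assms by (rule derivable_mp)
qed

definition section_isCEq_schema :: "sch \<Rightarrow> sch \<Rightarrow> sch" where
  "section_isCEq_schema A B = (\<Pi> k:sCEq A B \<rightharpoondown> sEqv A B.
     (\<Pi> v:sCEq A B. sid (A \<rightharpoondown> B) (sfst (k \<cdot> v)) (sfst v)) \<rightharpoondown>
     shasSection (sCEq A B) (sEqv A B) k \<rightharpoondown> isCEq_schema A B)"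

text \<open>The section at \<open>(f, e)\<close> yields a categorical equivalence \<open>v\<close>
  with \<open>k \<cdot> v\<close> equal to \<open>(f, e)\<close>. Since \<open>k\<close> preserves
  underlying maps, that of \<open>v\<close> equals \<open>f\<close>, and its inverse data is
  transported along this path. For \<open>CEqToEq\<close> the preservation holds by
  reflexivity.\<close>

lemma derivable_section_isCEq: "derivable \<S> (section_isCEq_schema tA tB 0)"
  by (rule derivable_checked [where t = "(\<Lambda> k:sCEq tA tB \<rightharpoondown> sEqv tA tB.
    \<Lambda> n:(\<Pi> v:sCEq tA tB. sid (tA \<rightharpoondown> tB) (sfst (k \<cdot> v)) (sfst v)).
    \<Lambda> h:shasSection (sCEq tA tB) (sEqv tA tB) k. \<Lambda> f:tA \<rightharpoondown> tB. \<Lambda> e:sisEquiv tA tB f.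
    (let w = spair (tA \<rightharpoondown> tB) (sisEquiv tA tB) f e; v = sfst h \<cdot> w; T = tA \<rightharpoondown> tB in
     sJ (sfst v) (\<lambda>y _. sisCEq tA tB y) (ssnd v) f
       (strans T (sfst v) (sfst (k \<cdot> v)) f (ssym T (sfst (k \<cdot> v)) (sfst v) (n \<cdot> v))
         (sap T sfst (k \<cdot> v) w (ssnd h \<cdot> w))))) 0"]) code_simp

lemma isCEq_if_CEqToEq_section:
  assumes "derivable \<S> (shasSection (sCEq tA tB) (sEqv tA tB) (sCEqToEq tA tB) 0)"
  shows "derivable \<S> (isCEq_schema tA tB 0)"
proof -
  let ?N = "(\<Pi> v:sCEq tA tB. sid (tA \<rightharpoondown> tB) (sfst (sCEqToEq tA tB \<cdot> v)) (sfst v)) 0"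
  have "derivable \<S> (MPi ?N (lift 1 0
      (MPi (shasSection (sCEq tA tB) (sEqv tA tB) (sCEqToEq tA tB) 0) (lift 1 0 (isCEq_schema tA tB 0)))))"
    by (rule derivable_specializes [OF derivable_section_isCEq, where a = "sCEqToEq tA tB 0"]) code_simp
  moreover have "derivable \<S> ?N"
    by (rule derivable_checked [where t = "(\<Lambda> v:sCEq tA tB. srefl (sfst v)) 0"]) code_simp
  ultimately show ?thesis using assms by (blast intro: derivable_mp)
qed

text \<open>Whiskering the path from \<open>f \<circ> s\<close> to the identity with
  \<open>k\<close> gives a path from \<open>f \<circ> (s \<circ> k)\<close> to \<open>k\<close>, by
  the strict beta- and eta-rules; similarly for \<open>r\<close>. A mere homotopy would not suffice
  for this step.\<close>

lemma postcomp_if_isCEq: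
  assumes "derivable \<S> (isCEq_schema tA tB 0)"
  shows "derivable \<S> (postcomp_schema tA tB tX 0)"
  by (rule derivable_from [where Hs = "[isCEq_schema tA tB 0]" and t =
    "(\<Lambda> h:isCEq_schema tA tB. \<Lambda> f:tA \<rightharpoondown> tB. \<Lambda> e:sisEquiv tA tB f.
      (let c = h \<cdot> f \<cdot> e; s = c1 c; r = c3 c in
       smkEquiv (tX \<rightharpoondown> tA) (tX \<rightharpoondown> tB) (spostcomp tX tA f)
        (spostcomp tX tB s)
        (\<Lambda> k:tX \<rightharpoondown> tB. sap (tX \<rightharpoondown> tB) (\<lambda>u. scmp tX u k) (scmp tB f s) (sidm tB) (c2 c))
        (spostcomp tX tB r)
        (\<Lambda> k:tX \<rightharpoondown> tA. sap (tX \<rightharpoondown> tA) (\<lambda>u. scmp tX u k) (scmp tA r f) (sidm tA) (c4 c)))) 0"],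
    code_simp, use assms in simp)

text \<open>\<open>e\<close> and \<open>e'\<close> both prove that the identity is an equivalence,
  with sections \<open>f\<close> and \<open>i\<close>. The first projection of a path between them
  is the required path.\<close>

lemma htpy_id_if_isEquiv_isProp:
  assumes "derivable \<S> (isEquiv_isProp_schema tA tB 0)"
  shows "derivable \<S> (htpy_id_schema tA 0)"
proof -
  have 1: "derivable \<S> (isEquiv_isProp_schema tA tA 0)"
    by (rule derivable_instance [OF assms, where Ts = "[tA 0, tA 0]" and Fs = "[]"]) code_simp
  show ?thesis
    by (rule derivable_from [where Hs = "[isEquiv_isProp_schema tA tA 0]" and t =
      "(\<Lambda> h:isEquiv_isProp_schema tA tA. \<Lambda> f:tA \<rightharpoondown> tA. \<Lambda> H:shtpy tA (\<lambda>_. tA) f (sidm tA).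
        (let i = sidm tA; p = (\<Lambda> x:tA. srefl x);
             e = smkEquiv tA tA i f H i p; e' = smkEquiv tA tA i i p i p in
         sap (tA \<rightharpoondown> tA) sfst e e' (h \<cdot> i \<cdot> e \<cdot> e'))) 0"], code_simp, use 1 in simp)
qed

subsection \<open>Post-composition and the path space\<close>

definition injective_schema :: "sch \<Rightarrow> sch \<Rightarrow> sch \<Rightarrow> sch" where
  "injective_schema W A p = (\<Pi> u:W \<rightharpoondown> W. \<Pi> v:W \<rightharpoondown> W.
     sid (W \<rightharpoondown> A) (scmp W p u) (scmp W p v) \<rightharpoondown> sid (W \<rightharpoondown> W) u v)"

definition postcomp_injective_schema :: "sch \<Rightarrow> sch \<Rightarrow> sch" where
  "postcomp_injective_schema W A = (postcomp_schema W A W \<rightharpoondown>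
     (\<Pi> p:W \<rightharpoondown> A. sisEquiv W A p \<rightharpoondown> injective_schema W A p))"

text \<open>The retraction of post-composition with \<open>p\<close> recovers \<open>u\<close> from
  \<open>p \<circ> u\<close> and \<open>v\<close> from \<open>p \<circ> v\<close>.\<close>

lemma derivable_postcomp_injective: "derivable \<S> (postcomp_injective_schema tA tB 0)"
  by (rule derivable_checked [where t =
    "(\<Lambda> h:postcomp_schema tA tB tA. \<Lambda> p:tA \<rightharpoondown> tB. \<Lambda> e:sisEquiv tA tB p.
      \<Lambda> u:tA \<rightharpoondown> tA. \<Lambda> v:tA \<rightharpoondown> tA. \<Lambda> q:sid (tA \<rightharpoondown> tB) (scmp tA p u) (scmp tA p v).
      (let E = h \<cdot> p \<cdot> e; r = (\<lambda>x. c3 E \<cdot> x); pu = scmp tA p u; pv = scmp tA p v; T = tA \<rightharpoondown> tA in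
       strans T u (r pv) v
         (strans T u (r pu) (r pv) (ssym T (r pu) u (c4 E \<cdot> u)) (sap T r pu pv q)) (c4 E \<cdot> v))) 0"]) code_simp

definition spaths :: "sch \<Rightarrow> sch" where "spaths A = (\<Sigma> x:A. \<Sigma> y:A. sid A x y)"
definition smkpath :: "sch \<Rightarrow> sch \<Rightarrow> sch \<Rightarrow> sch \<Rightarrow> sch" where
  "smkpath A x y q = spair A (\<lambda>x. \<Sigma> y:A. sid A x y) x (spair A (sid A x) y q)"
definition ssource :: "sch \<Rightarrow> sch" where "ssource A = (\<Lambda> p:spaths A. sfst p)"

text \<open>Constant paths give both inverses. One law is strict; the other is based path
  induction.\<close>

lemma derivable_source_equiv: "derivable \<S> (sisEquiv (spaths tA) tA (ssource tA) 0)"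
  by (rule derivable_checked [where t =
    "(let d = (\<lambda>x. smkpath tA x x (srefl x)) in
      smkEquiv (spaths tA) tA (ssource tA) (slam tA d) (\<Lambda> x:tA. srefl x) (slam tA d)
       (\<Lambda> p:spaths tA. sJ (sfst p)
         (\<lambda>y q. sid (spaths tA) (d (sfst p)) (smkpath tA (sfst p) y q))
         (srefl (d (sfst p))) (sfst (ssnd p)) (ssnd (ssnd p)))) 0"]) code_simp

lemma htpy_id_if_postcomp:
  assumes "derivable \<S> (postcomp_schema tA tB tX 0)"
  shows "derivable \<S> (htpy_id_schema tA 0)"
proof -
  have 1: "derivable \<S> (postcomp_schema (spaths tA) tA (spaths tA) 0)"
    by (rule derivable_instance [OF assms,
        where Ts = "[spaths tA 0, tA 0, spaths tA 0]" and Fs = "[]"]) code_simp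
  have 2: "derivable \<S> (postcomp_injective_schema (spaths tA) tA 0)"
    by (rule derivable_instance [OF derivable_postcomp_injective,
        where Ts = "[spaths tA 0, tA 0]" and Fs = "[]"]) code_simp
  have 3: "derivable \<S> (injective_schema (spaths tA) tA (ssource tA) 0)"
    by (rule derivable_from [where Hs = "[postcomp_schema (spaths tA) tA (spaths tA) 0,
          postcomp_injective_schema (spaths tA) tA 0, sisEquiv (spaths tA) tA (ssource tA) 0]" and t =
      "(\<Lambda> h:postcomp_schema (spaths tA) tA (spaths tA). \<Lambda> l:postcomp_injective_schema (spaths tA) tA.
        \<Lambda> e:sisEquiv (spaths tA) tA (ssource tA). l \<cdot> h \<cdot> ssource tA \<cdot> e) 0"],
      code_simp, use 1 2 derivable_source_equiv in simp)
  show ?thesis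
    \<comment> \<open>\<open>d\<close> preserves sources strictly, so reflexivity is the hypothesis
      of injectivity. The target of \<open>(f a, a, H a)\<close> is \<open>f a\<close> after
      \<open>d\<close> and \<open>a\<close> after the identity.\<close>
    by (rule derivable_from [where Hs = "[injective_schema (spaths tA) tA (ssource tA) 0]" and t =
      "(\<Lambda> h:injective_schema (spaths tA) tA (ssource tA).
        \<Lambda> f:tA \<rightharpoondown> tA. \<Lambda> H:shtpy tA (\<lambda>_. tA) f (sidm tA).
        (let d = (\<Lambda> p:spaths tA. smkpath tA (sfst p) (sfst p) (srefl (sfst p))) in
         sap (tA \<rightharpoondown> tA) (\<lambda>k. \<Lambda> a:tA. sfst (ssnd (k \<cdot> smkpath tA (f \<cdot> a) a (H \<cdot> a)))) d (sidm (spaths tA))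
           (h \<cdot> d \<cdot> sidm (spaths tA) \<cdot> srefl (ssource tA)))) 0"],
      code_simp, use 3 in simp)
qed

subsection \<open>Weak function extensionality\<close>

lemma weak_funext_if_htpy_id:
  assumes "derivable \<S> (htpy_id_schema tA 0)"
  shows "derivable \<S> (weak_funext_schema tA tP 0)"
proof -
  have 1: "derivable \<S> (htpy_id_schema (ssig tA tP) 0)"
    by (rule derivable_instance [OF assms, where Ts = "[ssig tA tP 0]" and Fs = "[]"]) code_simp
  show ?thesis
    \<comment> \<open>\<open>e\<close> replaces the second component of a pair by the centre of its
      fibre, and \<open>\<alpha>\<close> is a path from \<open>e\<close> to the identity. The lifts
      of \<open>s\<close> through the identity form a based path space, hence a proposition;
      transport gives the same for lifts through \<open>e\<close>. \<open>n\<close> turns a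
      dependent function into such a lift, with \<open>e \<circ> m\<close> strictly equal to
      \<open>s\<close>. \<open>G\<close> goes back by transporting second components along
      \<open>s = e \<circ> m\<close>; \<open>G (n g)\<close> is strictly \<open>g\<close>, and
      \<open>G\<close> of the lift \<open>s\<close> is the family of centres.\<close>
    by (rule derivable_from [where Hs = "[htpy_id_schema (ssig tA tP) 0]" and t =
      "(\<Lambda> h:htpy_id_schema (ssig tA tP). \<Lambda> c:(\<Pi> a:tA. sisContr (tP a)).
        (let W = ssig tA tP; V = tA \<rightharpoondown> W; pr = spair tA tP; cen = (\<lambda>a. sfst (c \<cdot> a));
             s = (\<Lambda> a:tA. pr a (cen a)); e = (\<Lambda> w:W. pr (sfst w) (cen (sfst w)));
             \<alpha> = h \<cdot> e \<cdot> (\<Lambda> w:W. sap W (pr (sfst w)) (cen (sfst w)) (ssnd w)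
                                   (ssnd (c \<cdot> sfst w) \<cdot> ssnd w));
             lifts = (\<lambda>k m. sid V s (scmp tA k m)); mk = (\<lambda>k. spair V (lifts k));
             i = sidm W; L = ssig V (lifts i); z = mk i s (srefl s);
             K = (\<lambda>w. sJ s (\<lambda>m q. sid L z (mk i m q)) (srefl z) (sfst w) (ssnd w));
             prop_i = (\<Lambda> u:L. \<Lambda> v:L. strans L u z v (ssym L z u (K u)) (K v));
             prop_e = sJ i (\<lambda>k _. sisProp (ssig V (lifts k))) prop_i e (ssym (W \<rightharpoondown> W) e i \<alpha>);
             G = (\<lambda>w. \<Lambda> a:tA. sJ s (\<lambda>y _. tP (sfst (y \<cdot> a)) \<rightharpoondown> tP a) (\<Lambda> u:tP a. u)
                    (scmp tA e (sfst w)) (ssnd w) \<cdot> ssnd (sfst w \<cdot> a));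
             T = spi tA tP; m = mk e s (srefl s);
             n = (\<lambda>g. mk e (\<Lambda> a:tA. pr a (g \<cdot> a)) (srefl s)) in
         spair T (\<lambda>x. \<Pi> y:T. sid T x y) (slam tA cen)
           (\<Lambda> g:T. sap T G m (n g) (prop_e \<cdot> m \<cdot> n g)))) 0"],
      code_simp, use 1 in simp)
qed

subsection \<open>Function extensionality\<close>

definition trans_sym_schema :: "sch \<Rightarrow> sch" where
  "trans_sym_schema X = (\<Pi> a:X. \<Pi> b:X. \<Pi> p:sid X a b.
     sid (sid X b b) (strans X b a b (ssym X a b p) p) (srefl b))"

lemma derivable_trans_sym: "derivable \<S> (trans_sym_schema tA 0)"
  by (rule derivable_checked [where t = "(\<Lambda> a:tA. \<Lambda> b:tA. \<Lambda> p:sid tA a b.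
     sJ a (\<lambda>b p. sid (sid tA b b) (strans tA b a b (ssym tA a b p) p) (srefl b))
       (srefl (srefl a)) b p) 0"]) code_simp

definition htpy_family :: "sch \<Rightarrow> (sch \<Rightarrow> sch) \<Rightarrow> sch \<Rightarrow> sch" where
  "htpy_family A P f = ssig (spi A P) (shtpy A P f)"
definition htpy_refl :: "sch \<Rightarrow> (sch \<Rightarrow> sch) \<Rightarrow> sch \<Rightarrow> sch" where
  "htpy_refl A P f = spair (spi A P) (shtpy A P f) f (\<Lambda> a:A. srefl (f \<cdot> a))"
definition htpy_contr_schema :: "sch \<Rightarrow> (sch \<Rightarrow> sch) \<Rightarrow> sch" where
  "htpy_contr_schema A P = (\<Pi> f:spi A P. \<Pi> w:htpy_family A P f.
     sid (htpy_family A P f) (htpy_refl A P f) w)"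
definition singleton_fam :: "(sch \<Rightarrow> sch) \<Rightarrow> sch \<Rightarrow> sch \<Rightarrow> sch" where
  "singleton_fam P f a = (\<Sigma> b:P a. sid (P a) (f \<cdot> a) b)"

lemma htpy_contr_if_weak_funext:
  assumes "derivable \<S> (weak_funext_schema tA tP 0)"
  shows "derivable \<S> (htpy_contr_schema tA tP 0)"
proof -
  have 1: "derivable \<S> ((\<Pi> f:spi tA tP. weak_funext_schema tA (singleton_fam tP f)) 0)"
    by (rule derivable_instance_Pi [OF assms, where D = "spi tA tP 0" and Ts = "[tA 1]" and
        Fs = "[singleton_fam tP (svar 0) (svar 1) 2]"]) code_simp
  show ?thesis
    \<comment> \<open>Each singleton at \<open>f a\<close> is contractible by path induction, so
      weak extensionality connects \<open>k\<close> and \<open>l\<close>. Splitting a function into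
      singletons into its two components sends \<open>k\<close> to \<open>htpy_refl\<close> and
      \<open>l\<close> to \<open>w\<close>, strictly by eta.\<close>
    by (rule derivable_from [where Hs =
          "[(\<Pi> f:spi tA tP. weak_funext_schema tA (singleton_fam tP f)) 0]" and t =
      "(\<Lambda> h:(\<Pi> f:spi tA tP. weak_funext_schema tA (singleton_fam tP f)).
        \<Lambda> f:spi tA tP. \<Lambda> w:htpy_family tA tP f.
        (let S = singleton_fam tP f; mk = (\<lambda>a. spair (tP a) (sid (tP a) (f \<cdot> a)));
             z = (\<lambda>a. mk a (f \<cdot> a) (srefl (f \<cdot> a)));
             c = (\<Lambda> a:tA. spair (S a) (\<lambda>x. \<Pi> y:S a. sid (S a) x y) (z a)
                   (\<Lambda> u:S a. sJ (f \<cdot> a) (\<lambda>b q. sid (S a) (z a) (mk a b q)) (srefl (z a)) (sfst u) (ssnd u)));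
             K = h \<cdot> f \<cdot> c; Z = spi tA S; k = slam tA z;
             l = (\<Lambda> a:tA. mk a (sfst w \<cdot> a) (ssnd w \<cdot> a)) in
         sap (htpy_family tA tP f)
           (\<lambda>k. spair (spi tA tP) (shtpy tA tP f) (\<Lambda> a:tA. sfst (k \<cdot> a)) (\<Lambda> a:tA. ssnd (k \<cdot> a))) k l
           (strans Z k (sfst K) l (ssym Z (sfst K) k (ssnd K \<cdot> k)) (ssnd K \<cdot> l)))) 0"],
      code_simp, use 1 in simp)
qed

lemma funext_if_weak_funext:
  assumes "derivable \<S> (weak_funext_schema tA tP 0)"
  shows "derivable \<S> (funext_schema tA tP 0)"
proof -
  have 1: "derivable \<S> (trans_sym_schema (spi tA tP) 0)"
    by (rule derivable_instance [OF derivable_trans_sym, where Ts = "[spi tA tP 0]" and Fs = "[]"])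
      code_simp
  note 2 = htpy_contr_if_weak_funext [OF assms]
  show ?thesis
    \<comment> \<open>\<open>sec\<close> projects the contraction path at \<open>(g, H)\<close> to a
      path from \<open>f\<close> to \<open>g\<close>. As a section of \<open>happly\<close> it is
      verified by induction on the contraction path. For the retraction the loop \<open>s\<close> at
      \<open>f\<close> has to be cancelled, so that reflexivity is sent to \<open>s\<close> inverse
      followed by \<open>s\<close>.\<close>
    by (rule derivable_from [where Hs = "[trans_sym_schema (spi tA tP) 0, htpy_contr_schema tA tP 0]" and t =
      "(\<Lambda> l:trans_sym_schema (spi tA tP). \<Lambda> h:htpy_contr_schema tA tP. \<Lambda> f:spi tA tP. \<Lambda> g:spi tA tP.
        (let T = spi tA tP; hp = (\<lambda>g p. shapply tA tP f g \<cdot> p); w = htpy_refl tA tP f;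
             af = (\<lambda>v p. sap T sfst w v p); sec = (\<lambda>v. af v (h \<cdot> f \<cdot> v));
             mk = spair T (shtpy tA tP f); Hg = shtpy tA tP f; s = sec w;
             r = (\<lambda>g H. strans T f f g (ssym T f f s) (sec (mk g H))) in
         smkEquiv (sid T f g) (Hg g) (shapply tA tP f g)
           (\<Lambda> H:Hg g. sec (mk g H))
           (\<Lambda> H:Hg g. sJ w (\<lambda>v p. sid (Hg (sfst v)) (hp (sfst v) (af v p)) (ssnd v))
              (srefl (\<Lambda> a:tA. srefl (f \<cdot> a))) (mk g H) (h \<cdot> f \<cdot> mk g H))
           (\<Lambda> H:Hg g. r g H)
           (\<Lambda> p:sid T f g. sJ f (\<lambda>g p. sid (sid T f g) (r g (hp g p)) p) (l \<cdot> f \<cdot> f \<cdot> s) g p))) 0"],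
      code_simp, use 1 2 in simp)
qed

subsection \<open>Categorical equivalences under function extensionality\<close>

definition total_map :: "sch \<Rightarrow> (sch \<Rightarrow> sch) \<Rightarrow> (sch \<Rightarrow> sch) \<Rightarrow> sch \<Rightarrow> sch" where
  "total_map X P Q \<phi> = (\<Lambda> w:ssig X P. spair X Q (sfst w) (\<phi> \<cdot> sfst w \<cdot> ssnd w))"

text \<open>The conclusion speaks about a variable \<open>k\<close> that is identified with the map in question, so that
  its instances need not unfold the map inside the type of equivalences.\<close>

definition total_equiv_schema :: "sch \<Rightarrow> (sch \<Rightarrow> sch) \<Rightarrow> (sch \<Rightarrow> sch) \<Rightarrow> sch" where
  "total_equiv_schema X P Q = (\<Pi> \<phi>:(\<Pi> x:X. P x \<rightharpoondown> Q x). (\<Pi> x:X. sisEquiv (P x) (Q x) (\<phi> \<cdot> x)) \<rightharpoondown>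
     (\<Pi> k:ssig X P \<rightharpoondown> ssig X Q. sid (ssig X P \<rightharpoondown> ssig X Q) (total_map X P Q \<phi>) k \<rightharpoondown>
        sisEquiv (ssig X P) (ssig X Q) k))"

text \<open>Induction on \<open>q\<close> reduces to the total map itself, whose section and
  retraction are formed fibrewise.\<close>

lemma derivable_total_equiv: "derivable \<S> (total_equiv_schema tA tP (sfam 1) 0)"
  by (rule derivable_checked [where t =
    "(let P = tP; Q = sfam 1; V = ssig tA P; W = ssig tA Q in
      \<Lambda> \<phi>:(\<Pi> x:tA. P x \<rightharpoondown> Q x). \<Lambda> e:(\<Pi> x:tA. sisEquiv (P x) (Q x) (\<phi> \<cdot> x)).
      \<Lambda> k:V \<rightharpoondown> W. \<Lambda> q:sid (V \<rightharpoondown> W) (total_map tA P Q \<phi>) k.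
      sJ (total_map tA P Q \<phi>) (\<lambda>k _. sisEquiv V W k)
       (let inv = (\<lambda>c. \<Lambda> w:W. spair tA P (sfst w) (c (e \<cdot> sfst w) \<cdot> ssnd w)) in
        smkEquiv V W (total_map tA P Q \<phi>)
         (inv c1)
         (\<Lambda> w:W. sap W (spair tA Q (sfst w)) (\<phi> \<cdot> sfst w \<cdot> (c1 (e \<cdot> sfst w) \<cdot> ssnd w)) (ssnd w)
            (c2 (e \<cdot> sfst w) \<cdot> ssnd w))
         (inv c3)
         (\<Lambda> v:V. sap V (spair tA P (sfst v)) (c3 (e \<cdot> sfst v) \<cdot> (\<phi> \<cdot> sfst v \<cdot> ssnd v)) (ssnd v)
            (c4 (e \<cdot> sfst v) \<cdot> ssnd v)))
       k q) 0"]) code_simp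

text \<open>The common shape of \<open>sisCEq\<close> and \<open>sisEquiv\<close>, with
  \<open>P\<close> and \<open>Q\<close> the laws for the section and the retraction.\<close>

definition quad :: "sch \<Rightarrow> (sch \<Rightarrow> sch) \<Rightarrow> (sch \<Rightarrow> sch) \<Rightarrow> sch" where
  "quad Y P Q = (\<Sigma> s:Y. \<Sigma> _:P s. \<Sigma> r:Y. Q r)"
definition mkquad :: "sch \<Rightarrow> (sch \<Rightarrow> sch) \<Rightarrow> (sch \<Rightarrow> sch) \<Rightarrow> sch \<Rightarrow> sch \<Rightarrow> sch \<Rightarrow> sch \<Rightarrow> sch" where
  "mkquad Y P Q s S r R = spair Y (\<lambda>s. \<Sigma> _:P s. \<Sigma> r:Y. Q r) s
     (spair (P s) (\<lambda>_. \<Sigma> r:Y. Q r) S (spair Y Q r R))"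
definition quad_map :: "sch \<Rightarrow> (sch \<Rightarrow> sch) \<Rightarrow> (sch \<Rightarrow> sch) \<Rightarrow> (sch \<Rightarrow> sch) \<Rightarrow> (sch \<Rightarrow> sch) \<Rightarrow> sch \<Rightarrow> sch \<Rightarrow> sch" where
  "quad_map Y P P' Q Q' \<phi> \<psi> = (\<Lambda> w:quad Y P Q.
     mkquad Y P' Q' (c1 w) (\<phi> \<cdot> c1 w \<cdot> c2 w) (c3 w) (\<psi> \<cdot> c3 w \<cdot> c4 w))"
definition quad_equiv_schema :: "sch \<Rightarrow> (sch \<Rightarrow> sch) \<Rightarrow> (sch \<Rightarrow> sch) \<Rightarrow> (sch \<Rightarrow> sch) \<Rightarrow> (sch \<Rightarrow> sch) \<Rightarrow> sch" where
  "quad_equiv_schema Y P P' Q Q' =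
     (\<Pi> \<phi>:(\<Pi> x:Y. P x \<rightharpoondown> P' x). \<Pi> \<psi>:(\<Pi> x:Y. Q x \<rightharpoondown> Q' x).
        (\<Pi> x:Y. sisEquiv (P x) (P' x) (\<phi> \<cdot> x)) \<rightharpoondown> (\<Pi> x:Y. sisEquiv (Q x) (Q' x) (\<psi> \<cdot> x)) \<rightharpoondown>
        (\<Pi> k:quad Y P Q \<rightharpoondown> quad Y P' Q'.
           sid (quad Y P Q \<rightharpoondown> quad Y P' Q') (quad_map Y P P' Q Q' \<phi> \<psi>) k \<rightharpoondown>
           sisEquiv (quad Y P Q) (quad Y P' Q') k))"

text \<open>\<open>s\<close> and \<open>r\<close> stay fixed, so the laws for the inverses need
  paths only in the other two components. \<open>path\<close> combines these by one induction in
  each.\<close>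

lemma derivable_quad_equiv:
  "derivable \<S> (quad_equiv_schema tA (sfam 0) (sfam 1) (sfam 2) (sfam 3) 0)"
  by (rule derivable_checked [where t =
    "(let P = sfam 0; P' = sfam 1; Q = sfam 2; Q' = sfam 3; V = quad tA P Q; W = quad tA P' Q' in
      \<Lambda> \<phi>:(\<Pi> x:tA. P x \<rightharpoondown> P' x). \<Lambda> \<psi>:(\<Pi> x:tA. Q x \<rightharpoondown> Q' x).
      \<Lambda> e:(\<Pi> x:tA. sisEquiv (P x) (P' x) (\<phi> \<cdot> x)). \<Lambda> d:(\<Pi> x:tA. sisEquiv (Q x) (Q' x) (\<psi> \<cdot> x)).
      \<Lambda> k:V \<rightharpoondown> W. \<Lambda> q:sid (V \<rightharpoondown> W) (quad_map tA P P' Q Q' \<phi> \<psi>) k.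
      sJ (quad_map tA P P' Q Q' \<phi> \<psi>) (\<lambda>k _. sisEquiv V W k)
       (let inv = (\<lambda>c. \<Lambda> w:W. mkquad tA P Q (c1 w) (c (e \<cdot> c1 w) \<cdot> c2 w) (c3 w) (c (d \<cdot> c3 w) \<cdot> c4 w));
            path = (\<lambda>T mk s S S' r R R' p q. sJ R (\<lambda>R' _. sid T (mk s S r R) (mk s S' r R'))
              (sJ S (\<lambda>S' _. sid T (mk s S r R) (mk s S' r R)) (srefl (mk s S r R)) S' p) R' q) in
        smkEquiv V W (quad_map tA P P' Q Q' \<phi> \<psi>)
         (inv c1)
         (\<Lambda> w:W. path W (mkquad tA P' Q') (c1 w)
            (\<phi> \<cdot> c1 w \<cdot> (c1 (e \<cdot> c1 w) \<cdot> c2 w)) (c2 w) (c3 w)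
            (\<psi> \<cdot> c3 w \<cdot> (c1 (d \<cdot> c3 w) \<cdot> c4 w)) (c4 w)
            (c2 (e \<cdot> c1 w) \<cdot> c2 w) (c2 (d \<cdot> c3 w) \<cdot> c4 w))
         (inv c3)
         (\<Lambda> v:V. path V (mkquad tA P Q) (c1 v)
            (c3 (e \<cdot> c1 v) \<cdot> (\<phi> \<cdot> c1 v \<cdot> c2 v)) (c2 v) (c3 v)
            (c3 (d \<cdot> c3 v) \<cdot> (\<psi> \<cdot> c3 v \<cdot> c4 v)) (c4 v)
            (c4 (e \<cdot> c1 v) \<cdot> c2 v) (c4 (d \<cdot> c3 v) \<cdot> c4 v)))
       k q) 0"]) code_simp

definition isCEq_equiv_schema :: "sch \<Rightarrow> sch \<Rightarrow> sch" where
  "isCEq_equiv_schema A B = (\<Pi> f:A \<rightharpoondown> B. \<Pi> k:sisCEq A B f \<rightharpoondown> sisEquiv A B f.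
     sid (sisCEq A B f \<rightharpoondown> sisEquiv A B f) (\<Lambda> c:sisCEq A B f. isCEq_to_isEquiv A B f c) k \<rightharpoondown>
     sisEquiv (sisCEq A B f) (sisEquiv A B f) k)"

text \<open>For fixed \<open>f\<close>, the map from \<open>sisCEq\<close> to
  \<open>sisEquiv\<close> applies \<open>happly\<close> to the two laws, and function extensionality
  makes each of these applications an equivalence.\<close>

lemma isCEq_equiv_if_funext:
  assumes "derivable \<S> (funext_schema tA tP 0)"
  shows "derivable \<S> (isCEq_equiv_schema tA tB 0)"
proof -
  let ?quad = "\<Pi> f:tA \<rightharpoondown> tB. quad_equiv_schema (tB \<rightharpoondown> tA)
    (scsec tA tB f) (ssec tA tB f) (scret tA tB f) (sret tA tB f)"
  have 1: "derivable \<S> (?quad 0)"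
    by (rule derivable_instance_Pi [OF derivable_quad_equiv, where D = "(tA \<rightharpoondown> tB) 0" and
        Ts = "[(tB \<rightharpoondown> tA) 1]" and
        Fs = "[scsec tA tB (svar 0) (svar 1) 2, ssec tA tB (svar 0) (svar 1) 2,
               scret tA tB (svar 0) (svar 1) 2, sret tA tB (svar 0) (svar 1) 2]"]) code_simp
  have 2: "derivable \<S> (funext_schema tA (\<lambda>_. tA) 0)"
    by (rule derivable_instance [OF assms, where Ts = "[tA 0]" and Fs = "[tA 1]"]) code_simp
  have 3: "derivable \<S> (funext_schema tB (\<lambda>_. tB) 0)"
    by (rule derivable_instance [OF assms, where Ts = "[tB 0]" and Fs = "[tB 1]"]) code_simp
  show ?thesis
    by (rule derivable_from [where Hs = "[?quad 0, funext_schema tA (\<lambda>_. tA) 0, funext_schema tB (\<lambda>_. tB) 0]"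
        and t =
      "(\<Lambda> l:?quad. \<Lambda> hA:funext_schema tA (\<lambda>_. tA). \<Lambda> hB:funext_schema tB (\<lambda>_. tB). \<Lambda> f:tA \<rightharpoondown> tB.
        l \<cdot> f \<cdot> (\<Lambda> s:tB \<rightharpoondown> tA. shapply tB (\<lambda>_. tB) (scmp tB f s) (sidm tB))
              \<cdot> (\<Lambda> r:tB \<rightharpoondown> tA. shapply tA (\<lambda>_. tA) (scmp tA r f) (sidm tA))
              \<cdot> (\<Lambda> s:tB \<rightharpoondown> tA. hB \<cdot> scmp tB f s \<cdot> sidm tB)
              \<cdot> (\<Lambda> r:tB \<rightharpoondown> tA. hA \<cdot> scmp tA r f \<cdot> sidm tA)) 0"],
      code_simp, use 1 2 3 in simp)
qed

lemma CEqToEq_equiv_if_funext: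
  assumes "derivable \<S> (funext_schema tA tP 0)"
  shows "derivable \<S> (sisEquiv (sCEq tA tB) (sEqv tA tB) (sCEqToEq tA tB) 0)"
proof -
  let ?total = "total_equiv_schema (tA \<rightharpoondown> tB) (sisCEq tA tB) (sisEquiv tA tB)"
  let ?M = "sCEq tA tB \<rightharpoondown> sEqv tA tB"
  let ?T = "\<Pi> k:?M. sid ?M (sCEqToEq tA tB) k \<rightharpoondown> sisEquiv (sCEq tA tB) (sEqv tA tB) k"
  have 1: "derivable \<S> (?total 0)"
    by (rule derivable_instance [OF derivable_total_equiv, where Ts = "[(tA \<rightharpoondown> tB) 0]" and
        Fs = "[sisCEq tA tB (svar 0) 1, sisEquiv tA tB (svar 0) 1]"]) code_simp
  note 2 = isCEq_equiv_if_funext [OF assms]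
  have "derivable \<S> (?T 0)"
    by (rule derivable_from [where Hs = "[?total 0, isCEq_equiv_schema tA tB 0]" and t =
      "(let \<phi> = (\<lambda>f. \<Lambda> c:sisCEq tA tB f. isCEq_to_isEquiv tA tB f c) in
        \<Lambda> l:?total. \<Lambda> h:isCEq_equiv_schema tA tB.
          l \<cdot> slam (tA \<rightharpoondown> tB) \<phi> \<cdot> (\<Lambda> f:tA \<rightharpoondown> tB. h \<cdot> f \<cdot> \<phi> f \<cdot> srefl (\<phi> f))) 0"],
      code_simp, use 1 2 in simp)
  then have "derivable \<S> (MPi (sid ?M (sCEqToEq tA tB) (sCEqToEq tA tB) 0)
      (lift 1 0 (sisEquiv (sCEq tA tB) (sEqv tA tB) (sCEqToEq tA tB) 0)))"
    by (rule derivable_specializes [where a = "sCEqToEq tA tB 0"]) code_simp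
  moreover have "derivable \<S> (sid ?M (sCEqToEq tA tB) (sCEqToEq tA tB) 0)"
    by (rule derivable_checked [where t = "srefl (sCEqToEq tA tB) 0"]) code_simp
  ultimately show ?thesis by (rule derivable_mp)
qed

subsection \<open>Being an equivalence is a proposition under function extensionality\<close>

definition sRet :: "sch \<Rightarrow> sch \<Rightarrow> sch" where
  "sRet X Y = (\<Sigma> i:X \<rightharpoondown> Y. \<Sigma> r:Y \<rightharpoondown> X. \<Pi> x:X. sid X (r \<cdot> (i \<cdot> x)) x)"
definition smkRet :: "sch \<Rightarrow> sch \<Rightarrow> sch \<Rightarrow> sch \<Rightarrow> sch \<Rightarrow> sch" where
  "smkRet X Y i r e = spair (X \<rightharpoondown> Y) (\<lambda>i. \<Sigma> r:Y \<rightharpoondown> X. \<Pi> x:X. sid X (r \<cdot> (i \<cdot> x)) x) i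
     (spair (Y \<rightharpoondown> X) (\<lambda>r. \<Pi> x:X. sid X (r \<cdot> (i \<cdot> x)) x) r e)"
definition ret_trans :: "sch \<Rightarrow> sch \<Rightarrow> sch \<Rightarrow> sch \<Rightarrow> sch \<Rightarrow> sch" where
  "ret_trans X Y Z a b =
     (let i = (\<lambda>x. sfst b \<cdot> (sfst a \<cdot> x)); r = (\<lambda>z. sfst (ssnd a) \<cdot> (sfst (ssnd b) \<cdot> z)) in
      smkRet X Z (slam X i) (slam Z r)
       (\<Lambda> x:X. strans X (r (i x)) (sfst (ssnd a) \<cdot> (sfst a \<cdot> x)) x
          (sap X (\<lambda>y. sfst (ssnd a) \<cdot> y) (sfst (ssnd b) \<cdot> i x) (sfst a \<cdot> x) (ssnd (ssnd b) \<cdot> (sfst a \<cdot> x)))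
          (ssnd (ssnd a) \<cdot> x)))"

definition prop_sigma_schema :: "sch \<Rightarrow> (sch \<Rightarrow> sch) \<Rightarrow> sch" where
  "prop_sigma_schema X P = (\<Pi> x0:X. (\<Pi> x:X. sRet (P x) (sid X x0 x)) \<rightharpoondown> sisProp (ssig X P))"

text \<open>The paths out of \<open>x0\<close> form a contractible total space, of which the total
  space of \<open>P\<close> is a retract.\<close>

lemma derivable_prop_sigma: "derivable \<S> (prop_sigma_schema tA tP 0)"
  by (rule derivable_checked [where t =
    "(\<Lambda> x0:tA. \<Lambda> h:(\<Pi> x:tA. sRet (tP x) (sid tA x0 x)).
      (let F = ssig tA tP; pr = spair tA tP; \<rho> = (\<lambda>x z. sfst (ssnd (h \<cdot> x)) \<cdot> z); c = pr x0 (\<rho> x0 (srefl x0));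
           K = (\<lambda>w. let x = sfst w; u = ssnd w; z = sfst (h \<cdot> x) \<cdot> u in
             strans F c (pr x (\<rho> x z)) w
               (sJ x0 (\<lambda>x z. sid F c (pr x (\<rho> x z))) (srefl c) x z)
               (sap F (pr x) (\<rho> x z) u (ssnd (ssnd (h \<cdot> x)) \<cdot> u))) in
       \<Lambda> u:F. \<Lambda> v:F. strans F u c v (ssym F c u (K u)) (K v))) 0"]) code_simp

definition trans_cancel_schema :: "sch \<Rightarrow> sch" where
  "trans_cancel_schema X = (\<Pi> a:X. \<Pi> b:X. \<Pi> c:X. \<Pi> p:sid X a b. \<Pi> q:sid X b c.
     sid (sid X a b) (strans X a c b (strans X a b c p q) (ssym X b c q)) p)"

lemma derivable_trans_cancel: "derivable \<S> (trans_cancel_schema tA 0)"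
  by (rule derivable_checked [where t =
    "(\<Lambda> a:tA. \<Lambda> b:tA. \<Lambda> c:tA. \<Lambda> p:sid tA a b. \<Lambda> q:sid tA b c.
      sJ b (\<lambda>c q. sid (sid tA a b) (strans tA a c b (strans tA a b c p q) (ssym tA b c q)) p)
        (srefl p) c q) 0"]) code_simp

definition ap_retract_schema :: "sch \<Rightarrow> sch \<Rightarrow> sch" where
  "ap_retract_schema X Y = (\<Pi> f:X \<rightharpoondown> Y. \<Pi> g:Y \<rightharpoondown> X. \<Pi> \<epsilon>:(\<Pi> y:Y. sid Y (f \<cdot> (g \<cdot> y)) y). \<Pi> y:Y. \<Pi> z:Y.
     \<Sigma> r:sid X (g \<cdot> y) (g \<cdot> z) \<rightharpoondown> sid Y y z.
       \<Pi> q:sid Y y z. sid (sid Y y z) (r \<cdot> sap X (\<lambda>v. g \<cdot> v) y z q) q)"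

text \<open>A path between the images under \<open>g\<close> is mapped by \<open>f\<close> and
  conjugated with \<open>\<epsilon>\<close>. On the image of reflexivity this is
  \<open>\<epsilon>\<close> inverse followed by \<open>\<epsilon>\<close>.\<close>

lemma derivable_ap_retract: "derivable \<S> (ap_retract_schema tA tB 0)"
proof -
  have 1: "derivable \<S> (trans_sym_schema tB 0)"
    by (rule derivable_instance [OF derivable_trans_sym, where Ts = "[tB 0]" and Fs = "[]"]) code_simp
  show ?thesis
    by (rule derivable_from [where Hs = "[trans_sym_schema tB 0]" and t =
      "(\<Lambda> l:trans_sym_schema tB. \<Lambda> f:tA \<rightharpoondown> tB. \<Lambda> g:tB \<rightharpoondown> tA. \<Lambda> \<epsilon>:(\<Pi> y:tB. sid tB (f \<cdot> (g \<cdot> y)) y).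
        \<Lambda> y:tB. \<Lambda> z:tB.
        (let fg = (\<lambda>y. f \<cdot> (g \<cdot> y)); apg = (\<lambda>z q. sap tA (\<lambda>v. g \<cdot> v) y z q);
             \<rho> = (\<lambda>z w. strans tB y (fg z) z
               (strans tB y (fg y) (fg z) (ssym tB (fg y) y (\<epsilon> \<cdot> y)) (sap tB (\<lambda>x. f \<cdot> x) (g \<cdot> y) (g \<cdot> z) w))
               (\<epsilon> \<cdot> z)) in
         spair (sid tA (g \<cdot> y) (g \<cdot> z) \<rightharpoondown> sid tB y z)
           (\<lambda>r. \<Pi> q:sid tB y z. sid (sid tB y z) (r \<cdot> apg z q) q)
           (\<Lambda> w:sid tA (g \<cdot> y) (g \<cdot> z). \<rho> z w)
           (\<Lambda> q:sid tB y z. sJ y (\<lambda>z q. sid (sid tB y z) (\<rho> z (apg z q)) q) (l \<cdot> fg y \<cdot> y \<cdot> (\<epsilon> \<cdot> y)) z q))) 0"],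
      code_simp, use 1 in simp)
qed

definition fibre_retract_schema :: "sch \<Rightarrow> sch \<Rightarrow> sch" where
  "fibre_retract_schema X Y = (\<Pi> f:X \<rightharpoondown> Y. \<Pi> g:Y \<rightharpoondown> X.
     (\<Pi> x:X. sid X (g \<cdot> (f \<cdot> x)) x) \<rightharpoondown> (\<Pi> y:Y. sid Y (f \<cdot> (g \<cdot> y)) y) \<rightharpoondown>
     (\<Pi> y:Y. \<Pi> x:X. sRet (sid Y y (f \<cdot> x)) (sid X (g \<cdot> y) x)))"

text \<open>Apply \<open>g\<close> and compose with \<open>\<eta> \<cdot> x\<close>; to return,
  cancel \<open>\<eta> \<cdot> x\<close> and use the left inverse of the action of \<open>g\<close>
  on paths. No coherence between \<open>\<eta>\<close> and \<open>\<epsilon>\<close> enters.\<close>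

lemma derivable_fibre_retract: "derivable \<S> (fibre_retract_schema tA tB 0)"
  by (rule derivable_from [where Hs = "[trans_cancel_schema tA 0, ap_retract_schema tA tB 0]" and t =
    "(\<Lambda> l:trans_cancel_schema tA. \<Lambda> m:ap_retract_schema tA tB. \<Lambda> f:tA \<rightharpoondown> tB. \<Lambda> g:tB \<rightharpoondown> tA.
      \<Lambda> \<eta>:(\<Pi> x:tA. sid tA (g \<cdot> (f \<cdot> x)) x). \<Lambda> \<epsilon>:(\<Pi> y:tB. sid tB (f \<cdot> (g \<cdot> y)) y). \<Lambda> y:tB. \<Lambda> x:tA.
      (let T = sid tB y (f \<cdot> x); gy = g \<cdot> y; gfx = g \<cdot> (f \<cdot> x); k = m \<cdot> f \<cdot> g \<cdot> \<epsilon> \<cdot> y \<cdot> (f \<cdot> x);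
           apg = (\<lambda>q. sap tA (\<lambda>v. g \<cdot> v) y (f \<cdot> x) q);
           \<zeta> = (\<lambda>q. strans tA gy gfx x (apg q) (\<eta> \<cdot> x));
           \<delta> = (\<lambda>z. strans tA gy x gfx z (ssym tA gfx x (\<eta> \<cdot> x)));
           \<rho> = (\<lambda>z. sfst k \<cdot> z) in
       smkRet T (sid tA gy x) (slam T \<zeta>) (\<Lambda> z:sid tA gy x. \<rho> (\<delta> z))
        (\<Lambda> q:T. strans T (\<rho> (\<delta> (\<zeta> q))) (\<rho> (apg q)) q
           (sap T \<rho> (\<delta> (\<zeta> q)) (apg q) (l \<cdot> gy \<cdot> gfx \<cdot> x \<cdot> apg q \<cdot> (\<eta> \<cdot> x))) (ssnd k \<cdot> q)))) 0"],
    code_simp, use derivable_trans_cancel [of \<S>] derivable_ap_retract [of \<S>] in simp)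

text \<open>The path is reversed so that, with \<open>v\<close> the identity, it starts at a fixed
  point, as in \<open>fibre_retract_schema\<close>.\<close>

definition htpy_retract_schema :: "sch \<Rightarrow> sch \<Rightarrow> sch" where
  "htpy_retract_schema A B = (\<Pi> u:A \<rightharpoondown> B. \<Pi> v:A \<rightharpoondown> B.
     sRet (shtpy A (\<lambda>_. B) u v) (sid (A \<rightharpoondown> B) v u))"

lemma htpy_retract_if_funext:
  assumes "derivable \<S> (funext_schema tA tP 0)"
  shows "derivable \<S> (htpy_retract_schema tA tB 0)"
proof -
  have 1: "derivable \<S> (funext_schema tA (\<lambda>_. tB) 0)"
    by (rule derivable_instance [OF assms, where Ts = "[tA 0]" and Fs = "[tB 1]"]) code_simp
  show ?thesis
    by (rule derivable_from [where Hs = "[funext_schema tA (\<lambda>_. tB) 0]" and t =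
      "(\<Lambda> h:funext_schema tA (\<lambda>_. tB). \<Lambda> u:tA \<rightharpoondown> tB. \<Lambda> v:tA \<rightharpoondown> tB.
        (let T = tA \<rightharpoondown> tB; H = shtpy tA (\<lambda>_. tB) u v; e = h \<cdot> u \<cdot> v; s = (\<lambda>x. c1 e \<cdot> x);
             hp = (\<lambda>p. shapply tA (\<lambda>_. tB) u v \<cdot> p);
             ss = (\<lambda>v p. ssym T v u (ssym T u v p)) in
         smkRet H (sid T v u) (\<Lambda> x:H. ssym T u v (s x)) (\<Lambda> q:sid T v u. hp (ssym T v u q))
          (\<Lambda> x:H. strans H (hp (ss v (s x))) (hp (s x)) x
             (sap H hp (ss v (s x)) (s x)
               (sJ u (\<lambda>v p. sid (sid T u v) (ss v p) p) (srefl (srefl u)) v (s x)))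
             (c2 e \<cdot> x)))) 0"],
      code_simp, use 1 in simp)
qed

section \<open>Two-sided inverses and uniqueness of sections and retractions\<close>

definition inverse_schema :: "sch \<Rightarrow> sch \<Rightarrow> sch" where
  "inverse_schema A B = (\<Pi> f:A \<rightharpoondown> B. sisEquiv A B f \<rightharpoondown>
     (\<Sigma> g:B \<rightharpoondown> A. \<Sigma> _:scret A B f g. scsec A B f g))"

definition inverses_agree_schema :: "sch \<Rightarrow> sch \<Rightarrow> sch" where
  "inverses_agree_schema A B = (\<Pi> f:A \<rightharpoondown> B. \<Pi> s:B \<rightharpoondown> A. \<Pi> r:B \<rightharpoondown> A.
     sid (B \<rightharpoondown> B) (sidm B) (scmp B f s) \<rightharpoondown> sid (A \<rightharpoondown> A) (sidm A) (scmp A r f) \<rightharpoondown> sid (B \<rightharpoondown> A) s r)"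

text \<open>Both maps are compared with \<open>r \<circ> f \<circ> s\<close>.\<close>

lemma derivable_inverses_agree: "derivable \<S> (inverses_agree_schema tA tB 0)"
  by (rule derivable_checked [where t =
    "(\<Lambda> f:tA \<rightharpoondown> tB. \<Lambda> s:tB \<rightharpoondown> tA. \<Lambda> r:tB \<rightharpoondown> tA.
      \<Lambda> S:sid (tB \<rightharpoondown> tB) (sidm tB) (scmp tB f s). \<Lambda> R:sid (tA \<rightharpoondown> tA) (sidm tA) (scmp tA r f).
      (let T = tB \<rightharpoondown> tA; rfs = (\<Lambda> b:tB. r \<cdot> (f \<cdot> (s \<cdot> b))) in
       strans T s rfs r (sap T (\<lambda>k. scmp tB k s) (sidm tA) (scmp tA r f) R)
        (ssym T r rfs (sap T (\<lambda>k. scmp tB r k) (sidm tB) (scmp tB f s) S)))) 0"]) code_simp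

lemma inverse_if_funext:
  assumes "derivable \<S> (funext_schema tA tP 0)"
  shows "derivable \<S> (inverse_schema tA tB 0)"
proof -
  note h = htpy_retract_if_funext [OF assms]
  have 1: "derivable \<S> (htpy_retract_schema tA tA 0)"
    by (rule derivable_instance [OF h, where Ts = "[tA 0, tA 0]" and Fs = "[]"]) code_simp
  have 2: "derivable \<S> (htpy_retract_schema tB tB 0)"
    by (rule derivable_instance [OF h, where Ts = "[tB 0, tB 0]" and Fs = "[]"]) code_simp
  show ?thesis
    by (rule derivable_from [where Hs = "[htpy_retract_schema tA tA 0, htpy_retract_schema tB tB 0,
          inverses_agree_schema tA tB 0]" and t =
      "(\<Lambda> hA:htpy_retract_schema tA tA. \<Lambda> hB:htpy_retract_schema tB tB. \<Lambda> l:inverses_agree_schema tA tB.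
        \<Lambda> f:tA \<rightharpoondown> tB. \<Lambda> e:sisEquiv tA tB f.
        (let s = c1 e; r = c3 e; AA = tA \<rightharpoondown> tA; BB = tB \<rightharpoondown> tB; iA = sidm tA; iB = sidm tB;
             S = sfst (hB \<cdot> scmp tB f s \<cdot> iB) \<cdot> c2 e; R = sfst (hA \<cdot> scmp tA r f \<cdot> iA) \<cdot> c4 e in
         spair (tB \<rightharpoondown> tA) (\<lambda>g. \<Sigma> _:scret tA tB f g. scsec tA tB f g) r
          (spair (scret tA tB f r) (\<lambda>_. scsec tA tB f r)
            (ssym AA iA (scmp tA r f) R)
            (strans BB (scmp tB f r) (scmp tB f s) iB
              (sap BB (scmp tB f) r s (ssym (tB \<rightharpoondown> tA) s r (l \<cdot> f \<cdot> s \<cdot> r \<cdot> S \<cdot> R)))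
              (ssym BB iB (scmp tB f s) S))))) 0"],
      code_simp, use 1 2 derivable_inverses_agree [of \<S>] in simp)
qed

definition section_prop_schema :: "sch \<Rightarrow> sch \<Rightarrow> sch" where
  "section_prop_schema A B = (\<Pi> f:A \<rightharpoondown> B. \<Pi> g:B \<rightharpoondown> A. scret A B f g \<rightharpoondown> scsec A B f g \<rightharpoondown>
     sisProp (shasSection A B f))"
definition retraction_prop_schema :: "sch \<Rightarrow> sch \<Rightarrow> sch" where
  "retraction_prop_schema A B = (\<Pi> f:A \<rightharpoondown> B. \<Pi> g:B \<rightharpoondown> A. scret A B f g \<rightharpoondown> scsec A B f g \<rightharpoondown>
     sisProp (shasRetraction A B f))"

text \<open>Post-compositions with \<open>f\<close> and \<open>g\<close> are mutually inverse by
  whiskering \<open>\<eta>\<close> and \<open>\<epsilon>\<close>. Being a section \<open>s\<close>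
  is thus a retract of the path from the identity to \<open>f \<circ> s\<close>, and this of the
  path from \<open>g\<close> to \<open>s\<close>; \<open>prop_sigma_schema\<close> applies with base
  point \<open>g\<close>.\<close>

lemma section_prop_if_funext:
  assumes "derivable \<S> (funext_schema tA tP 0)"
  shows "derivable \<S> (section_prop_schema tA tB 0)"
proof -
  let ?prop = "\<Pi> f:tA \<rightharpoondown> tB. prop_sigma_schema (tB \<rightharpoondown> tA) (ssec tA tB f)"
  let ?fib = "fibre_retract_schema (tB \<rightharpoondown> tA) (tB \<rightharpoondown> tB)"
  let ?path = "\<Pi> f:tA \<rightharpoondown> tB. \<Pi> g:tB \<rightharpoondown> tA. scret tA tB f g \<rightharpoondown> scsec tA tB f g \<rightharpoondown>
     (\<Pi> s:tB \<rightharpoondown> tA. sRet (sid (tB \<rightharpoondown> tB) (sidm tB) (scmp tB f s)) (sid (tB \<rightharpoondown> tA) g s))"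
  have 1: "derivable \<S> (?prop 0)"
    by (rule derivable_instance_Pi [OF derivable_prop_sigma, where D = "(tA \<rightharpoondown> tB) 0" and
        Ts = "[(tB \<rightharpoondown> tA) 1]" and Fs = "[ssec tA tB (svar 0) (svar 1) 2]"]) code_simp
  have 2: "derivable \<S> (?fib 0)"
    by (rule derivable_instance [OF derivable_fibre_retract,
        where Ts = "[(tB \<rightharpoondown> tA) 0, (tB \<rightharpoondown> tB) 0]" and Fs = "[]"]) code_simp
  have 3: "derivable \<S> (htpy_retract_schema tB tB 0)"
    by (rule derivable_instance [OF htpy_retract_if_funext [OF assms],
        where Ts = "[tB 0, tB 0]" and Fs = "[]"]) code_simp
  have 4: "derivable \<S> (?path 0)"
    by (rule derivable_from [where Hs = "[?fib 0]" and t =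
      "(\<Lambda> l:?fib. \<Lambda> f:tA \<rightharpoondown> tB. \<Lambda> g:tB \<rightharpoondown> tA. \<Lambda> \<eta>:scret tA tB f g. \<Lambda> \<epsilon>:scsec tA tB f g.
        l \<cdot> (\<Lambda> m:tB \<rightharpoondown> tA. scmp tB f m) \<cdot> (\<Lambda> u:tB \<rightharpoondown> tB. scmp tB g u)
          \<cdot> (\<Lambda> m:tB \<rightharpoondown> tA. sap (tB \<rightharpoondown> tA) (\<lambda>k. scmp tB k m) (scmp tA g f) (sidm tA) \<eta>)
          \<cdot> (\<Lambda> u:tB \<rightharpoondown> tB. sap (tB \<rightharpoondown> tB) (\<lambda>k. scmp tB k u) (scmp tB f g) (sidm tB) \<epsilon>)
          \<cdot> sidm tB) 0"], code_simp, use 2 in simp)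
  show ?thesis
    by (rule derivable_from [where Hs = "[?prop 0, htpy_retract_schema tB tB 0, ?path 0]" and t =
      "(\<Lambda> p:?prop. \<Lambda> h:htpy_retract_schema tB tB. \<Lambda> l:?path.
        \<Lambda> f:tA \<rightharpoondown> tB. \<Lambda> g:tB \<rightharpoondown> tA. \<Lambda> \<eta>:scret tA tB f g. \<Lambda> \<epsilon>:scsec tA tB f g.
        p \<cdot> f \<cdot> g \<cdot> (\<Lambda> s:tB \<rightharpoondown> tA. ret_trans (ssec tA tB f s)
          (sid (tB \<rightharpoondown> tB) (sidm tB) (scmp tB f s)) (sid (tB \<rightharpoondown> tA) g s)
          (h \<cdot> scmp tB f s \<cdot> sidm tB) (l \<cdot> f \<cdot> g \<cdot> \<eta> \<cdot> \<epsilon> \<cdot> s))) 0"],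
      code_simp, use 1 3 4 in simp)
qed

text \<open>The same argument for pre-composition, which exchanges the roles of
  \<open>\<eta>\<close> and \<open>\<epsilon>\<close>.\<close>

lemma retraction_prop_if_funext:
  assumes "derivable \<S> (funext_schema tA tP 0)"
  shows "derivable \<S> (retraction_prop_schema tA tB 0)"
proof -
  let ?prop = "\<Pi> f:tA \<rightharpoondown> tB. prop_sigma_schema (tB \<rightharpoondown> tA) (sret tA tB f)"
  let ?fib = "fibre_retract_schema (tB \<rightharpoondown> tA) (tA \<rightharpoondown> tA)"
  let ?path = "\<Pi> f:tA \<rightharpoondown> tB. \<Pi> g:tB \<rightharpoondown> tA. scret tA tB f g \<rightharpoondown> scsec tA tB f g \<rightharpoondown>
     (\<Pi> r:tB \<rightharpoondown> tA. sRet (sid (tA \<rightharpoondown> tA) (sidm tA) (scmp tA r f)) (sid (tB \<rightharpoondown> tA) g r))"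
  have 1: "derivable \<S> (?prop 0)"
    by (rule derivable_instance_Pi [OF derivable_prop_sigma, where D = "(tA \<rightharpoondown> tB) 0" and
        Ts = "[(tB \<rightharpoondown> tA) 1]" and Fs = "[sret tA tB (svar 0) (svar 1) 2]"]) code_simp
  have 2: "derivable \<S> (?fib 0)"
    by (rule derivable_instance [OF derivable_fibre_retract,
        where Ts = "[(tB \<rightharpoondown> tA) 0, (tA \<rightharpoondown> tA) 0]" and Fs = "[]"]) code_simp
  have 3: "derivable \<S> (htpy_retract_schema tA tA 0)"
    by (rule derivable_instance [OF htpy_retract_if_funext [OF assms],
        where Ts = "[tA 0, tA 0]" and Fs = "[]"]) code_simp
  have 4: "derivable \<S> (?path 0)"
    by (rule derivable_from [where Hs = "[?fib 0]" and t =
      "(\<Lambda> l:?fib. \<Lambda> f:tA \<rightharpoondown> tB. \<Lambda> g:tB \<rightharpoondown> tA. \<Lambda> \<eta>:scret tA tB f g. \<Lambda> \<epsilon>:scsec tA tB f g.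
        l \<cdot> (\<Lambda> m:tB \<rightharpoondown> tA. scmp tA m f) \<cdot> (\<Lambda> u:tA \<rightharpoondown> tA. scmp tB u g)
          \<cdot> (\<Lambda> m:tB \<rightharpoondown> tA. sap (tB \<rightharpoondown> tA) (\<lambda>k. scmp tB m k) (scmp tB f g) (sidm tB) \<epsilon>)
          \<cdot> (\<Lambda> u:tA \<rightharpoondown> tA. sap (tA \<rightharpoondown> tA) (\<lambda>k. scmp tA u k) (scmp tA g f) (sidm tA) \<eta>)
          \<cdot> sidm tA) 0"], code_simp, use 2 in simp)
  show ?thesis
    by (rule derivable_from [where Hs = "[?prop 0, htpy_retract_schema tA tA 0, ?path 0]" and t =
      "(\<Lambda> p:?prop. \<Lambda> h:htpy_retract_schema tA tA. \<Lambda> l:?path.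
        \<Lambda> f:tA \<rightharpoondown> tB. \<Lambda> g:tB \<rightharpoondown> tA. \<Lambda> \<eta>:scret tA tB f g. \<Lambda> \<epsilon>:scsec tA tB f g.
        p \<cdot> f \<cdot> g \<cdot> (\<Lambda> r:tB \<rightharpoondown> tA. ret_trans (sret tA tB f r)
          (sid (tA \<rightharpoondown> tA) (sidm tA) (scmp tA r f)) (sid (tB \<rightharpoondown> tA) g r)
          (h \<cdot> scmp tA r f \<cdot> sidm tA) (l \<cdot> f \<cdot> g \<cdot> \<eta> \<cdot> \<epsilon> \<cdot> r))) 0"],
      code_simp, use 1 3 4 in simp)
qed

text \<open>An equivalence is strictly a section paired with a retraction. The inverse obtained from
  \<open>e\<close> makes both types propositions, and the two halves are exchanged one after the
  other.\<close>

lemma isEquiv_isProp_if_funext: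
  assumes "derivable \<S> (funext_schema tA tP 0)"
  shows "derivable \<S> (isEquiv_isProp_schema tA tB 0)"
  by (rule derivable_from [where Hs = "[inverse_schema tA tB 0, section_prop_schema tA tB 0,
        retraction_prop_schema tA tB 0]" and t =
    "(\<Lambda> i:inverse_schema tA tB. \<Lambda> sp:section_prop_schema tA tB. \<Lambda> rp:retraction_prop_schema tA tB.
      \<Lambda> f:tA \<rightharpoondown> tB. \<Lambda> e:sisEquiv tA tB f. \<Lambda> e':sisEquiv tA tB f.
      (let T = sisEquiv tA tB f; k = i \<cdot> f \<cdot> e; g = sfst k; \<eta> = sfst (ssnd k); \<epsilon> = ssnd (ssnd k);
           sec = (\<lambda>e. spair (tB \<rightharpoondown> tA) (ssec tA tB f) (c1 e) (c2 e)); ret = (\<lambda>e. ssnd (ssnd e));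
           mk = (\<lambda>u v. spair (tB \<rightharpoondown> tA) (\<lambda>s. \<Sigma> _:ssec tA tB f s. shasRetraction tA tB f) (sfst u)
             (spair (ssec tA tB f (sfst u)) (\<lambda>_. shasRetraction tA tB f) (ssnd u) v)) in
       strans T e (mk (sec e') (ret e)) e'
        (sap T (\<lambda>u. mk u (ret e)) (sec e) (sec e') (sp \<cdot> f \<cdot> g \<cdot> \<eta> \<cdot> \<epsilon> \<cdot> sec e \<cdot> sec e'))
        (sap T (\<lambda>v. mk (sec e') v) (ret e) (ret e') (rp \<cdot> f \<cdot> g \<cdot> \<eta> \<cdot> \<epsilon> \<cdot> ret e \<cdot> ret e')))) 0"],
    code_simp, use inverse_if_funext [OF assms] section_prop_if_funext [OF assms] retraction_prop_if_funext [OF assms]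
    in simp)

section \<open>The principles as schemas\<close>

lemma derivable_iff:
  assumes T: "is_type [] T"
    and G: "\<And>(I :: nat \<Rightarrow> 'c expr) F. interp I F 0 T = G (I 0) (I 1) (I 2) (F 0)"
  shows "derivable \<S> T \<longleftrightarrow> (\<forall>\<Gamma> A B X P. ty \<S> \<Gamma> A \<longrightarrow> ty \<S> \<Gamma> B \<longrightarrow> ty \<S> \<Gamma> X \<longrightarrow>
    ty \<S> (A # \<Gamma>) P \<longrightarrow> inhabited \<S> \<Gamma> (G A B X P))"
proof
  assume d: "derivable \<S> T"
  show "\<forall>\<Gamma> A B X P. ty \<S> \<Gamma> A \<longrightarrow> ty \<S> \<Gamma> B \<longrightarrow> ty \<S> \<Gamma> X \<longrightarrow>
    ty \<S> (A # \<Gamma>) P \<longrightarrow> inhabited \<S> \<Gamma> (G A B X P)"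
  proof (intro allI impI)
    fix \<Gamma> A B X P assume t: "ty \<S> \<Gamma> A" "ty \<S> \<Gamma> B" "ty \<S> \<Gamma> X" "ty \<S> (A # \<Gamma>) P"
    \<comment> \<open>Index 2 reads \<open>X\<close>, which also serves as the default for all
      further metavariables.\<close>
    let ?I = "(\<lambda>_. X)(0 := A, 1 := B)"
    have "schema_model \<S> \<Gamma> ?I (\<lambda>_. P)"
      using t ctx_of(2) [OF t(1)] by unfold_locales auto
    then have "inhabited \<S> \<Gamma> (interp ?I (\<lambda>_. P) 0 T)" using d by (simp add: derivable_def)
    then show "inhabited \<S> \<Gamma> (G A B X P)" by (simp add: G)
  qed
next
  assume *: "\<forall>\<Gamma> A B X P. ty \<S> \<Gamma> A \<longrightarrow> ty \<S> \<Gamma> B \<longrightarrow> ty \<S> \<Gamma> X \<longrightarrow>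
    ty \<S> (A # \<Gamma>) P \<longrightarrow> inhabited \<S> \<Gamma> (G A B X P)"
  show "derivable \<S> T"
    unfolding derivable_def
  proof (intro allI impI)
    fix \<Gamma> I F assume "schema_model \<S> \<Gamma> I F"
    then interpret schema_model \<S> \<Gamma> I F .
    have "ty \<S> \<Gamma> (interp I F 0 T)" using is_type_sound [OF _ T] base_ctx by simp
    then show "ty \<S> \<Gamma> (interp I F 0 T) \<and> inhabited \<S> \<Gamma> (interp I F 0 T)"
      using * ty_I ty_F by (simp add: G)
  qed
qed

text \<open>Supplies a family over \<open>A\<close> for principles that mention none, so that
  \<open>derivable_iff\<close> can be specialised to them.\<close>

lemma ty_wk1_self: "ty \<S> \<Gamma> A \<Longrightarrow> ty \<S> (A # \<Gamma>) (wk 1 A)"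
  using ctx_of(2) by (blast intro: ty_wk1 ctx_cons)

lemma derivable_iff2:
  assumes "is_type [] T" "\<And>(I :: nat \<Rightarrow> 'c expr) F. interp I F 0 T = G (I 0) (I 1)"
  shows "derivable \<S> T \<longleftrightarrow> (\<forall>\<Gamma> A B. ty \<S> \<Gamma> A \<longrightarrow> ty \<S> \<Gamma> B \<longrightarrow> inhabited \<S> \<Gamma> (G A B))"
  using derivable_iff [of T "\<lambda>A B X P. G A B" \<S>] assms ty_wk1_self by metis

lemmas schema_defs = spi_def slam_def sapp_def ssig_def spair_def sfst_def ssnd_def sid_def srefl_def
  sJ_def styp_def sfam_def svar_def sarr_def sidm_def scmp_def shtpy_def shapply_def ssec_def sret_def
  sisEquiv_def smkEquiv_def scsec_def scret_def sisCEq_def sisProp_def sisContr_def c1_def c2_def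
  c3_def c4_def shasSection_def sEqv_def sCEq_def isCEq_to_isEquiv_def sCEqToEq_def spostcomp_def
  htpy_id_schema_def isEquiv_isProp_schema_def isCEq_schema_def postcomp_schema_def
  weak_funext_schema_def funext_schema_def

lemmas notion_defs = arr_def idm_def cmp_def htpy_def happly_def isEquiv_def isCEq_def Eqv_def CEq_def
  CEqToEq_def isProp_def isContr_def postcomp_def hasSection_def Let_def wk_def wk1_def

lemmas interp_simps = schema_defs notion_defs ren_ren numeral_eq_Suc ren_id

lemma CEqToEq_equiv_iff:
  "CEqToEq_equiv \<S> \<longleftrightarrow> derivable \<S> (sisEquiv (sCEq tA tB) (sEqv tA tB) (sCEqToEq tA tB) 0)"
  unfolding CEqToEq_equiv_def
proof (rule derivable_iff2 [symmetric])
  show "is_type [] (sisEquiv (sCEq tA tB) (sEqv tA tB) (sCEqToEq tA tB) 0)" by code_simp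
qed (simp add: interp_simps)

lemma CEqToEq_section_iff:
  "CEqToEq_section \<S> \<longleftrightarrow> derivable \<S> (shasSection (sCEq tA tB) (sEqv tA tB) (sCEqToEq tA tB) 0)"
  unfolding CEqToEq_section_def
proof (rule derivable_iff2 [symmetric])
  show "is_type [] (shasSection (sCEq tA tB) (sEqv tA tB) (sCEqToEq tA tB) 0)" by code_simp
qed (simp add: interp_simps)

lemma isEquiv_isProp_iff: "isEquiv_isProp \<S> \<longleftrightarrow> derivable \<S> (isEquiv_isProp_schema tA tB 0)"
  unfolding isEquiv_isProp_def
proof (rule derivable_iff2 [symmetric])
  show "is_type [] (isEquiv_isProp_schema tA tB 0)" by code_simp
qed (simp add: interp_simps)

lemma isEquiv_imp_isCEq_iff: "isEquiv_imp_isCEq \<S> \<longleftrightarrow> derivable \<S> (isCEq_schema tA tB 0)"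
  unfolding isEquiv_imp_isCEq_def
proof (rule derivable_iff2 [symmetric])
  show "is_type [] (isCEq_schema tA tB 0)" by code_simp
qed (simp add: interp_simps)

lemma htpy_id_imp_eq_id_iff: "htpy_id_imp_eq_id \<S> \<longleftrightarrow> derivable \<S> (htpy_id_schema tA 0)"
proof -
  let ?G = "\<lambda>A. Pi (A \<Rrightarrow> A) (htpy (wk 1 A) (wk 2 A) (Var 0) (idm (wk 1 A)) \<Rrightarrow>
        Idt (wk 1 A \<Rrightarrow> wk 1 A) (Var 0) (idm (wk 1 A))) :: 'a expr"
  have "derivable \<S> (htpy_id_schema tA 0) \<longleftrightarrow>
      (\<forall>\<Gamma> A B. ty \<S> \<Gamma> A \<longrightarrow> ty \<S> \<Gamma> B \<longrightarrow> inhabited \<S> \<Gamma> (?G A))"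
  proof (rule derivable_iff2)
    show "is_type [] (htpy_id_schema tA 0)" by code_simp
  qed (simp add: interp_simps)
  then show ?thesis unfolding htpy_id_imp_eq_id_def by blast
qed

lemma postcomp_isEquiv_iff: "postcomp_isEquiv \<S> \<longleftrightarrow> derivable \<S> (postcomp_schema tA tB tX 0)"
proof -
  let ?G = "\<lambda>A B X. Pi (A \<Rrightarrow> B) (isEquiv (wk 1 A) (wk 1 B) (Var 0) \<Rrightarrow>
        isEquiv (wk 1 X \<Rrightarrow> wk 1 A) (wk 1 X \<Rrightarrow> wk 1 B) (postcomp (wk 1 X) (wk 1 A) (Var 0))) :: 'a expr"
  have "derivable \<S> (postcomp_schema tA tB tX 0) \<longleftrightarrow>
      (\<forall>\<Gamma> A B X P. ty \<S> \<Gamma> A \<longrightarrow> ty \<S> \<Gamma> B \<longrightarrow> ty \<S> \<Gamma> X \<longrightarrow> ty \<S> (A # \<Gamma>) P \<longrightarrow> inhabited \<S> \<Gamma> (?G A B X))"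
  proof (rule derivable_iff)
    show "is_type [] (postcomp_schema tA tB tX 0)" by code_simp
  qed (simp add: interp_simps)
  then show ?thesis unfolding postcomp_isEquiv_def using ty_wk1_self by metis
qed

text \<open>A family metavariable applied to a variable is interpreted by a substitution of
  variables. As a renaming it can be matched with the weakenings \<open>wk\<close> and
  \<open>wk1\<close> of the stated principles.\<close>

lemma sub_case_Var:
  fixes t :: "'c expr"
  shows "sub (case_nat (Var k) (\<lambda>i. Var (f i))) t = ren (case_nat k f) t"
proof -
  have "case_nat (Var k) (\<lambda>i. Var (f i)) = (\<lambda>i. Var (case_nat k f i) :: 'c expr)"
    by (simp add: fun_eq_iff split: nat.split)
  then show ?thesis by (simp only: sub_Var_ren)
qed

lemma case_nat_shift:
  "case_nat (Suc 0) (\<lambda>i. Suc (Suc i)) = Suc"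
  "case_nat (Suc (Suc 0)) (\<lambda>i. Suc (Suc (Suc i))) = (\<lambda>i. Suc (Suc i))"
  by (simp_all add: fun_eq_iff split: nat.split)

lemma case_nat_upr: "case_nat 0 (\<lambda>i. Suc (\<rho> i)) = upr \<rho>"
  by (simp add: upr_def)

lemma weak_funext_iff: "weak_funext \<S> \<longleftrightarrow> derivable \<S> (weak_funext_schema tA tP 0)"
proof -
  have "derivable \<S> (weak_funext_schema tA tP 0) \<longleftrightarrow>
      (\<forall>\<Gamma> A B X P. ty \<S> \<Gamma> A \<longrightarrow> ty \<S> \<Gamma> B \<longrightarrow> ty \<S> \<Gamma> X \<longrightarrow> ty \<S> (A # \<Gamma>) P \<longrightarrow>
        inhabited \<S> \<Gamma> (Pi A (isContr P) \<Rrightarrow> isContr (Pi A P)))"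
  proof (rule derivable_iff)
    show "is_type [] (weak_funext_schema tA tP 0)" by code_simp
  qed (simp add: interp_simps sub_case_Var case_nat_shift case_nat_upr upr_upr upr_id)
  then show ?thesis unfolding weak_funext_def by blast
qed

lemma funext_iff: "funext \<S> \<longleftrightarrow> derivable \<S> (funext_schema tA tP 0)"
proof -
  let ?G = "\<lambda>A B. Pi (Pi A B) (Pi (wk 1 (Pi A B))
       (isEquiv (Idt (wk 2 (Pi A B)) (Var 1) (Var 0)) (htpy (wk 2 A) (wk1 2 B) (Var 1) (Var 0))
                (happly (wk 2 A) (wk1 2 B) (Var 1) (Var 0)))) :: 'a expr"
  have "derivable \<S> (funext_schema tA tP 0) \<longleftrightarrow>
      (\<forall>\<Gamma> A B X P. ty \<S> \<Gamma> A \<longrightarrow> ty \<S> \<Gamma> B \<longrightarrow> ty \<S> \<Gamma> X \<longrightarrow> ty \<S> (A # \<Gamma>) P \<longrightarrow> inhabited \<S> \<Gamma> (?G A P))"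
  proof (rule derivable_iff)
    show "is_type [] (funext_schema tA tP 0)" by code_simp
  qed (simp add: interp_simps sub_case_Var case_nat_shift case_nat_upr upr_upr upr_id)
  then show ?thesis unfolding funext_def by blast
qed

section \<open>The theorem\<close>

theorem theorem2p13:
  fixes \<S> :: "'c \<rightharpoonup> 'c expr"
  shows "(CEqToEq_equiv \<S> \<longleftrightarrow> CEqToEq_section \<S>) \<and>
         (CEqToEq_section \<S> \<longleftrightarrow> isEquiv_isProp \<S>) \<and>
         (isEquiv_isProp \<S> \<longleftrightarrow> htpy_id_imp_eq_id \<S>) \<and>
         (htpy_id_imp_eq_id \<S> \<longleftrightarrow> isEquiv_imp_isCEq \<S>) \<and>
         (isEquiv_imp_isCEq \<S> \<longleftrightarrow> postcomp_isEquiv \<S>) \<and>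
         (postcomp_isEquiv \<S> \<longleftrightarrow> weak_funext \<S>) \<and>
         (weak_funext \<S> \<longleftrightarrow> funext \<S>)"
  using CEqToEq_section_if_equiv [of \<S>] isCEq_if_CEqToEq_section [of \<S>] postcomp_if_isCEq [of \<S>]
    htpy_id_if_postcomp [of \<S>] weak_funext_if_htpy_id [of \<S>] funext_if_weak_funext [of \<S>]
    CEqToEq_equiv_if_funext [of \<S>] isEquiv_isProp_if_funext [of \<S>] htpy_id_if_isEquiv_isProp [of \<S>]
  unfolding CEqToEq_equiv_iff CEqToEq_section_iff isEquiv_isProp_iff htpy_id_imp_eq_id_iff
    isEquiv_imp_isCEq_iff postcomp_isEquiv_iff weak_funext_iff funext_iff
  by blast

end
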